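(* Any closed $\mathrm{SU}(2)$-invariant 3-form $\Omega$ on the total space $P$ of the principal bundle $P\to M$ can be written as $$\Omega=CS(W)+\omega+db$$ for some $\mathrm{SU}(2)$ connection $W$ on $P$, a representative $\omega$, $d\omega=0$, of $H^3(M)$ (a closed 3-form on $M$), and a 2-form field $b\in\Lambda^2(M)$ on the base (with $\omega$ and $db$ pulled back to $P$).
   Context: $M$ is a smooth 3-dimensional manifold and $P\to M$ is a principal $\mathrm{SU}(2)$ bundle (right action), necessarily trivial, so $P$ is 6-dimensional. $\mathfrak{su}(2)$ consists of tracefree anti-hermitian $2\times2$ matrices; products of matrix-valued forms combine matrix product and wedge product. A connection is viewed as an $\mathfrak{su}(2)$-valued 1-form $W$ on $P$; in a trivialisation with fibre coordinate $g\in\mathrm{SU}(2)$ it has the form $W=g^{-1}\mathbf{w}g+g^{-1}dg$, where $\mathbf{w}$ is an $\mathfrak{su}(2)$-valued 1-form on $M$. The Chern-Simons 3-form is $CS(W)=\mathrm{Tr}\left(W\wedge dW+\frac23W\wedge W\wedge W\right)$. Invariance of $\Omega$ means invariance under the right $\mathrm{SU}(2)$ action on $P$.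
   Formalization: Adds the necessary hypothesis that Ω restricts on each fibre to −1/3 Tr((g⁻¹dg)³), the fibre part of every CS(W); without it the claim fails, e.g. for Ω = 0. *)

theory Defs
  imports "HOL-Analysis.Analysis"
begin

section \<open>Smooth maps between subsets of Euclidean spaces\<close>

text \<open>Intended for open sets; continuity of the iterated directional derivatives in all
  directions is the usual notion of class \<open>C^n\<close> in finite dimension.\<close>

primrec Ck_on :: "nat \<Rightarrow> 'a::euclidean_space set \<Rightarrow> ('a \<Rightarrow> 'b::real_normed_vector) \<Rightarrow> bool" where
  "Ck_on 0 = (\<lambda>S f. continuous_on S f)"
| "Ck_on (Suc n) = (\<lambda>S f. (\<forall>x\<in>S. f differentiable (at x)) \<and>
     (\<forall>v. Ck_on n S (\<lambda>x. frechet_derivative f (at x) v)))"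

text \<open>Smoothness on an arbitrary set means existence of smooth local extensions. On an open set
  this is ordinary smoothness; on \<open>U \<times> SU(2)\<close> it is smoothness for the submanifold structure.\<close>

definition smooth_on :: "'a::euclidean_space set \<Rightarrow> ('a \<Rightarrow> 'b::real_normed_vector) \<Rightarrow> bool" where
  "smooth_on S f \<longleftrightarrow> (\<forall>x\<in>S. \<exists>N F. open N \<and> x \<in> N \<and> (\<forall>k. Ck_on k N F) \<and>
     (\<forall>y\<in>S \<inter> N. F y = f y))"


section \<open>Smooth manifolds\<close>

text \<open>A chart is a domain together with a coordinate map; values of the coordinate map outside
  the domain are irrelevant.\<close>

type_synonym ('m, 'e) chart = "'m set \<times> ('m \<Rightarrow> 'e)"

abbreviation cdom :: "('m, 'e) chart \<Rightarrow> 'm set" where "cdom c \<equiv> fst c"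
abbreviation coord :: "('m, 'e) chart \<Rightarrow> 'm \<Rightarrow> 'e" where "coord c \<equiv> snd c"
abbreviation param :: "('m, 'e) chart \<Rightarrow> 'e \<Rightarrow> 'm" where "param c \<equiv> inv_into (fst c) (snd c)"

definition is_chart :: "('m::topological_space, 'e::euclidean_space) chart \<Rightarrow> bool" where
  "is_chart c \<longleftrightarrow> open (cdom c) \<and> open (coord c ` cdom c) \<and>
     homeomorphism (cdom c) (coord c ` cdom c) (coord c) (param c)"

definition smooth_atlas :: "('m::topological_space, 'e::euclidean_space) chart set \<Rightarrow> bool" where
  "smooth_atlas A \<longleftrightarrow> (\<forall>c\<in>A. is_chart c) \<and> (\<Union>c\<in>A. cdom c) = UNIV \<and>
     (\<forall>c\<in>A. \<forall>c'\<in>A. smooth_on (coord c ` (cdom c \<inter> cdom c')) (coord c' \<circ> param c))"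

text \<open>Smoothness of a map on an open subset \<open>S\<close>.\<close>

definition smooth_map :: "('m::topological_space, 'e::euclidean_space) chart set \<Rightarrow>
    ('n::topological_space, 'f::euclidean_space) chart set \<Rightarrow> 'm set \<Rightarrow> ('m \<Rightarrow> 'n) \<Rightarrow> bool" where
  "smooth_map A B S f \<longleftrightarrow> continuous_on S f \<and>
     (\<forall>c\<in>A. \<forall>c'\<in>B. smooth_on (coord c ` {x \<in> cdom c \<inter> S. f x \<in> cdom c'})
        (coord c' \<circ> f \<circ> param c))"

definition std_atlas :: "('e::euclidean_space, 'e) chart set" where
  "std_atlas = {(UNIV, \<lambda>x. x)}"


section \<open>Differential forms\<close>

text \<open>A form is given by its coordinate representatives: \<open>\<omega> c u [v\<^sub>1, \<dots>, v\<^sub>k]\<close> is the value of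
  \<open>\<omega>\<close> at the point with coordinates \<open>u\<close> in the chart \<open>c\<close>, on the tangent vectors with
  components \<open>v\<^sub>1, \<dots>, v\<^sub>k\<close> in that chart. Only the values at \<open>c\<close> in the atlas,
  \<open>u\<close> in the image of \<open>c\<close> and lists of length \<open>k\<close> are meaningful.\<close>

type_synonym ('m, 'e, 'v) form = "('m, 'e) chart \<Rightarrow> 'e \<Rightarrow> 'e list \<Rightarrow> 'v"

definition alternating :: "nat \<Rightarrow> ('e::real_vector list \<Rightarrow> 'v::real_vector) \<Rightarrow> bool" where
  "alternating k f \<longleftrightarrow> (\<forall>vs. length vs = k \<longrightarrow>
     (\<forall>i<k. linear (\<lambda>v. f (vs[i := v]))) \<and>
     (\<forall>i<k. \<forall>j<k. i \<noteq> j \<and> vs ! i = vs ! j \<longrightarrow> f vs = 0))"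

text \<open>Smooth \<open>k\<close>-forms on an open subset \<open>S\<close>; the last conjunct is the transformation law under
  change of charts.\<close>

definition k_form :: "('m::topological_space, 'e::euclidean_space) chart set \<Rightarrow> 'm set \<Rightarrow> nat \<Rightarrow>
    ('m, 'e, 'v::real_normed_vector) form \<Rightarrow> bool" where
  "k_form A S k \<omega> \<longleftrightarrow>
     (\<forall>c\<in>A. \<forall>u \<in> coord c ` (cdom c \<inter> S). alternating k (\<omega> c u)) \<and>
     (\<forall>c\<in>A. \<forall>vs. length vs = k \<longrightarrow> smooth_on (coord c ` (cdom c \<inter> S)) (\<lambda>u. \<omega> c u vs)) \<and>
     (\<forall>c\<in>A. \<forall>c'\<in>A. \<forall>u \<in> coord c ` (cdom c \<inter> cdom c' \<inter> S). \<forall>vs. length vs = k \<longrightarrow>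
        \<omega> c u vs = \<omega> c' (coord c' (param c u))
          (map (frechet_derivative (coord c' \<circ> param c) (at u)) vs))"

definition form_eq :: "('m, 'e) chart set \<Rightarrow> nat \<Rightarrow> ('m, 'e, 'v) form \<Rightarrow> ('m, 'e, 'v) form \<Rightarrow> bool"
  where
  "form_eq A k \<alpha> \<beta> \<longleftrightarrow>
     (\<forall>c\<in>A. \<forall>u \<in> coord c ` cdom c. \<forall>vs. length vs = k \<longrightarrow> \<alpha> c u vs = \<beta> c u vs)"

text \<open>The chart chosen around the image point is immaterial, by the transformation law.\<close>

definition pullback :: "('n, 'f::euclidean_space) chart set \<Rightarrow> ('m \<Rightarrow> 'n) \<Rightarrow>
    ('n, 'f, 'v) form \<Rightarrow> ('m, 'e::euclidean_space, 'v) form" where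
  "pullback B f \<omega> = (\<lambda>c u vs.
     let c' = (SOME c'. c' \<in> B \<and> f (param c u) \<in> cdom c')
     in \<omega> c' (coord c' (f (param c u)))
          (map (frechet_derivative (coord c' \<circ> f \<circ> param c) (at u)) vs))"

text \<open>Exterior derivative:
  \<open>d\<omega>(v\<^sub>0, \<dots>, v\<^sub>k) = \<Sum>\<^sub>i (-1)^i D\<^bsub>v\<^sub>i\<^esub> \<omega>(v\<^sub>0, \<dots>, omit v\<^sub>i, \<dots>, v\<^sub>k)\<close>.\<close>

definition ext_d :: "('m, 'e::euclidean_space, 'v::real_normed_vector) form \<Rightarrow> ('m, 'e, 'v) form"
  where
  "ext_d \<omega> = (\<lambda>c u vs. \<Sum>i<length vs. (-1) ^ i *\<^sub>R
     frechet_derivative (\<lambda>y. \<omega> c y (take i vs @ drop (Suc i) vs)) (at u) (vs ! i))"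

definition closed_form :: "('m, 'e::euclidean_space) chart set \<Rightarrow> nat \<Rightarrow>
    ('m, 'e, 'v::real_normed_vector) form \<Rightarrow> bool" where
  "closed_form A k \<omega> \<longleftrightarrow> form_eq A (Suc k) (ext_d \<omega>) (\<lambda>c u vs. 0)"

text \<open>Wedge product of a matrix-valued \<open>k\<close>-form and a matrix-valued \<open>l\<close>-form, normalised so that
  \<open>(\<alpha> \<and> \<beta>)(v, w) = \<alpha>(v) \<beta>(w) - \<alpha>(w) \<beta>(v)\<close> for 1-forms.\<close>

definition wedge :: "nat \<Rightarrow> nat \<Rightarrow> ('m, 'e, complex^'n^'n) form \<Rightarrow> ('m, 'e, complex^'n^'n) form \<Rightarrow>
    ('m, 'e, complex^'n^'n) form" where
  "wedge k l \<alpha> \<beta> = (\<lambda>c u vs. (1 / (fact k * fact l)) *\<^sub>R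
     (\<Sum>p | p permutes {..<k + l}. of_int (sign p) *\<^sub>R
        (\<alpha> c u (map (\<lambda>i. vs ! p i) [0..<k]) ** \<beta> c u (map (\<lambda>i. vs ! p i) [k..<k + l]))))"


section \<open>Principal \<open>SU(2)\<close> bundles, connections, the Chern-Simons form\<close>

definition conj_transpose :: "complex^'n^'m \<Rightarrow> complex^'m^'n" where
  "conj_transpose A = (\<chi> i j. cnj (A $ j $ i))"

definition SU2 :: "(complex^2^2) set" where
  "SU2 = {g. conj_transpose g ** g = mat 1 \<and> det g = 1}"

definition su2 :: "(complex^2^2) set" where
  "su2 = {X. conj_transpose X = - X \<and> trace X = 0}"

text \<open>A local trivialisation over \<open>U\<close>: the maps \<open>(x, g) \<mapsto> act (s x) g\<close> and \<open>q \<mapsto> (\<pi> q, \<gamma> q)\<close> are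
  smooth mutually inverse bijections between \<open>U \<times> SU(2)\<close> and the part of the bundle over \<open>U\<close>.
  Given that \<open>act\<close> is a smooth fibre-preserving right action, the first one is equivariant, and it
  is smooth iff the section \<open>s\<close> is. The fibre coordinate is \<open>\<gamma>\<close>.\<close>

definition local_triv :: "('m::topological_space, 'e::euclidean_space) chart set \<Rightarrow>
    ('p::topological_space, 'f::euclidean_space) chart set \<Rightarrow> ('p \<Rightarrow> 'm) \<Rightarrow>
    ('p \<Rightarrow> complex^2^2 \<Rightarrow> 'p) \<Rightarrow> 'm set \<Rightarrow> ('m \<Rightarrow> 'p) \<Rightarrow> ('p \<Rightarrow> complex^2^2) \<Rightarrow> bool" where
  "local_triv AM AP \<pi> act U s \<gamma> \<longleftrightarrow> open U \<and>
     smooth_map AM AP U s \<and> smooth_map AP std_atlas (\<pi> -` U) \<gamma> \<and> \<gamma> ` (\<pi> -` U) \<subseteq> SU2 \<and>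
     (\<forall>x\<in>U. \<pi> (s x) = x) \<and>
     (\<forall>x\<in>U. \<forall>g\<in>SU2. \<gamma> (act (s x) g) = g) \<and>
     (\<forall>q \<in> \<pi> -` U. act (s (\<pi> q)) (\<gamma> q) = q)"

locale principal_SU2_bundle =
  fixes AM :: "('m::{t2_space,second_countable_topology}, 'e::euclidean_space) chart set"
    and AP :: "('p::{t2_space,second_countable_topology}, 'f::euclidean_space) chart set"
    and \<pi> :: "'p \<Rightarrow> 'm"
    and act :: "'p \<Rightarrow> complex^2^2 \<Rightarrow> 'p"
  assumes base_atlas: "smooth_atlas AM"
    and total_atlas: "smooth_atlas AP"
    and proj_smooth: "smooth_map AP AM UNIV \<pi>"
    and act_one: "act q (mat 1) = q"
    and act_mult: "g \<in> SU2 \<Longrightarrow> h \<in> SU2 \<Longrightarrow> act (act q g) h = act q (g ** h)"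
    and proj_act: "g \<in> SU2 \<Longrightarrow> \<pi> (act q g) = \<pi> q"
    and act_continuous: "continuous_on (UNIV \<times> SU2) (\<lambda>(q, g). act q g)"
    and act_smooth: "c \<in> AP \<Longrightarrow> c' \<in> AP \<Longrightarrow>
      smooth_on {(coord c q, g) | q g. q \<in> cdom c \<and> g \<in> SU2 \<and> act q g \<in> cdom c'}
        (\<lambda>(u, g). coord c' (act (param c u) g))"
    and locally_trivial: "\<exists>U s \<gamma>. x \<in> U \<and> local_triv AM AP \<pi> act U s \<gamma>"

definition invariant_form :: "('p, 'f::euclidean_space) chart set \<Rightarrow> ('p \<Rightarrow> complex^2^2 \<Rightarrow> 'p) \<Rightarrow>
    nat \<Rightarrow> ('p, 'f, 'v) form \<Rightarrow> bool" where
  "invariant_form AP act k \<omega> \<longleftrightarrow> (\<forall>g\<in>SU2. form_eq AP k (pullback AP (\<lambda>q. act q g) \<omega>) \<omega>)"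

text \<open>The 1-form \<open>g\<^sup>-\<^sup>1 dg\<close> for a fibre coordinate \<open>g = \<gamma>\<close>.\<close>

definition maurer_cartan :: "('p \<Rightarrow> complex^2^2) \<Rightarrow> ('p, 'f::euclidean_space, complex^2^2) form" where
  "maurer_cartan \<gamma> = (\<lambda>c u vs.
     matrix_inv (\<gamma> (param c u)) ** frechet_derivative (\<gamma> \<circ> param c) (at u) (vs ! 0))"

definition su2_connection :: "('m::topological_space, 'e::euclidean_space) chart set \<Rightarrow>
    ('p::topological_space, 'f::euclidean_space) chart set \<Rightarrow> ('p \<Rightarrow> 'm) \<Rightarrow>
    ('p \<Rightarrow> complex^2^2 \<Rightarrow> 'p) \<Rightarrow> ('p, 'f, complex^2^2) form \<Rightarrow> bool" where
  "su2_connection AM AP \<pi> act W \<longleftrightarrow>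
     k_form AP UNIV 1 W \<and>
     (\<forall>c\<in>AP. \<forall>u \<in> coord c ` cdom c. \<forall>v. W c u [v] \<in> su2) \<and>
     (\<forall>U s \<gamma>. local_triv AM AP \<pi> act U s \<gamma> \<longrightarrow>
        (\<exists>w. k_form AM U 1 w \<and>
           (\<forall>c\<in>AM. \<forall>u \<in> coord c ` (cdom c \<inter> U). \<forall>v. w c u [v] \<in> su2) \<and>
           (\<forall>c\<in>AP. \<forall>u \<in> coord c ` (cdom c \<inter> \<pi> -` U). \<forall>v.
              W c u [v] = matrix_inv (\<gamma> (param c u)) ** pullback AM \<pi> w c u [v] ** \<gamma> (param c u)
                + maurer_cartan \<gamma> c u [v])))"

definition chern_simons :: "('p, 'f::euclidean_space, complex^2^2) form \<Rightarrow> ('p, 'f, complex) form"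
  where
  "chern_simons W = (\<lambda>c u vs. trace (wedge 1 2 W (ext_d W) c u vs
     + (2/3) *\<^sub>R wedge 2 1 (wedge 1 1 W W) W c u vs))"

text \<open>Every connection \<open>W\<close> restricts to \<open>m = g\<^sup>-\<^sup>1 dg\<close> on the fibres, and \<open>dm = - m \<and> m\<close>, so the
  restriction of \<open>chern_simons W\<close> to each fibre is \<open>- 1/3 Tr (m \<and> m \<and> m)\<close>, whatever \<open>W\<close> is, and
  forms pulled back from the base restrict to 0. The following predicate fixes the constant
  multiple of this fibre volume form correspondingly; tangent vectors to the fibres are those
  annihilated by the differential of \<open>\<pi>\<close>.\<close>

definition vertical :: "('m, 'e::euclidean_space) chart set \<Rightarrow> ('p \<Rightarrow> 'm) \<Rightarrow>
    ('p, 'f::euclidean_space) chart \<Rightarrow> 'f \<Rightarrow> 'f \<Rightarrow> bool" where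
  "vertical AM \<pi> c u v \<longleftrightarrow> (\<forall>c'\<in>AM. \<pi> (param c u) \<in> cdom c' \<longrightarrow>
     frechet_derivative (coord c' \<circ> \<pi> \<circ> param c) (at u) v = 0)"

definition fibre_normalised :: "('m::topological_space, 'e::euclidean_space) chart set \<Rightarrow>
    ('p::topological_space, 'f::euclidean_space) chart set \<Rightarrow> ('p \<Rightarrow> 'm) \<Rightarrow>
    ('p \<Rightarrow> complex^2^2 \<Rightarrow> 'p) \<Rightarrow> ('p, 'f, real) form \<Rightarrow> bool" where
  "fibre_normalised AM AP \<pi> act \<Omega> \<longleftrightarrow>
     (\<forall>U s \<gamma>. local_triv AM AP \<pi> act U s \<gamma> \<longrightarrow>
        (\<forall>c\<in>AP. \<forall>u \<in> coord c ` (cdom c \<inter> \<pi> -` U). \<forall>vs.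
           length vs = 3 \<and> (\<forall>v \<in> set vs. vertical AM \<pi> c u v) \<longrightarrow>
           complex_of_real (\<Omega> c u vs) =
             - (1/3) * trace (wedge 2 1 (wedge 1 1 (maurer_cartan \<gamma>) (maurer_cartan \<gamma>))
                               (maurer_cartan \<gamma>) c u vs)))"

end

theory Submission
  imports Defs
begin

text \<open>The fundamental vector fields \<open>\<xi>\<^sub>X\<close> of the action determine the connection: for the
  Chern-Simons form of a connection \<open>W\<close> one has \<open>CS(W)(v, \<xi>\<^sub>X, \<xi>\<^sub>Y) = - Tr (W(v) [X, Y])\<close>, and the
  right-hand side determines \<open>W(v)\<close>. So one defines \<open>W\<close> globally by
  \<open>\<Omega>(v, \<xi>\<^sub>X, \<xi>\<^sub>Y) = - Tr (W(v) [X, Y])\<close>; the normalisation of \<open>\<Omega>\<close> on the fibres gives \<open>W(\<xi>\<^sub>X) = X\<close> and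
  invariance gives equivariance, so \<open>W\<close> is a connection. By Cartan's formula the 2-forms
  \<open>\<Omega>(\<xi>\<^sub>Z, \<cdot>, \<cdot>)\<close> are closed, and contracting once more with a fundamental field yields
  \<open>\<Omega>(\<xi>\<^sub>Z, v, w) = Tr (Z dW(v, w))\<close>. Substituting this into \<open>CS(W)\<close>, the difference \<open>\<Omega> - CS(W)\<close> turns
  out to be \<open>\<Omega>\<close> evaluated on the horizontal parts of its arguments. This form is horizontal and
  invariant, hence the pullback of a 3-form on the base, which is closed for reasons of dimension;
  \<open>b\<close> can be taken to be 0.\<close>

section \<open>Smooth maps on open sets\<close>

text \<open>The main obstacle is that \<open>SU2\<close> has empty interior among the matrices, so
  the action cannot be differentiated directly in its group argument. That argument is therefore
  passed through a retraction of an open set of matrices onto \<open>SU2\<close>. Read a matrix as a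
  pair of quaternions, drop the second one and normalise the first: both operations commute with
  translations by unit quaternions, so the extended action keeps its algebraic identities.
  Fundamental fields, their brackets and Lie derivatives then become first and second partial
  derivatives of one smooth map, and every identity between them comes from uniqueness of
  derivatives and symmetry of second derivatives. That \<Omega>(v, \<xi>_X, \<xi>_Y) has exactly the
  size of an \<open>su2\<close> element is special to dimension three: the commutator is, up to a
  factor, the cross product, so an alternating form in X and Y is a vector. Cartan's formula appears
  in coordinates: closedness is evaluated on constant vectors v, w and on the values of two
  fundamental fields, and the derivatives of these fields cancel except for their bracket.\<close>

lemma Ck_on_cong:
  assumes "open S" "Ck_on n S f" "\<And>x. x \<in> S \<Longrightarrow> f x = g x"
  shows "Ck_on n S g"
  using assms(2,3)
proof (induction n arbitrary: f g)
  case 0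
  then show ?case using continuous_on_cong[of S S f g] by simp
next
  case (Suc n)
  have d: "f differentiable at x" if "x \<in> S" for x
    using Suc.prems that by simp
  have "(g has_derivative frechet_derivative f (at x)) (at x)" if "x \<in> S" for x
    using has_derivative_transform_within_open[OF d[OF that, unfolded frechet_derivative_works] \<open>open S\<close> that]
      Suc.prems(2) by auto
  then have g: "g differentiable at x" "frechet_derivative f (at x) = frechet_derivative g (at x)"
    if "x \<in> S" for x
    using that frechet_derivative_at unfolding differentiable_def by blast+
  have "Ck_on n S (\<lambda>x. frechet_derivative g (at x) v)" for v
    by (rule Suc.IH[where f = "\<lambda>x. frechet_derivative f (at x) v"]) (use Suc.prems g in auto)
  with g show ?case by simp
qed

lemma Ck_on_subset: "Ck_on n S f \<Longrightarrow> T \<subseteq> S \<Longrightarrow> Ck_on n T f"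
  by (induction n arbitrary: f) (auto intro: continuous_on_subset)

lemma Ck_on_Suc_imp: "Ck_on (Suc n) S f \<Longrightarrow> Ck_on n S f"
proof (induction n arbitrary: f)
  case 0
  then show ?case
    by (auto intro!: continuous_at_imp_continuous_on differentiable_imp_continuous_within)
next
  case (Suc n)
  show ?case
    using Suc.prems Suc.IH[of "\<lambda>x. frechet_derivative f (at x) _"] by simp
qed

lemma Ck_on_local:
  assumes "\<And>x. x \<in> S \<Longrightarrow> \<exists>T. open T \<and> x \<in> T \<and> Ck_on n T f"
  shows "Ck_on n S f"
  using assms
proof (induction n arbitrary: f)
  case 0
  show ?case
  proof (rule continuous_at_imp_continuous_on[THEN Ck_on.simps(1)[THEN fun_cong, THEN fun_cong, THEN iffD2]], rule ballI)
    fix x assume "x \<in> S"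
    then obtain T where "open T" "x \<in> T" "continuous_on T f" using 0 by auto
    then show "isCont f x" by (simp add: continuous_on_eq_continuous_at)
  qed
next
  case (Suc n)
  have "f differentiable (at x)" if "x \<in> S" for x using Suc.prems[OF that] by auto
  moreover have "Ck_on n S (\<lambda>x. frechet_derivative f (at x) v)" for v
    by (rule Suc.IH) (use Suc.prems in fastforce)
  ultimately show ?case by simp
qed

lemma Ck_on_const: "Ck_on n S (\<lambda>x. c)"
  by (induction n arbitrary: c) auto

lemma Ck_on_bounded_linear: "bounded_linear L \<Longrightarrow> Ck_on n S L"
proof (cases n)
  case 0
  then show "bounded_linear L \<Longrightarrow> Ck_on n S L" by (simp add: linear_continuous_on)
next
  case (Suc m)
  assume L: "bounded_linear L"
  have "frechet_derivative L (at x) = L" for x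
    using frechet_derivative_at[OF bounded_linear_imp_has_derivative[OF L]] by simp
  then show "Ck_on n S L" using Suc L by (simp add: bounded_linear_imp_differentiable Ck_on_const)
qed

lemma Ck_on_add:
  assumes "open S" "Ck_on n S f" "Ck_on n S g"
  shows "Ck_on n S (\<lambda>x. f x + g x)"
  using assms(2,3)
proof (induction n arbitrary: f g)
  case 0
  then show ?case by (auto intro: continuous_on_add)
next
  case (Suc n)
  have D: "((\<lambda>x. f x + g x) has_derivative (\<lambda>v. frechet_derivative f (at x) v + frechet_derivative g (at x) v)) (at x)"
    if "x \<in> S" for x
    using Suc.prems that by (auto intro!: has_derivative_add simp: frechet_derivative_works[symmetric])
  have "Ck_on n S (\<lambda>x. frechet_derivative (\<lambda>x. f x + g x) (at x) v)" for v
    by (rule Ck_on_cong[OF \<open>open S\<close> Suc.IH[of "\<lambda>x. frechet_derivative f (at x) v" "\<lambda>x. frechet_derivative g (at x) v"]])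
      (use Suc.prems D[THEN frechet_derivative_at] in \<open>auto simp: fun_eq_iff\<close>)
  with D show ?case unfolding Ck_on.simps differentiable_def by blast
qed

lemma Ck_on_bilinear:
  assumes "bounded_bilinear B" "open S" "Ck_on n S f" "Ck_on n S g"
  shows "Ck_on n S (\<lambda>x. B (f x) (g x))"
  using assms(3,4)
proof (induction n arbitrary: f g)
  case 0
  then show ?case by (auto intro: bounded_bilinear.continuous_on[OF assms(1)])
next
  case (Suc n)
  have D: "((\<lambda>x. B (f x) (g x)) has_derivative (\<lambda>v. B (f x) (frechet_derivative g (at x) v)
      + B (frechet_derivative f (at x) v) (g x))) (at x)"
    if "x \<in> S" for x
    using Suc.prems that
    by (auto intro!: bounded_bilinear.FDERIV[OF assms(1)] simp: frechet_derivative_works[symmetric])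
  have "Ck_on n S (\<lambda>x. frechet_derivative (\<lambda>x. B (f x) (g x)) (at x) v)" for v
    by (rule Ck_on_cong[OF \<open>open S\<close> Ck_on_add[OF \<open>open S\<close>
        Suc.IH[of f "\<lambda>x. frechet_derivative g (at x) v"]
        Suc.IH[of "\<lambda>x. frechet_derivative f (at x) v" g]]])
      (use Suc.prems Ck_on_Suc_imp D[THEN frechet_derivative_at] in \<open>auto simp: fun_eq_iff\<close>)
  with D show ?case unfolding Ck_on.simps differentiable_def by blast
qed

lemma Ck_on_linear_comp:
  assumes "bounded_linear L" "open S" "Ck_on n S f"
  shows "Ck_on n S (\<lambda>x. L (f x))"
  using assms(3)
proof (induction n arbitrary: f)
  case 0
  then show ?case by (auto intro: bounded_linear.continuous_on[OF assms(1)])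
next
  case (Suc n)
  have D: "((\<lambda>x. L (f x)) has_derivative (\<lambda>v. L (frechet_derivative f (at x) v))) (at x)"
    if "x \<in> S" for x
    using Suc.prems that
    by (auto intro!: bounded_linear.has_derivative[OF assms(1)] simp: frechet_derivative_works[symmetric])
  have "Ck_on n S (\<lambda>x. frechet_derivative (\<lambda>x. L (f x)) (at x) v)" for v
    by (rule Ck_on_cong[OF \<open>open S\<close> Suc.IH[of "\<lambda>x. frechet_derivative f (at x) v"]])
      (use Suc.prems D[THEN frechet_derivative_at] in \<open>auto simp: fun_eq_iff\<close>)
  with D show ?case unfolding Ck_on.simps differentiable_def by blast
qed

lemma Ck_on_sum:
  assumes "finite I" "open S" "\<And>i. i \<in> I \<Longrightarrow> Ck_on n S (f i)"
  shows "Ck_on n S (\<lambda>x. \<Sum>i\<in>I. f i x)"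
  using assms(1,3) by (induction I rule: finite_induct) (auto intro: Ck_on_const Ck_on_add[OF \<open>open S\<close>])

lemma Ck_on_compose:
  fixes f :: "'b::euclidean_space \<Rightarrow> 'c::real_normed_vector" and g :: "'a::euclidean_space \<Rightarrow> 'b"
  assumes "open S" "open T" "g ` S \<subseteq> T" "Ck_on n T f" "Ck_on n S g"
  shows "Ck_on n S (\<lambda>x. f (g x))"
  using assms(4,5)
proof (induction n arbitrary: f)
  case 0
  then show ?case using assms(3) by (auto intro: continuous_on_compose2)
next
  case (Suc n)
  have D: "((\<lambda>x. f (g x)) has_derivative (\<lambda>v. frechet_derivative f (at (g x)) (frechet_derivative g (at x) v))) (at x)"
    if "x \<in> S" for x
    using has_derivative_compose[of g "frechet_derivative g (at x)" x UNIV f "frechet_derivative f (at (g x))"] Suc.prems that assms(3)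
    by (auto simp: frechet_derivative_works[symmetric] image_subset_iff)
  \<comment> \<open>The direction in which f is differentiated moves with the point, whereas
    \<open>Ck_on\<close> speaks of fixed directions. Expanding it in the basis turns the chain rule
    into a sum of products.\<close>
  have lin: "frechet_derivative f (at (g x)) w = (\<Sum>b\<in>Basis. (w \<bullet> b) *\<^sub>R frechet_derivative f (at (g x)) b)"
    if "x \<in> S" for x w
  proof -
    have "linear (frechet_derivative f (at (g x)))"
      using Suc.prems that assms(3) by (auto intro!: linear_frechet_derivative)
    from linear_sum[OF this, of "\<lambda>b. (w \<bullet> b) *\<^sub>R b" Basis] show ?thesis
      by (simp add: euclidean_representation linear_cmul[OF \<open>linear _\<close>])
  qed
  have "Ck_on n S (\<lambda>x. \<Sum>b\<in>Basis. (frechet_derivative g (at x) v \<bullet> b) *\<^sub>R frechet_derivative f (at (g x)) b)" for v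
  proof (rule Ck_on_sum[OF finite_Basis \<open>open S\<close>], rule Ck_on_bilinear[OF bounded_bilinear_scaleR \<open>open S\<close>])
    fix b :: 'b
    show "Ck_on n S (\<lambda>x. frechet_derivative g (at x) v \<bullet> b)"
      by (rule Ck_on_linear_comp[OF bounded_linear_inner_left \<open>open S\<close>]) (use Suc.prems in simp)
    show "Ck_on n S (\<lambda>x. frechet_derivative f (at (g x)) b)"
      by (rule Suc.IH[of "\<lambda>y. frechet_derivative f (at y) b"]) (use Suc.prems Ck_on_Suc_imp in auto)
  qed
  then have "Ck_on n S (\<lambda>x. frechet_derivative (\<lambda>x. f (g x)) (at x) v)" for v
    by (rule Ck_on_cong[OF \<open>open S\<close>])
      (use D[THEN frechet_derivative_at] lin in \<open>auto simp: fun_eq_iff\<close>)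
  with D show ?case unfolding Ck_on.simps differentiable_def by blast
qed

section \<open>Infinitely differentiable functions on open sets\<close>

definition Cinf_on :: "'a::euclidean_space set \<Rightarrow> ('a \<Rightarrow> 'b::real_normed_vector) \<Rightarrow> bool" where
  "Cinf_on S f \<longleftrightarrow> (\<forall>k. Ck_on k S f)"

lemma Cinf_on_differentiable: "Cinf_on S f \<Longrightarrow> x \<in> S \<Longrightarrow> f differentiable (at x)"
  unfolding Cinf_on_def by (metis Ck_on.simps(2))

lemma Cinf_on_has_derivative:
  "Cinf_on S f \<Longrightarrow> x \<in> S \<Longrightarrow> (f has_derivative frechet_derivative f (at x)) (at x)"
  using Cinf_on_differentiable frechet_derivative_works by blast

lemma Cinf_on_deriv: "Cinf_on S f \<Longrightarrow> Cinf_on S (\<lambda>x. frechet_derivative f (at x) v)"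
  unfolding Cinf_on_def by (metis Ck_on.simps(2))

lemma Cinf_on_continuous: "Cinf_on S f \<Longrightarrow> continuous_on S f"
  unfolding Cinf_on_def by (metis Ck_on.simps(1))

lemma Cinf_on_cong: "open S \<Longrightarrow> Cinf_on S f \<Longrightarrow> (\<And>x. x \<in> S \<Longrightarrow> f x = g x) \<Longrightarrow> Cinf_on S g"
  unfolding Cinf_on_def using Ck_on_cong by blast

lemma Cinf_on_subset: "Cinf_on S f \<Longrightarrow> T \<subseteq> S \<Longrightarrow> Cinf_on T f"
  unfolding Cinf_on_def using Ck_on_subset by blast

lemma Cinf_on_local: "(\<And>x. x \<in> S \<Longrightarrow> \<exists>T. open T \<and> x \<in> T \<and> Cinf_on T f) \<Longrightarrow> Cinf_on S f"
  unfolding Cinf_on_def by (meson Ck_on_local)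

lemma Cinf_on_const [simp]: "Cinf_on S (\<lambda>x. c)"
  by (simp add: Cinf_on_def Ck_on_const)

lemma Cinf_on_bounded_linear: "bounded_linear L \<Longrightarrow> Cinf_on S L"
  by (simp add: Cinf_on_def Ck_on_bounded_linear)

lemma Cinf_on_id [simp]: "Cinf_on S (\<lambda>x. x)"
  by (simp add: Cinf_on_bounded_linear)

lemma Cinf_on_add: "open S \<Longrightarrow> Cinf_on S f \<Longrightarrow> Cinf_on S g \<Longrightarrow> Cinf_on S (\<lambda>x. f x + g x)"
  by (simp add: Cinf_on_def Ck_on_add)

lemma Cinf_on_bilinear:
  "bounded_bilinear B \<Longrightarrow> open S \<Longrightarrow> Cinf_on S f \<Longrightarrow> Cinf_on S g \<Longrightarrow> Cinf_on S (\<lambda>x. B (f x) (g x))"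
  by (simp add: Cinf_on_def Ck_on_bilinear)

lemma Cinf_on_linear_comp:
  "bounded_linear L \<Longrightarrow> open S \<Longrightarrow> Cinf_on S f \<Longrightarrow> Cinf_on S (\<lambda>x. L (f x))"
  by (simp add: Cinf_on_def Ck_on_linear_comp)

lemma Cinf_on_sum:
  "finite I \<Longrightarrow> open S \<Longrightarrow> (\<And>i. i \<in> I \<Longrightarrow> Cinf_on S (f i)) \<Longrightarrow> Cinf_on S (\<lambda>x. \<Sum>i\<in>I. f i x)"
  by (simp add: Cinf_on_def Ck_on_sum)

lemma Cinf_on_scaleR:
  "open S \<Longrightarrow> Cinf_on S f \<Longrightarrow> Cinf_on S g \<Longrightarrow> Cinf_on S (\<lambda>x. f x *\<^sub>R g x)"
  by (rule Cinf_on_bilinear[OF bounded_bilinear_scaleR])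

lemma Cinf_on_diff: "open S \<Longrightarrow> Cinf_on S f \<Longrightarrow> Cinf_on S g \<Longrightarrow> Cinf_on S (\<lambda>x. f x - g x)"
  using Cinf_on_add[of S f "\<lambda>x. - g x"] Cinf_on_linear_comp[OF bounded_linear_minus[OF bounded_linear_ident], of S g]
  by simp

lemma Cinf_on_compose:
  "open S \<Longrightarrow> open T \<Longrightarrow> g ` S \<subseteq> T \<Longrightarrow> Cinf_on T f \<Longrightarrow> Cinf_on S g \<Longrightarrow> Cinf_on S (\<lambda>x. f (g x))"
  unfolding Cinf_on_def using Ck_on_compose by blast

lemma Cinf_on_Pair:
  assumes "open S" "Cinf_on S f" "Cinf_on S g"
  shows "Cinf_on S (\<lambda>x. (f x, g x))"
proof -
  have "bounded_linear (\<lambda>y. (y, 0))" "bounded_linear (\<lambda>y. (0, y))"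
    by (auto intro: bounded_linear_Pair)
  then have "Cinf_on S (\<lambda>x. (f x, 0) + (0, g x))"
    using assms by (intro Cinf_on_add Cinf_on_linear_comp[where L = "\<lambda>y. (y, 0)"] Cinf_on_linear_comp[where L = "\<lambda>y. (0, y)"])
  then show ?thesis by simp
qed

text \<open>On an open set a local extension agrees with the function near each point, so the two
  have the same derivatives there.\<close>

lemma smooth_on_open: "open S \<Longrightarrow> smooth_on S f \<longleftrightarrow> Cinf_on S f"
proof
  assume "open S" and f: "smooth_on S f"
  show "Cinf_on S f"
  proof (rule Cinf_on_local)
    fix x assume "x \<in> S"
    then obtain N F where N: "open N" "x \<in> N" "Cinf_on N F" "\<forall>y\<in>S \<inter> N. F y = f y"
      using f unfolding smooth_on_def Cinf_on_def by blast
    have "Cinf_on (S \<inter> N) f"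
      by (rule Cinf_on_cong[OF _ Cinf_on_subset[OF N(3)]]) (use N \<open>open S\<close> in auto)
    then show "\<exists>T. open T \<and> x \<in> T \<and> Cinf_on T f"
      using N \<open>open S\<close> \<open>x \<in> S\<close> by blast
  qed
next
  assume "open S" "Cinf_on S f"
  then show "smooth_on S f" unfolding smooth_on_def Cinf_on_def by blast
qed

text \<open>The way to use smoothness on a set with empty interior, such as the domain in
  \<open>act_smooth\<close>: enter the set by a smooth map from an open set and compose with a local
  extension.\<close>

lemma smooth_on_compose_Cinf:
  assumes "smooth_on S f" "open T" "Cinf_on T g" "g ` T \<subseteq> S"
  shows "Cinf_on T (\<lambda>x. f (g x))"
proof (rule Cinf_on_local)
  fix x assume "x \<in> T"
  then have "g x \<in> S" using assms(4) by blast
  then obtain N F where N: "open N" "g x \<in> N" "Cinf_on N F" "\<forall>y\<in>S \<inter> N. F y = f y"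
    using assms(1) unfolding smooth_on_def Cinf_on_def[symmetric] by blast
  have o: "open (T \<inter> g -` N)"
    using continuous_open_preimage[OF Cinf_on_continuous[OF assms(3)] \<open>open T\<close> N(1)] .
  have "Cinf_on (T \<inter> g -` N) (\<lambda>x. F (g x))"
    by (rule Cinf_on_compose[OF o N(1) _ N(3) Cinf_on_subset[OF assms(3)]]) auto
  then have "Cinf_on (T \<inter> g -` N) (\<lambda>x. f (g x))"
    by (rule Cinf_on_cong[OF o]) (use N(4) assms(4) in blast)
  moreover have "x \<in> T \<inter> g -` N" using N(2) \<open>x \<in> T\<close> by simp
  ultimately show "\<exists>T. open T \<and> x \<in> T \<and> Cinf_on T (\<lambda>x. f (g x))"
    using o by blast
qed

lemma Cinf_on_powr: "Cinf_on {0<..} (\<lambda>t::real. t powr a)"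
proof -
  \<comment> \<open>Differentiating yields new constant factors; with \<open>c\<close> and
    \<open>a\<close> arbitrary, the family is closed under differentiation and the induction goes
    through.\<close>
  have "Ck_on n {0<..} (\<lambda>t::real. c * t powr a)" for n c
  proof (induction n arbitrary: c a)
    case 0
    then show ?case by (auto intro!: continuous_intros)
  next
    case (Suc n)
    have D: "((\<lambda>t. c * t powr a) has_derivative (\<lambda>v. (v * c * a) * x powr (a - 1))) (at x)"
      if "x > 0" for x :: real
      using that has_field_derivative_powr[of x a]
      by (auto intro!: derivative_eq_intros simp: fun_eq_iff powr_diff field_simps)
    have "Ck_on n {0<..} (\<lambda>x. frechet_derivative (\<lambda>t. c * t powr a) (at x) v)" for v
      by (rule Ck_on_cong[OF _ Suc.IH[of "v * c * a" "a - 1"]])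
        (use D[THEN frechet_derivative_at] in \<open>auto simp: fun_eq_iff\<close>)
    with D show ?case unfolding Ck_on.simps differentiable_def by (auto simp del: mult.assoc)
  qed
  from this[of _ 1] show ?thesis by (simp add: Cinf_on_def)
qed

text \<open>\<open>frechet_derivative\<close> is a choice among the maps satisfying
  \<open>has_derivative\<close>, so it is enough that f and g have the same such maps at x.\<close>

lemma frechet_derivative_cong_germ:
  assumes "open T" "x \<in> T" "\<And>y. y \<in> T \<Longrightarrow> f y = g y"
  shows "frechet_derivative f (at x) = frechet_derivative g (at x)"
proof -
  have "(f has_derivative f') (at x) \<longleftrightarrow> (g has_derivative f') (at x)" for f'
    using has_derivative_transform_within_open[OF _ assms(1,2), of f f' UNIV g]
      has_derivative_transform_within_open[OF _ assms(1,2), of g f' UNIV f] assms(3) by auto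
  then show ?thesis by (simp add: frechet_derivative_def)
qed

subsection \<open>Symmetry of second derivatives\<close>

text \<open>The mean value theorem is applied first along \<open>v\<close> and then along \<open>w\<close>.\<close>

lemma second_difference_mvt:
  fixes f :: "'a::real_normed_vector \<Rightarrow> real"
  assumes t: "t > 0"
    and fd: "\<And>r s. 0 \<le> r \<Longrightarrow> r \<le> t \<Longrightarrow> 0 \<le> s \<Longrightarrow> s \<le> t \<Longrightarrow> (f has_derivative f' (x + r *\<^sub>R v + s *\<^sub>R w)) (at (x + r *\<^sub>R v + s *\<^sub>R w))"
    and fdd: "\<And>r s. 0 \<le> r \<Longrightarrow> r \<le> t \<Longrightarrow> 0 \<le> s \<Longrightarrow> s \<le> t \<Longrightarrow> ((\<lambda>y. f' y v) has_derivative f'' (x + r *\<^sub>R v + s *\<^sub>R w)) (at (x + r *\<^sub>R v + s *\<^sub>R w))"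
  shows "\<exists>r s. 0 < r \<and> r < t \<and> 0 < s \<and> s < t \<and>
    f (x + t *\<^sub>R v + t *\<^sub>R w) - f (x + t *\<^sub>R v) - f (x + t *\<^sub>R w) + f x = t * t * f'' (x + r *\<^sub>R v + s *\<^sub>R w) w"
proof -
  define g where "g r = f (x + r *\<^sub>R v + t *\<^sub>R w) - f (x + r *\<^sub>R v + 0 *\<^sub>R w)" for r
  have g: "(g has_derivative (\<lambda>h. h * (f' (x + r *\<^sub>R v + t *\<^sub>R w) v - f' (x + r *\<^sub>R v + 0 *\<^sub>R w) v))) (at r)"
    if "0 \<le> r" "r \<le> t" for r
  proof -
    have "((\<lambda>r. f (x + r *\<^sub>R v + s *\<^sub>R w)) has_derivative (\<lambda>h. f' (x + r *\<^sub>R v + s *\<^sub>R w) (h *\<^sub>R v))) (at r)"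
      if "0 \<le> s" "s \<le> t" for s
    proof (rule has_derivative_compose[of "\<lambda>r. x + r *\<^sub>R v + s *\<^sub>R w" "\<lambda>h. h *\<^sub>R v"])
      show "((\<lambda>r. x + r *\<^sub>R v + s *\<^sub>R w) has_derivative (\<lambda>h. h *\<^sub>R v)) (at r)"
        by (auto intro!: derivative_eq_intros)
    qed (use fd \<open>0 \<le> r\<close> \<open>r \<le> t\<close> that in auto)
    moreover have "f' (x + r *\<^sub>R v + s *\<^sub>R w) (h *\<^sub>R v) = h * f' (x + r *\<^sub>R v + s *\<^sub>R w) v" if "0 \<le> s" "s \<le> t" for s h
      using linear_cmul[OF has_derivative_linear[OF fd[of r s]]] \<open>0 \<le> r\<close> \<open>r \<le> t\<close> that by simp
    ultimately have *: "((\<lambda>r. f (x + r *\<^sub>R v + s *\<^sub>R w)) has_derivative (\<lambda>h. h * f' (x + r *\<^sub>R v + s *\<^sub>R w) v)) (at r)"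
      if "0 \<le> s" "s \<le> t" for s using that by simp
    show ?thesis
      unfolding g_def using has_derivative_diff[OF *[of t] *[of 0]] t by (simp add: algebra_simps)
  qed
  obtain r where r: "0 < r" "r < t"
    "g t - g 0 = (t - 0) * (f' (x + r *\<^sub>R v + t *\<^sub>R w) v - f' (x + r *\<^sub>R v + 0 *\<^sub>R w) v)"
  proof (rule mvt[of 0 t g "\<lambda>r h. h * (f' (x + r *\<^sub>R v + t *\<^sub>R w) v - f' (x + r *\<^sub>R v + 0 *\<^sub>R w) v)", OF t])
    show "continuous_on {0..t} g"
      by (rule has_derivative_continuous_on, rule has_derivative_at_withinI, rule g) auto
  qed (use g in auto)
  have k: "((\<lambda>s. f' (x + r *\<^sub>R v + s *\<^sub>R w) v) has_derivative (\<lambda>h. h * f'' (x + r *\<^sub>R v + s *\<^sub>R w) w)) (at s)"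
    if "0 \<le> s" "s \<le> t" for s
  proof -
    have "((\<lambda>s. f' (x + r *\<^sub>R v + s *\<^sub>R w) v) has_derivative (\<lambda>h. f'' (x + r *\<^sub>R v + s *\<^sub>R w) (h *\<^sub>R w))) (at s)"
    proof (rule has_derivative_compose[of "\<lambda>s. x + r *\<^sub>R v + s *\<^sub>R w" "\<lambda>h. h *\<^sub>R w"])
      show "((\<lambda>s. x + r *\<^sub>R v + s *\<^sub>R w) has_derivative (\<lambda>h. h *\<^sub>R w)) (at s)"
        by (auto intro!: derivative_eq_intros)
    qed (use fdd r that in auto)
    moreover have "f'' (x + r *\<^sub>R v + s *\<^sub>R w) (h *\<^sub>R w) = h * f'' (x + r *\<^sub>R v + s *\<^sub>R w) w" for h
      using linear_cmul[OF has_derivative_linear[OF fdd[of r s]]] r that by simp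
    ultimately show ?thesis by simp
  qed
  obtain s where s: "0 < s" "s < t"
    "f' (x + r *\<^sub>R v + t *\<^sub>R w) v - f' (x + r *\<^sub>R v + 0 *\<^sub>R w) v = (t - 0) * f'' (x + r *\<^sub>R v + s *\<^sub>R w) w"
  proof (rule mvt[of 0 t "\<lambda>s. f' (x + r *\<^sub>R v + s *\<^sub>R w) v" "\<lambda>s h. h * f'' (x + r *\<^sub>R v + s *\<^sub>R w) w", OF t])
    show "continuous_on {0..t} (\<lambda>s. f' (x + r *\<^sub>R v + s *\<^sub>R w) v)"
      by (rule has_derivative_continuous_on, rule has_derivative_at_withinI, rule k) auto
  qed (use k in auto)
  have "f (x + t *\<^sub>R v + t *\<^sub>R w) - f (x + t *\<^sub>R v) - f (x + t *\<^sub>R w) + f x = g t - g 0"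
    by (simp add: g_def)
  with r s show ?thesis by (metis diff_zero mult.assoc)
qed

text \<open>The second difference over the parallelogram with sides \<open>t *\<^sub>R v\<close> and
  \<open>t *\<^sub>R w\<close> is symmetric in v and w, and equals \<open>t * t\<close> times either
  mixed derivative at some nearby point. Continuity of the mixed derivatives at x forces them to
  agree.\<close>

lemma second_derivative_symmetric_real:
  fixes f :: "'a::euclidean_space \<Rightarrow> real"
  assumes "open S" "x \<in> S" "Cinf_on S f"
  shows "frechet_derivative (\<lambda>y. frechet_derivative f (at y) v) (at x) w
       = frechet_derivative (\<lambda>y. frechet_derivative f (at y) w) (at x) v"
proof -
  define D where "D v w y = frechet_derivative (\<lambda>y. frechet_derivative f (at y) v) (at y) w" for v w y
  have cont: "isCont (D v w) x" for v w
    using Cinf_on_continuous[OF Cinf_on_deriv[OF Cinf_on_deriv[OF assms(3), of v], of w]] assms(1,2)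
    by (simp add: D_def[abs_def] continuous_on_eq_continuous_at)
  have ex: "\<exists>p. dist p x < e \<and> f (x + t *\<^sub>R v + t *\<^sub>R w) - f (x + t *\<^sub>R v) - f (x + t *\<^sub>R w) + f x = t * t * D v w p"
    if "t > 0" "t * (norm v + norm w) < e" "ball x e \<subseteq> S" for t e v w
  proof -
    have inS: "dist (x + r *\<^sub>R v + s *\<^sub>R w) x < e" if "0 \<le> r" "r \<le> t" "0 \<le> s" "s \<le> t" for r s
    proof -
      have "norm (r *\<^sub>R v + s *\<^sub>R w) \<le> r * norm v + s * norm w"
        using norm_triangle_ineq[of "r *\<^sub>R v" "s *\<^sub>R w"] that by simp
      also have "\<dots> \<le> t * norm v + t * norm w"
        using that by (intro add_mono mult_right_mono) auto
      also have "\<dots> < e" using \<open>t * (norm v + norm w) < e\<close> by (simp add: distrib_left)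
      finally show ?thesis by (simp add: dist_norm algebra_simps)
    qed
    have inS': "x + r *\<^sub>R v + s *\<^sub>R w \<in> S" if "0 \<le> r" "r \<le> t" "0 \<le> s" "s \<le> t" for r s
      using inS[OF that] \<open>ball x e \<subseteq> S\<close> by (auto simp: dist_commute)
    have "\<exists>r s. 0 < r \<and> r < t \<and> 0 < s \<and> s < t \<and>
      f (x + t *\<^sub>R v + t *\<^sub>R w) - f (x + t *\<^sub>R v) - f (x + t *\<^sub>R w) + f x = t * t * D v w (x + r *\<^sub>R v + s *\<^sub>R w)"
      unfolding D_def
      by (rule second_difference_mvt[OF \<open>t > 0\<close>])
        (auto intro!: Cinf_on_has_derivative[OF assms(3)] Cinf_on_has_derivative[OF Cinf_on_deriv[OF assms(3)]] inS')
    with inS show ?thesis by (metis less_imp_le)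
  qed
  have "D v w x = D w v x"
  proof (rule ccontr)
    assume ne: "D v w x \<noteq> D w v x"
    define \<epsilon> where "\<epsilon> = \<bar>D v w x - D w v x\<bar> / 2"
    have "\<epsilon> > 0" using ne by (simp add: \<epsilon>_def)
    obtain e1 where e1: "e1 > 0" "\<And>p. dist p x < e1 \<Longrightarrow> dist (D v w p) (D v w x) < \<epsilon>"
      using cont[of v w] \<open>\<epsilon> > 0\<close> unfolding continuous_at_eps_delta by metis
    obtain e2 where e2: "e2 > 0" "\<And>p. dist p x < e2 \<Longrightarrow> dist (D w v p) (D w v x) < \<epsilon>"
      using cont[of w v] \<open>\<epsilon> > 0\<close> unfolding continuous_at_eps_delta by metis
    obtain e3 where e3: "e3 > 0" "ball x e3 \<subseteq> S"
      using assms open_contains_ball by blast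
    define e where "e = min e1 (min e2 e3)"
    \<comment> \<open>The 1 keeps the denominator positive when both vectors vanish; the 2 makes the
      bound by \<open>e\<close> strict.\<close>
    define t where "t = e / (2 * (norm v + norm w + 1))"
    have "e > 0" using e1 e2 e3 by (simp add: e_def)
    have pos: "norm v + norm w + 1 > 0" by (simp add: add_nonneg_pos)
    then have "t > 0" using \<open>e > 0\<close> by (simp add: t_def)
    have "t * (norm v + norm w) \<le> t * (norm v + norm w + 1)"
      using \<open>t > 0\<close> by (intro mult_left_mono) auto
    also have "\<dots> = e / 2"
      using pos by (simp add: t_def divide_simps)
    also have "\<dots> < e" using \<open>e > 0\<close> by simp
    finally have te: "t * (norm v + norm w) < e" .
    have ball: "ball x e \<subseteq> S" using e3 by (auto simp: e_def)
    obtain p where p: "dist p x < e"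
      "f (x + t *\<^sub>R v + t *\<^sub>R w) - f (x + t *\<^sub>R v) - f (x + t *\<^sub>R w) + f x = t * t * D v w p"
      using ex[OF \<open>t > 0\<close> te ball] by blast
    obtain q where q: "dist q x < e"
      "f (x + t *\<^sub>R w + t *\<^sub>R v) - f (x + t *\<^sub>R w) - f (x + t *\<^sub>R v) + f x = t * t * D w v q"
      using ex[OF \<open>t > 0\<close> _ ball, of w v] te by (auto simp: add.commute)
    have "x + t *\<^sub>R w + t *\<^sub>R v = x + t *\<^sub>R v + t *\<^sub>R w" by (simp add: algebra_simps)
    then have "t * t * D v w p = t * t * D w v q" using p(2) q(2) by (simp add: algebra_simps)
    then have "D v w p = D w v q" using \<open>t > 0\<close> by simp
    moreover have "dist (D v w p) (D v w x) < \<epsilon>" "dist (D w v q) (D w v x) < \<epsilon>"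
      using p(1) q(1) e1 e2 by (auto simp: e_def)
    ultimately have "dist (D v w x) (D w v x) < \<epsilon> + \<epsilon>"
      by (metis dist_triangle_half_l dist_commute field_sum_of_halves add_divide_distrib)
    then show False using ne by (simp add: \<epsilon>_def dist_real_def)
  qed
  then show ?thesis by (simp add: D_def)
qed

lemma second_derivative_symmetric:
  fixes f :: "'a::euclidean_space \<Rightarrow> 'b::euclidean_space"
  assumes "open S" "x \<in> S" "Cinf_on S f"
  shows "frechet_derivative (\<lambda>y. frechet_derivative f (at y) v) (at x) w
       = frechet_derivative (\<lambda>y. frechet_derivative f (at y) w) (at x) v"
proof (rule euclidean_eqI)
  fix b :: 'b assume "b \<in> Basis"
  have fb: "Cinf_on S (\<lambda>y. f y \<bullet> b)"
    by (rule Cinf_on_linear_comp[OF bounded_linear_inner_left assms(1,3)])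
  have comp: "frechet_derivative (\<lambda>y. g y \<bullet> b) (at y) u = frechet_derivative g (at y) u \<bullet> b"
    if "g differentiable at y" for g :: "'a \<Rightarrow> 'b" and y u
    using frechet_derivative_at[OF bounded_linear.has_derivative[OF bounded_linear_inner_left that[unfolded frechet_derivative_works]]]
    by (simp add: fun_eq_iff)
  have 2: "frechet_derivative (\<lambda>y. frechet_derivative (\<lambda>y. f y \<bullet> b) (at y) v) (at x) w
    = frechet_derivative (\<lambda>y. frechet_derivative f (at y) v) (at x) w \<bullet> b" for v w
  proof -
    have "frechet_derivative (\<lambda>y. frechet_derivative (\<lambda>y. f y \<bullet> b) (at y) v) (at x)
      = frechet_derivative (\<lambda>y. frechet_derivative f (at y) v \<bullet> b) (at x)"
      by (rule frechet_derivative_cong_germ[OF assms(1,2)]) (rule comp[OF Cinf_on_differentiable[OF assms(3)]])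
    then show ?thesis
      using comp[OF Cinf_on_differentiable[OF Cinf_on_deriv[OF assms(3)] assms(2)]] by simp
  qed
  show "frechet_derivative (\<lambda>y. frechet_derivative f (at y) v) (at x) w \<bullet> b
      = frechet_derivative (\<lambda>y. frechet_derivative f (at y) w) (at x) v \<bullet> b"
    using second_derivative_symmetric_real[OF assms(1,2) fb, of v w] 2 by simp
qed

section \<open>Quaternions, \<open>SU(2)\<close> and its Lie algebra\<close>

lemma matrix2_eq_iff:
  "A = B \<longleftrightarrow> A $ 1 $ 1 = B $ 1 $ 1 \<and> A $ 1 $ 2 = B $ 1 $ 2 \<and> A $ 2 $ 1 = B $ 2 $ 1 \<and> A $ 2 $ 2 = B $ 2 $ 2"
  for A B :: "'a^2^2"
  by (auto simp: vec_eq_iff forall_2)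

lemma matrix_mult_entry2: "(A ** B) $ i $ j = A $ i $ 1 * B $ 1 $ j + A $ i $ 2 * B $ 2 $ j"
  for A :: "'a::semiring_1^2^'n"
  by (simp add: matrix_matrix_mult_def sum_2)

lemma trace2: "trace A = A $ 1 $ 1 + A $ 2 $ 2" for A :: "'a::semiring_1^2^2"
  by (simp add: trace_def sum_2)

lemmas matrix2_simps = matrix2_eq_iff matrix_mult_entry2 trace2 conj_transpose_def mat_def det_2

text \<open>The quaternion p + q j as a complex matrix. Such matrices form a real subalgebra H, and
  all 2x2 matrices are the direct sum of H and iH. \<open>SU2\<close> is the unit sphere of H,
  \<open>su2\<close> its imaginary part.\<close>

definition quat_mat :: "complex \<Rightarrow> complex \<Rightarrow> complex^2^2" where
  "quat_mat p q = (\<chi> i j. if i = 1 then (if j = 1 then p else q) else (if j = 1 then - cnj q else cnj p))"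

text \<open>Coordinates with respect to the imaginary units i, j, k of H.\<close>

definition su2_mat :: "real \<Rightarrow> real \<Rightarrow> real \<Rightarrow> complex^2^2" where
  "su2_mat x y z = quat_mat (Complex 0 x) (Complex y z)"

definition commutator :: "complex^2^2 \<Rightarrow> complex^2^2 \<Rightarrow> complex^2^2" where
  "commutator X Y = X ** Y - Y ** X"

text \<open>\<open>quat_p\<close> and \<open>quat_q\<close> are the components of the projection
  onto H along iH; iH is also the real orthogonal complement of H.\<close>

definition quat_p :: "complex^2^2 \<Rightarrow> complex" where "quat_p A = (A $ 1 $ 1 + cnj (A $ 2 $ 2)) / 2"
definition quat_q :: "complex^2^2 \<Rightarrow> complex" where "quat_q A = (A $ 1 $ 2 - cnj (A $ 2 $ 1)) / 2"

definition quat_proj :: "complex^2^2 \<Rightarrow> complex^2^2" where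
  "quat_proj A = quat_mat (quat_p A) (quat_q A)"

definition quat_norm2 :: "complex^2^2 \<Rightarrow> real" where
  "quat_norm2 A = quat_p A \<bullet> quat_p A + quat_q A \<bullet> quat_q A"

definition retr_dom :: "(complex^2^2) set" where "retr_dom = {A. quat_norm2 A > 0}"

text \<open>Functions on \<open>SU2\<close> extend smoothly to an open set of matrices by composition with this
  retraction, so that they can be differentiated there.\<close>

definition SU2_retr :: "complex^2^2 \<Rightarrow> complex^2^2" where
  "SU2_retr A = (quat_norm2 A powr (-1/2)) *\<^sub>R quat_proj A"

lemma quat_mat_entries [simp]:
  "quat_mat p q $ 1 $ 1 = p" "quat_mat p q $ 1 $ 2 = q" "quat_mat p q $ 2 $ 1 = - cnj q" "quat_mat p q $ 2 $ 2 = cnj p"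
  by (auto simp: quat_mat_def)

lemma quat_mat_mult: "quat_mat p q ** quat_mat r s = quat_mat (p * r - q * cnj s) (p * s + q * cnj r)"
  by (simp add: matrix2_simps algebra_simps)

lemma quat_pq_quat_mat [simp]: "quat_p (quat_mat p q) = p" "quat_q (quat_mat p q) = q"
  by (auto simp: quat_p_def quat_q_def)

lemma quat_proj_quat_mat [simp]: "quat_proj (quat_mat p q) = quat_mat p q"
  by (simp add: quat_proj_def)

lemma quat_mat_mult_pq:
  "quat_p (quat_mat p q ** A) = p * quat_p A - q * cnj (quat_q A)"
  "quat_q (quat_mat p q ** A) = p * quat_q A + q * cnj (quat_p A)"
  "quat_p (A ** quat_mat p q) = quat_p A * p - quat_q A * cnj q"
  "quat_q (A ** quat_mat p q) = quat_p A * q + quat_q A * cnj p"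
  by (auto simp: quat_p_def quat_q_def matrix_mult_entry2 field_simps)

text \<open>Multiplication by a quaternion, on either side, preserves both H and iH.\<close>

lemma quat_mat_proj_mult:
  "quat_proj (quat_mat p q ** A) = quat_mat p q ** quat_proj A"
  "quat_proj (A ** quat_mat p q) = quat_proj A ** quat_mat p q"
  by (auto simp: quat_proj_def quat_mat_mult_pq quat_mat_mult)

text \<open>The four-square identity for the quaternionic part of A, whose squared norm is
  \<open>quat_norm2 A\<close>.\<close>

lemma quat_norm2_mult:
  "quat_norm2 (quat_mat p q ** A) = (p \<bullet> p + q \<bullet> q) * quat_norm2 A"
  "quat_norm2 (A ** quat_mat p q) = (p \<bullet> p + q \<bullet> q) * quat_norm2 A"
  unfolding quat_norm2_def quat_mat_mult_pq
  by (simp_all add: inner_complex_def algebra_simps)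

lemma SU2_quat_iff: "g \<in> SU2 \<longleftrightarrow> (\<exists>p q. g = quat_mat p q \<and> p \<bullet> p + q \<bullet> q = 1)"
proof
  assume "g \<in> SU2"
  define a b c d where "a = g $ 1 $ 1" "b = g $ 1 $ 2" "c = g $ 2 $ 1" "d = g $ 2 $ 2"
  note abcd = this
  have 1: "cnj a * a + cnj c * c = 1" "cnj a * b + cnj c * d = 0" "a * d - b * c = 1"
    using \<open>g \<in> SU2\<close> by (auto simp: SU2_def matrix2_simps abcd)
  \<comment> \<open>The first column has norm 1; multiplying by that 1 lets orthogonality and the
    determinant determine the second column from the first.\<close>
  have "d = d * (cnj a * a + cnj c * c)" using 1 by simp
  also have "\<dots> = cnj a * (a * d - b * c) + c * (cnj a * b + cnj c * d)" by (simp add: algebra_simps)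
  finally have d: "d = cnj a" using 1 by simp
  have "b = b * (cnj a * a + cnj c * c)" using 1 by simp
  also have "\<dots> = a * (cnj a * b + cnj c * d) - cnj c * (a * d - b * c)" by (simp add: algebra_simps)
  finally have b: "b = - cnj c" using 1 by simp
  have "g = quat_mat a b" using b d by (simp add: matrix2_eq_iff abcd)
  moreover have "a \<bullet> a + b \<bullet> b = 1"
    using 1(1) b by (simp add: inner_complex_def complex_eq_iff algebra_simps)
  ultimately show "\<exists>p q. g = quat_mat p q \<and> p \<bullet> p + q \<bullet> q = 1" by blast
next
  assume "\<exists>p q. g = quat_mat p q \<and> p \<bullet> p + q \<bullet> q = 1"
  then show "g \<in> SU2"
    by (auto simp: SU2_def matrix2_simps inner_complex_def complex_eq_iff algebra_simps)
qed

lemma SU2_retr_in: "A \<in> retr_dom \<Longrightarrow> SU2_retr A \<in> SU2"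
proof -
  assume "A \<in> retr_dom"
  then have n: "quat_norm2 A > 0" by (simp add: retr_dom_def)
  let ?c = "quat_norm2 A powr (-1/2)"
  have "SU2_retr A = quat_mat (?c *\<^sub>R quat_p A) (?c *\<^sub>R quat_q A)"
    by (simp add: SU2_retr_def quat_proj_def matrix2_eq_iff)
  moreover have "?c * ?c * quat_norm2 A = 1"
    using n by (simp add: powr_add[symmetric] powr_minus_divide)
  then have "(?c *\<^sub>R quat_p A) \<bullet> (?c *\<^sub>R quat_p A) + (?c *\<^sub>R quat_q A) \<bullet> (?c *\<^sub>R quat_q A) = 1"
    by (simp add: quat_norm2_def algebra_simps)
  ultimately show ?thesis unfolding SU2_quat_iff by blast
qed

lemma SU2_in_retr_dom: "g \<in> SU2 \<Longrightarrow> g \<in> retr_dom"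
  by (auto simp: SU2_quat_iff retr_dom_def quat_norm2_def)

lemma SU2_retr_id: "g \<in> SU2 \<Longrightarrow> SU2_retr g = g"
  by (auto simp: SU2_quat_iff SU2_retr_def quat_norm2_def)

lemma mat_1_quat: "mat 1 = quat_mat 1 0"
  by (simp add: matrix2_simps)

lemma mat_1_SU2 [simp]: "mat 1 \<in> SU2"
  unfolding SU2_quat_iff by (intro exI[of _ 1] exI[of _ 0]) (simp add: mat_1_quat)

lemma SU2_mult: "g \<in> SU2 \<Longrightarrow> h \<in> SU2 \<Longrightarrow> g ** h \<in> SU2"
proof -
  assume "g \<in> SU2" "h \<in> SU2"
  then obtain p q r s where
    1: "g = quat_mat p q" "p \<bullet> p + q \<bullet> q = 1" "h = quat_mat r s" "r \<bullet> r + s \<bullet> s = 1"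
    unfolding SU2_quat_iff by blast
  have "quat_norm2 (g ** h) = 1"
    using 1 by (simp only: quat_norm2_mult) (simp add: quat_norm2_def)
  then show ?thesis
    using 1 unfolding SU2_quat_iff by (auto simp: quat_mat_mult quat_norm2_def)
qed

lemma matrix_inv_eqI: "A ** B = mat 1 \<Longrightarrow> B ** A = mat 1 \<Longrightarrow> matrix_inv A = B" for A :: "'a::semiring_1^'n^'m"
proof -
  assume AB: "A ** B = mat 1" "B ** A = mat 1"
  then have "\<exists>C. A ** C = mat 1 \<and> C ** A = mat 1" by blast
  then have "A ** matrix_inv A = mat 1 \<and> matrix_inv A ** A = mat 1"
    unfolding matrix_inv_def by (rule someI_ex)
  then show ?thesis
    by (metis AB matrix_mul_assoc matrix_mul_lid matrix_mul_rid)
qed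

lemma SU2_inv:
  assumes "g \<in> SU2"
  shows "matrix_inv g ** g = mat 1" "g ** matrix_inv g = mat 1" "matrix_inv g \<in> SU2"
    "matrix_inv g = conj_transpose g"
proof -
  obtain p q where g: "g = quat_mat p q" "p \<bullet> p + q \<bullet> q = 1"
    using assms unfolding SU2_quat_iff by blast
  have ct: "conj_transpose g = quat_mat (cnj p) (- q)"
    by (simp add: g matrix2_simps)
  have "p * cnj p + q * cnj q = 1"
    using g(2) by (simp add: inner_complex_def complex_eq_iff)
  then have "conj_transpose g ** g = mat 1" "g ** conj_transpose g = mat 1"
    unfolding ct unfolding g(1) by (auto simp: quat_mat_mult mat_1_quat algebra_simps)
  moreover from this show "matrix_inv g = conj_transpose g" by (intro matrix_inv_eqI)
  ultimately show "matrix_inv g ** g = mat 1" "g ** matrix_inv g = mat 1" by auto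
  show "matrix_inv g \<in> SU2"
    unfolding \<open>matrix_inv g = _\<close> ct SU2_quat_iff using g(2)
    by (intro exI[of _ "cnj p"] exI[of _ "- q"]) (simp add: inner_complex_def)
qed

text \<open>A unit quaternion changes neither the norm nor, therefore, the normalising factor.
  Translations thus pass through the retraction, which reduces derivatives at a group element to
  derivatives at the identity.\<close>

lemma SU2_retr_mult:
  assumes "g \<in> SU2"
  shows "SU2_retr (g ** A) = g ** SU2_retr A" "SU2_retr (A ** g) = SU2_retr A ** g"
    "g ** A \<in> retr_dom \<longleftrightarrow> A \<in> retr_dom" "A ** g \<in> retr_dom \<longleftrightarrow> A \<in> retr_dom"
proof -
  obtain p q where g: "g = quat_mat p q" "p \<bullet> p + q \<bullet> q = 1"
    using assms unfolding SU2_quat_iff by blast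
  show "SU2_retr (g ** A) = g ** SU2_retr A" "SU2_retr (A ** g) = SU2_retr A ** g"
    by (simp_all add: SU2_retr_def g quat_mat_proj_mult quat_norm2_mult matrix2_simps algebra_simps)
  show "g ** A \<in> retr_dom \<longleftrightarrow> A \<in> retr_dom" "A ** g \<in> retr_dom \<longleftrightarrow> A \<in> retr_dom"
    by (simp_all add: retr_dom_def g quat_norm2_mult)
qed

lemma bounded_linear_quat:
  "bounded_linear quat_p" "bounded_linear quat_q" "bounded_linear quat_proj"
  by (auto intro!: linear_conv_bounded_linear[THEN iffD1] linearI
      simp: quat_p_def quat_q_def quat_proj_def matrix2_eq_iff complex_eq_iff field_simps)

lemma Cinf_on_quat_norm2: "Cinf_on UNIV quat_norm2"
  unfolding quat_norm2_def[abs_def]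
  by (intro Cinf_on_add Cinf_on_bilinear[OF bounded_bilinear_inner] Cinf_on_bounded_linear bounded_linear_quat) auto

lemma open_retr_dom: "open retr_dom"
proof -
  have "continuous_on UNIV quat_norm2" using Cinf_on_quat_norm2 by (rule Cinf_on_continuous)
  then have "open (quat_norm2 -` {0<..})" by (rule continuous_on_open_vimage[OF open_UNIV, THEN iffD1, rule_format, of _ "{0<..}", simplified]) auto
  moreover have "quat_norm2 -` {0<..} = retr_dom" by (auto simp: retr_dom_def)
  ultimately show ?thesis by simp
qed

lemma Cinf_on_SU2_retr: "Cinf_on retr_dom SU2_retr"
proof -
  have "Cinf_on retr_dom (\<lambda>A. quat_norm2 A powr (-1/2))"
    by (rule Cinf_on_compose[OF open_retr_dom open_greaterThan _ Cinf_on_powr Cinf_on_subset[OF Cinf_on_quat_norm2]])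
      (auto simp: retr_dom_def)
  then show ?thesis
    unfolding SU2_retr_def[abs_def]
    by (rule Cinf_on_scaleR[OF open_retr_dom _ Cinf_on_bounded_linear[OF bounded_linear_quat(3)]])
qed

section \<open>The Lie algebra and its trace form\<close>

lemma su2_matD:
  assumes "X \<in> su2"
  shows "X = su2_mat (Im (X $ 1 $ 1)) (Re (X $ 1 $ 2)) (Im (X $ 1 $ 2))"
proof -
  have "cnj (X $ 1 $ 1) = - X $ 1 $ 1" "cnj (X $ 2 $ 2) = - X $ 2 $ 2" "cnj (X $ 1 $ 2) = - X $ 2 $ 1"
    "X $ 1 $ 1 + X $ 2 $ 2 = 0"
    using assms by (auto simp: su2_def matrix2_simps)
  then show ?thesis
    by (auto simp: su2_mat_def matrix2_eq_iff complex_eq_iff)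
qed

lemma su2_mat_in [simp]: "su2_mat x y z \<in> su2"
    by (simp add: su2_def su2_mat_def matrix2_simps complex_eq_iff)

lemma su2_iff: "X \<in> su2 \<longleftrightarrow> (\<exists>x y z. X = su2_mat x y z)"
  using su2_matD by auto

text \<open>Imaginary quaternions are orthogonal to 1, so the normalising factor is stationary in
  direction X, and the projection fixes X.\<close>

lemma SU2_retr_deriv_1:
  assumes "X \<in> su2"
  shows "frechet_derivative SU2_retr (at (mat 1)) X = X"
proof -
  have n: "(quat_norm2 has_derivative (\<lambda>h. (quat_p (mat 1) \<bullet> quat_p h + quat_p h \<bullet> quat_p (mat 1)) +
      (quat_q (mat 1) \<bullet> quat_q h + quat_q h \<bullet> quat_q (mat 1)))) (at (mat 1))"
    unfolding quat_norm2_def[abs_def]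
    by (intro has_derivative_add has_derivative_inner bounded_linear_imp_has_derivative bounded_linear_quat)
  have n1: "quat_norm2 (mat 1) = 1" by (simp add: quat_norm2_def mat_1_quat)
  have p: "((\<lambda>t::real. t powr (-1/2)) has_derivative (\<lambda>h. h * (-1/2))) (at (quat_norm2 (mat 1)))"
  proof -
    have "(\<lambda>h::real. h * (-1/2)) = (*) (-1/2)" by auto
    then show ?thesis using has_real_derivative_powr[of 1 "-1/2"] n1 by (simp add: has_field_derivative_def)
  qed
  obtain x y z where X: "X = su2_mat x y z" using assms unfolding su2_iff by blast
  have "(SU2_retr has_derivative (\<lambda>h. (quat_norm2 (mat 1) powr (-1/2)) *\<^sub>R quat_proj h +
     (((quat_p (mat 1) \<bullet> quat_p h + quat_p h \<bullet> quat_p (mat 1)) +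
      (quat_q (mat 1) \<bullet> quat_q h + quat_q h \<bullet> quat_q (mat 1))) * (-1/2)) *\<^sub>R quat_proj (mat 1))) (at (mat 1))"
    unfolding SU2_retr_def[abs_def]
    by (rule has_derivative_scaleR[OF has_derivative_compose[OF n p] bounded_linear_imp_has_derivative[OF bounded_linear_quat(3)]])
  from frechet_derivative_at[OF this]
  have "frechet_derivative SU2_retr (at (mat 1)) X = quat_proj X +
     (((quat_p (mat 1) \<bullet> quat_p X + quat_p X \<bullet> quat_p (mat 1)) +
      (quat_q (mat 1) \<bullet> quat_q X + quat_q X \<bullet> quat_q (mat 1))) * (-1/2)) *\<^sub>R quat_proj (mat 1)"
    using n1 by (simp add: fun_eq_iff)
  also have "\<dots> = X"
    unfolding mat_1_quat X su2_mat_def by (simp add: inner_complex_def)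
  finally show ?thesis .
qed

lemma su2_mat_add: "su2_mat x y z + su2_mat x' y' z' = su2_mat (x + x') (y + y') (z + z')"
  and su2_mat_scaleR: "c *\<^sub>R su2_mat x y z = su2_mat (c * x) (c * y) (c * z)"
  and commutator_su2_mat: "commutator (su2_mat x y z) (su2_mat x' y' z') =
    su2_mat (2 * (y * z' - z * y')) (2 * (z * x' - x * z')) (2 * (x * y' - y * x'))"
  and trace_su2_mat: "trace (su2_mat x y z ** su2_mat x' y' z') = - 2 * complex_of_real (x * x' + y * y' + z * z')"
  by (auto simp: commutator_def su2_mat_def matrix2_simps complex_eq_iff algebra_simps)

lemma su2_mat_decomp: "su2_mat x y z = x *\<^sub>R su2_mat 1 0 0 + y *\<^sub>R su2_mat 0 1 0 + z *\<^sub>R su2_mat 0 0 1"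
  by (simp add: su2_mat_add su2_mat_scaleR)

text \<open>The commutator pairing \<open>(A, X, Y) \<mapsto> - Tr (A [X, Y])\<close> identifies \<open>su2\<close> with the space of
  alternating bilinear forms on \<open>su2\<close>.\<close>

definition su2_of_bilinear :: "(complex^2^2 \<Rightarrow> complex^2^2 \<Rightarrow> real) \<Rightarrow> complex^2^2" where
  "su2_of_bilinear \<beta> = (1/4) *\<^sub>R su2_mat (\<beta> (su2_mat 0 1 0) (su2_mat 0 0 1))
     (\<beta> (su2_mat 0 0 1) (su2_mat 1 0 0)) (\<beta> (su2_mat 1 0 0) (su2_mat 0 1 0))"

lemma su2_of_bilinear_in [simp]: "su2_of_bilinear \<beta> \<in> su2"
  by (simp add: su2_of_bilinear_def su2_mat_scaleR)

text \<open>An alternating form in three dimensions is known from its values on the three cyclic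
  pairs of basis elements. The 1/4 compensates the 2 in the commutators and the -2 in the trace:
  -Tr(e1 [e2, e3]) = 4.\<close>

lemma su2_of_bilinear:
  assumes lin: "\<And>Y. linear (\<lambda>X. \<beta> X Y)" "\<And>X. linear (\<beta> X)" and alt: "\<And>X. \<beta> X X = 0"
    and XY: "X \<in> su2" "Y \<in> su2"
  shows "complex_of_real (\<beta> X Y) = - trace (su2_of_bilinear \<beta> ** commutator X Y)"
proof -
  have add: "\<beta> (A + B) C = \<beta> A C + \<beta> B C" "\<beta> C (A + B) = \<beta> C A + \<beta> C B"
    "\<beta> (c *\<^sub>R A) C = c * \<beta> A C" "\<beta> C (c *\<^sub>R A) = c * \<beta> C A" for A B C c
    using linear_add[OF lin(1)] linear_add[OF lin(2)] linear_cmul[OF lin(1)] linear_cmul[OF lin(2)] by auto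
  have skew: "\<beta> B A = - \<beta> A B" for A B
    using alt[of "A + B"] alt[of A] alt[of B] by (simp add: add)
  obtain x y z x' y' z' where X: "X = su2_mat x y z" and Y: "Y = su2_mat x' y' z'"
    using XY unfolding su2_iff by blast
  let ?e1 = "su2_mat 1 0 0" and ?e2 = "su2_mat 0 1 0" and ?e3 = "su2_mat 0 0 1"
  have "\<beta> X Y = (x * y' - y * x') * \<beta> ?e1 ?e2 + (y * z' - z * y') * \<beta> ?e2 ?e3 + (z * x' - x * z') * \<beta> ?e3 ?e1"
    unfolding X Y su2_mat_decomp[of x y z] su2_mat_decomp[of x' y' z'] add alt
      skew[of ?e2 ?e1] skew[of ?e3 ?e2] skew[of ?e1 ?e3]
    by (simp add: algebra_simps)
  then show ?thesis
    unfolding X Y su2_of_bilinear_def su2_mat_scaleR commutator_su2_mat trace_su2_mat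
    by (simp only:) (simp add: algebra_simps)
qed

text \<open>Commutators of the basis elements are twice basis elements and the trace form is
  diagonal, so the three cyclic pairs read off the coordinates.\<close>

lemma su2_nondegenerate:
  assumes "A \<in> su2" "B \<in> su2"
    "\<And>X Y. X \<in> su2 \<Longrightarrow> Y \<in> su2 \<Longrightarrow> trace (A ** commutator X Y) = trace (B ** commutator X Y)"
  shows "A = B"
proof -
  obtain x y z x' y' z' where A: "A = su2_mat x y z" and B: "B = su2_mat x' y' z'"
    using assms unfolding su2_iff by blast
  show ?thesis
    using assms(3)[of "su2_mat 1 0 0" "su2_mat 0 1 0"] assms(3)[of "su2_mat 0 1 0" "su2_mat 0 0 1"]
      assms(3)[of "su2_mat 0 0 1" "su2_mat 1 0 0"]
    unfolding A B by (simp add: commutator_su2_mat trace_su2_mat complex_eq_iff)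
qed

text \<open>\<open>su2\<close> is spanned by its commutators. This reduces a claim linear in Z to Z
  = [X, Y], where fundamental fields and their bracket can be brought in.\<close>

lemma linear_eq_on_su2:
  assumes "linear f" "linear g"
    "\<And>X Y. X \<in> su2 \<Longrightarrow> Y \<in> su2 \<Longrightarrow> f (commutator X Y) = g (commutator X Y)"
    and "Z \<in> su2"
  shows "f Z = g Z"
proof -
  obtain x y z where Z: "Z = su2_mat x y z" using assms unfolding su2_iff by blast
  \<comment> \<open>The halves cancel the factor 2 of \<open>commutator_su2_mat\<close>.\<close>
  have "Z = commutator (su2_mat 0 1 0) (su2_mat 0 0 (x/2)) + commutator (su2_mat 0 0 1) (su2_mat (y/2) 0 0)
     + commutator (su2_mat 1 0 0) (su2_mat 0 (z/2) 0)"
    by (simp add: Z commutator_su2_mat su2_mat_add)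
  then show ?thesis
    by (simp add: linear_add[OF assms(1)] linear_add[OF assms(2)] assms(3))
qed

section \<open>Conjugation and derivatives of group-valued maps\<close>

lemma su2_conj: "g \<in> SU2 \<Longrightarrow> X \<in> su2 \<Longrightarrow> matrix_inv g ** X ** g \<in> su2"
proof -
  assume g: "g \<in> SU2" and X: "X \<in> su2"
  obtain p q where g': "g = quat_mat p q"
    using g unfolding SU2_quat_iff by blast
  obtain x y z where X': "X = su2_mat x y z" using X unfolding su2_iff by blast
  have "matrix_inv g ** X ** g = quat_mat (cnj p) (- q) ** X ** quat_mat p q"
    using SU2_inv(4)[OF g] by (simp add: g' matrix2_simps)
  then show ?thesis
    unfolding X' su2_mat_def quat_mat_mult su2_def
    by (simp add: matrix2_simps complex_eq_iff algebra_simps)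
qed

lemma matrix_diff_mult: "(A - B) ** C = A ** C - B ** C" "C ** (A - B) = C ** A - C ** B"
  for A B C :: "'a::ring_1^'n^'n"
  by (simp_all add: matrix_matrix_mult_def vec_eq_iff sum_subtractf algebra_simps)

lemma commutator_conj:
  assumes "g \<in> SU2"
  shows "commutator (matrix_inv g ** X ** g) (matrix_inv g ** Y ** g) = matrix_inv g ** commutator X Y ** g"
proof -
  have "(matrix_inv g ** X ** g) ** (matrix_inv g ** Y ** g) = matrix_inv g ** (X ** Y) ** g" for X Y
  proof -
    have "(matrix_inv g ** X ** g) ** (matrix_inv g ** Y ** g) = matrix_inv g ** X ** (g ** matrix_inv g) ** Y ** g"
      by (simp only: matrix_mul_assoc)
    then show ?thesis by (simp add: SU2_inv(2)[OF assms] matrix_mul_assoc)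
  qed
  then show ?thesis by (simp add: commutator_def matrix_diff_mult)
qed

lemma trace_conj:
  assumes "g \<in> SU2"
  shows "trace ((matrix_inv g ** X ** g) ** (matrix_inv g ** Y ** g)) = trace (X ** Y)"
proof -
  have "(matrix_inv g ** X ** g) ** (matrix_inv g ** Y ** g) = matrix_inv g ** X ** (g ** matrix_inv g) ** Y ** g"
    by (simp only: matrix_mul_assoc)
  also have "\<dots> = matrix_inv g ** (X ** Y ** g)" by (simp add: SU2_inv(2)[OF assms] matrix_mul_assoc)
  also have "trace \<dots> = trace (X ** Y ** (g ** matrix_inv g))"
    by (subst trace_mul_sym) (simp only: matrix_mul_assoc)
  finally show ?thesis by (simp add: SU2_inv(2)[OF assms])
qed

lemma bounded_bilinear_matrix_mult: "bounded_bilinear ((**) :: complex^2^2 \<Rightarrow> complex^2^2 \<Rightarrow> complex^2^2)"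
proof -
  have "bilinear ((**) :: complex^2^2 \<Rightarrow> complex^2^2 \<Rightarrow> complex^2^2)"
    by (auto simp: bilinear_def intro!: linearI simp: matrix2_simps complex_eq_iff algebra_simps)
  then show ?thesis by (simp add: bilinear_conv_bounded_bilinear)
qed

text \<open>Differentiate the two conditions on f, being quaternionic and having norm 1:
  \<open>f' v\<close> is a quaternion orthogonal to \<open>f x\<close>. Multiplied by the conjugate
  of \<open>f x\<close>, which is its inverse, it becomes imaginary.\<close>

lemma SU2_valued_derivative:
  assumes "(f has_derivative f') (at x)" "open S" "x \<in> S" "\<And>y. y \<in> S \<Longrightarrow> f y \<in> SU2"
  shows "matrix_inv (f x) ** f' v \<in> su2"
proof -
  have SU: "f x \<in> SU2" using assms by auto
  have "((\<lambda>y. quat_proj (f y)) has_derivative (\<lambda>v. quat_proj (f' v))) (at x)"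
    by (rule bounded_linear.has_derivative[OF bounded_linear_quat(3) assms(1)])
  then have "(f has_derivative (\<lambda>v. quat_proj (f' v))) (at x)"
  proof (rule has_derivative_transform_within_open[OF _ assms(2,3)])
    fix y assume "y \<in> S"
    then have "f y \<in> SU2" by (rule assms(4))
    then show "quat_proj (f y) = f y" unfolding SU2_quat_iff by auto
  qed
  then have q: "f' v = quat_proj (f' v)" using has_derivative_unique[OF assms(1)] by metis
  have "((\<lambda>y. quat_p (f y) \<bullet> quat_p (f y) + quat_q (f y) \<bullet> quat_q (f y)) has_derivative
    (\<lambda>v. (quat_p (f x) \<bullet> quat_p (f' v) + quat_p (f' v) \<bullet> quat_p (f x)) + (quat_q (f x) \<bullet> quat_q (f' v) + quat_q (f' v) \<bullet> quat_q (f x)))) (at x)"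
    by (intro has_derivative_add has_derivative_inner bounded_linear.has_derivative[OF _ assms(1)] bounded_linear_quat)
  then have "((\<lambda>y. 1::real) has_derivative
    (\<lambda>v. (quat_p (f x) \<bullet> quat_p (f' v) + quat_p (f' v) \<bullet> quat_p (f x)) + (quat_q (f x) \<bullet> quat_q (f' v) + quat_q (f' v) \<bullet> quat_q (f x)))) (at x)"
  proof (rule has_derivative_transform_within_open[OF _ assms(2,3)])
    fix y assume "y \<in> S"
    then have "f y \<in> SU2" by (rule assms(4))
    then show "quat_p (f y) \<bullet> quat_p (f y) + quat_q (f y) \<bullet> quat_q (f y) = 1" unfolding SU2_quat_iff by auto
  qed
  from has_derivative_unique[OF this has_derivative_const]
  have 0: "quat_p (f x) \<bullet> quat_p (f' v) + quat_q (f x) \<bullet> quat_q (f' v) = 0"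
    by (drule_tac fun_cong[of _ _ v]) (simp add: inner_commute)
  obtain p q where pq: "f x = quat_mat p q"
    using SU unfolding SU2_quat_iff by blast
  obtain r s where rs: "f' v = quat_mat r s" using q unfolding quat_proj_def by blast
  have "matrix_inv (f x) = quat_mat (cnj p) (- q)"
    using SU2_inv(4)[OF SU] by (simp add: pq matrix2_simps)
  then have "matrix_inv (f x) ** f' v = quat_mat (cnj p * r + q * cnj s) (cnj p * s - q * cnj r)"
    by (simp add: rs quat_mat_mult)
  then show ?thesis
    using 0 by (simp add: pq rs su2_def matrix2_simps inner_complex_def complex_eq_iff algebra_simps)
qed

section \<open>Charts, smooth maps and differential forms\<close>

lemma chart_facts:
  assumes "is_chart c"
  shows "open (cdom c)" "open (coord c ` cdom c)" "inj_on (coord c) (cdom c)"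
    "continuous_on (cdom c) (coord c)" "continuous_on (coord c ` cdom c) (param c)"
    "\<And>x. x \<in> cdom c \<Longrightarrow> param c (coord c x) = x"
    "\<And>u. u \<in> coord c ` cdom c \<Longrightarrow> coord c (param c u) = u"
    "\<And>u. u \<in> coord c ` cdom c \<Longrightarrow> param c u \<in> cdom c"
proof -
  have h: "homeomorphism (cdom c) (coord c ` cdom c) (coord c) (param c)"
    using assms by (simp add: is_chart_def)
  show "open (cdom c)" "open (coord c ` cdom c)" using assms by (auto simp: is_chart_def)
  show "inj_on (coord c) (cdom c)" using h by (metis homeomorphism_apply1 inj_on_inverseI)
  show "continuous_on (cdom c) (coord c)" "continuous_on (coord c ` cdom c) (param c)"
    using h by (auto simp: homeomorphism_def)
  show "\<And>x. x \<in> cdom c \<Longrightarrow> param c (coord c x) = x"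
    "\<And>u. u \<in> coord c ` cdom c \<Longrightarrow> coord c (param c u) = u"
    "\<And>u. u \<in> coord c ` cdom c \<Longrightarrow> param c u \<in> cdom c"
    using h by (auto simp: homeomorphism_def)
qed

lemma chart_image_iff:
  assumes "is_chart c"
  shows "u \<in> coord c ` (cdom c \<inter> S) \<longleftrightarrow> u \<in> coord c ` cdom c \<and> param c u \<in> S"
    "u \<in> coord c ` {x \<in> cdom c \<inter> S. P x} \<longleftrightarrow> u \<in> coord c ` cdom c \<and> param c u \<in> S \<and> P (param c u)"
proof -
  show "u \<in> coord c ` (cdom c \<inter> S) \<longleftrightarrow> u \<in> coord c ` cdom c \<and> param c u \<in> S" for S
    using chart_facts(6)[OF assms] by auto
  from this[of "{x \<in> S. P x}"]
  show "u \<in> coord c ` {x \<in> cdom c \<inter> S. P x} \<longleftrightarrow> u \<in> coord c ` cdom c \<and> param c u \<in> S \<and> P (param c u)"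
    by (simp add: Int_def conj_ac)
qed

lemma open_chart_image:
  assumes "is_chart c" "open S"
  shows "open (coord c ` (cdom c \<inter> S))"
proof -
  have "coord c ` (cdom c \<inter> S) = coord c ` cdom c \<inter> param c -` S"
    using chart_image_iff[OF assms(1)] by auto
  then show ?thesis
    using continuous_open_preimage[OF chart_facts(5,2)[OF assms(1)] assms(2)] by simp
qed

lemma atlas_chart: "smooth_atlas A \<Longrightarrow> c \<in> A \<Longrightarrow> is_chart c"
  by (simp add: smooth_atlas_def)

lemma atlas_cover: "smooth_atlas A \<Longrightarrow> \<exists>c\<in>A. x \<in> cdom c"
  unfolding smooth_atlas_def by blast

lemma param_std [simp]: "param (UNIV, \<lambda>x. x) = (\<lambda>x. x)"
  by (auto simp: fun_eq_iff inv_into_f_f)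

lemma smooth_atlas_std: "smooth_atlas std_atlas"
  unfolding smooth_atlas_def std_atlas_def is_chart_def
  by (auto simp: homeomorphism_def smooth_on_open o_def)

section \<open>Differentials of maps in charts\<close>

definition dmap :: "('m \<Rightarrow> 'n) \<Rightarrow> ('m, 'e::euclidean_space) chart \<Rightarrow> ('n, 'f::euclidean_space) chart \<Rightarrow> 'e \<Rightarrow> 'e \<Rightarrow> 'f" where
  "dmap f c c' u = frechet_derivative (coord c' \<circ> f \<circ> param c) (at u)"

lemma smooth_map_local_rep:
  assumes "smooth_map A B S f" "smooth_atlas A" "smooth_atlas B" "open S" "c \<in> A" "c' \<in> B"
  shows "open {x \<in> cdom c \<inter> S. f x \<in> cdom c'}"
    "open (coord c ` {x \<in> cdom c \<inter> S. f x \<in> cdom c'})"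
    "Cinf_on (coord c ` {x \<in> cdom c \<inter> S. f x \<in> cdom c'}) (coord c' \<circ> f \<circ> param c)"
proof -
  note ch = atlas_chart[OF assms(2,5)] atlas_chart[OF assms(3,6)]
  have "open (S \<inter> f -` cdom c')"
    using assms(1,4) chart_facts(1)[OF ch(2)] by (intro continuous_open_preimage) (auto simp: smooth_map_def)
  then have o: "open (cdom c \<inter> (S \<inter> f -` cdom c'))" using chart_facts(1)[OF ch(1)] by blast
  have eq: "{x \<in> cdom c \<inter> S. f x \<in> cdom c'} = cdom c \<inter> (S \<inter> f -` cdom c')" by auto
  show "open {x \<in> cdom c \<inter> S. f x \<in> cdom c'}" unfolding eq by (rule o)
  show op: "open (coord c ` {x \<in> cdom c \<inter> S. f x \<in> cdom c'})"
    unfolding eq using open_chart_image[OF ch(1) \<open>open (S \<inter> f -` cdom c')\<close>] .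
  show "Cinf_on (coord c ` {x \<in> cdom c \<inter> S. f x \<in> cdom c'}) (coord c' \<circ> f \<circ> param c)"
    using assms(1,5,6) smooth_on_open[OF op] unfolding smooth_map_def by blast
qed

lemma dmap_has_derivative:
  assumes "smooth_map A B S f" "smooth_atlas A" "smooth_atlas B" "open S" "c \<in> A" "c' \<in> B"
    "u \<in> coord c ` cdom c" "param c u \<in> S" "f (param c u) \<in> cdom c'"
  shows "((coord c' \<circ> f \<circ> param c) has_derivative dmap f c c' u) (at u)"
  unfolding dmap_def
  by (rule Cinf_on_has_derivative[OF smooth_map_local_rep(3)[OF assms(1-6)]])
    (intro chart_image_iff(2)[OF atlas_chart[OF assms(2,5)], THEN iffD2] conjI assms(7-))

lemma dmap_linear:
  assumes "smooth_map A B S f" "smooth_atlas A" "smooth_atlas B" "open S" "c \<in> A" "c' \<in> B"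
    "u \<in> coord c ` cdom c" "param c u \<in> S" "f (param c u) \<in> cdom c'"
  shows "linear (dmap f c c' u)"
  using dmap_has_derivative[OF assms] by (rule has_derivative_linear)

text \<open>\<open>param c'\<close> inverts \<open>coord c'\<close> only on the domain of c', so the
  composed coordinate expressions agree with that of the composite map merely near u; derivatives
  see no more than that.\<close>

lemma dmap_chain_has_derivative:
  assumes f: "smooth_map A B S f" and g: "smooth_map B C T g"
    and A: "smooth_atlas A" and B: "smooth_atlas B" and C: "smooth_atlas C"
    and o: "open S" "open T" and c: "c \<in> A" "c' \<in> B" "c'' \<in> C"
    and u: "u \<in> coord c ` cdom c" "param c u \<in> S" "f (param c u) \<in> cdom c'" "f (param c u) \<in> T"
      "g (f (param c u)) \<in> cdom c''"
  shows "((\<lambda>u. coord c'' (g (f (param c u)))) has_derivative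
      (\<lambda>v. dmap g c' c'' (coord c' (f (param c u))) (dmap f c c' u v))) (at u)"
proof -
  note ch = atlas_chart[OF A c(1)] atlas_chart[OF B c(2)]
  note F = dmap_has_derivative[OF f A B o(1) c(1,2) u(1-3)]
  have p: "param c' (coord c' (f (param c u))) = f (param c u)"
    using chart_facts(6)[OF ch(2)] u(3) by simp
  have "((coord c'' \<circ> g \<circ> param c') has_derivative dmap g c' c'' (coord c' (f (param c u)))) (at (coord c' (f (param c u))))"
    by (rule dmap_has_derivative[OF g B C o(2) c(2,3)]) (simp_all only: p imageI u)
  then have "((\<lambda>u. (coord c'' \<circ> g \<circ> param c') ((coord c' \<circ> f \<circ> param c) u)) has_derivative
      (\<lambda>v. dmap g c' c'' (coord c' (f (param c u))) (dmap f c c' u v))) (at u)"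
    using has_derivative_compose[OF F, of "coord c'' \<circ> g \<circ> param c'" "dmap g c' c'' (coord c' (f (param c u)))"]
    by (simp only: o_apply)
  then show ?thesis
  proof (rule has_derivative_transform_within_open)
    show "open (coord c ` {x \<in> cdom c \<inter> S. f x \<in> cdom c'})"
      by (rule smooth_map_local_rep(2)[OF f A B o(1) c(1,2)])
    show "u \<in> coord c ` {x \<in> cdom c \<inter> S. f x \<in> cdom c'}"
      by (intro chart_image_iff(2)[OF ch(1), THEN iffD2] conjI u)
    fix y assume "y \<in> coord c ` {x \<in> cdom c \<inter> S. f x \<in> cdom c'}"
    then have "f (param c y) \<in> cdom c'" by (simp only: chart_image_iff(2)[OF ch(1)])
    then show "(coord c'' \<circ> g \<circ> param c') ((coord c' \<circ> f \<circ> param c) y) = coord c'' (g (f (param c y)))"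
      using chart_facts(6)[OF ch(2)] by simp
  qed
qed

lemma dmap_chain:
  assumes f: "smooth_map A B S f" and g: "smooth_map B C T g"
    and A: "smooth_atlas A" and B: "smooth_atlas B" and C: "smooth_atlas C"
    and o: "open S" "open T" and c: "c \<in> A" "c' \<in> B" "c'' \<in> C"
    and u: "u \<in> coord c ` cdom c" "param c u \<in> S" "f (param c u) \<in> cdom c'" "f (param c u) \<in> T"
      "g (f (param c u)) \<in> cdom c''"
  shows "dmap (\<lambda>x. g (f x)) c c'' u v = dmap g c' c'' (coord c' (f (param c u))) (dmap f c c' u v)"
  using fun_cong[OF frechet_derivative_at[OF dmap_chain_has_derivative[OF assms]], of v]
  unfolding dmap_def[of "\<lambda>x. g (f x)"] o_def by (rule sym)

lemma dmap_cong:
  assumes "is_chart c" "open T" "u \<in> coord c ` cdom c" "param c u \<in> T" "\<And>x. x \<in> T \<Longrightarrow> f x = g x"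
  shows "dmap f c c' u = dmap g c c' u"
  unfolding dmap_def
  by (rule frechet_derivative_cong_germ[OF open_chart_image[OF assms(1,2)]])
    (use assms chart_image_iff(1)[OF assms(1)] in auto)

lemma smooth_map_id: "smooth_atlas A \<Longrightarrow> smooth_map A A UNIV (\<lambda>x. x)"
  unfolding smooth_map_def
proof (intro conjI ballI continuous_on_id)
  fix c c' assume A: "smooth_atlas A" and c: "c \<in> A" "c' \<in> A"
  have "{x \<in> cdom c \<inter> UNIV. x \<in> cdom c'} = cdom c \<inter> cdom c'" by blast
  moreover have "coord c' \<circ> (\<lambda>x. x) \<circ> param c = coord c' \<circ> param c" by (simp only: fun_eq_iff o_apply simp_thms)
  moreover have "smooth_on (coord c ` (cdom c \<inter> cdom c')) (coord c' \<circ> param c)"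
    using A c unfolding smooth_atlas_def by blast
  ultimately show "smooth_on (coord c ` {x \<in> cdom c \<inter> UNIV. x \<in> cdom c'}) (coord c' \<circ> (\<lambda>x. x) \<circ> param c)"
    by (simp only:)
qed

lemma dmap_id_same:
  assumes "is_chart c" "u \<in> coord c ` cdom c"
  shows "dmap (\<lambda>x. x) c c u v = v"
proof -
  have "frechet_derivative (coord c \<circ> (\<lambda>x. x) \<circ> param c) (at u) = frechet_derivative (\<lambda>x. x) (at u)"
    by (rule frechet_derivative_cong_germ[OF chart_facts(2)[OF assms(1)] assms(2)])
      (use chart_facts(7)[OF assms(1)] in auto)
  then show ?thesis by (simp add: dmap_def)
qed

text \<open>Chart changes become differentials of the identity map, so \<open>dmap_chain\<close>
  covers them too.\<close>

lemma transition_eq_dmap: "frechet_derivative (coord c' \<circ> param c) (at u) = dmap (\<lambda>x. x) c c' u"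
  by (simp add: dmap_def o_def)

subsection \<open>Alternating families\<close>

lemma alternating_linear:
  "alternating k f \<Longrightarrow> length xs + Suc (length ys) = k \<Longrightarrow> linear (\<lambda>v. f (xs @ v # ys))"
proof -
  assume a: "alternating k f" and l: "length xs + Suc (length ys) = k"
  have "linear (\<lambda>v. f ((xs @ 0 # ys)[length xs := v]))"
    using a[unfolded alternating_def, rule_format, of "xs @ 0 # ys", THEN conjunct1, rule_format, of "length xs"] l by simp
  then show ?thesis by simp
qed

lemma alternating_map:
  fixes L :: "'c::real_vector \<Rightarrow> 'a::real_vector"
  assumes "alternating k f" "linear L"
  shows "alternating k (\<lambda>vs. f (map L vs))"
proof -
  have 1: "\<And>vs i. length vs = k \<Longrightarrow> i < k \<Longrightarrow> linear (\<lambda>v. f (vs[i := v]))"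
    and 2: "\<And>vs i j. length vs = k \<Longrightarrow> i < k \<Longrightarrow> j < k \<Longrightarrow> i \<noteq> j \<Longrightarrow> vs ! i = vs ! j \<Longrightarrow> f vs = 0"
    using assms(1) unfolding alternating_def by blast+
  show ?thesis
    unfolding alternating_def
  proof (intro allI impI conjI)
    fix vs :: "'c list" and i assume l: "length vs = k" and i: "i < k"
    show "linear (\<lambda>v. f (map L (vs[i := v])))"
      using linear_compose[OF assms(2) 1[of "map L vs" i]] l i by (simp add: o_def map_update)
  next
    fix vs :: "'c list" and i j assume "length vs = k" "i < k" "j < k" "i \<noteq> j \<and> vs ! i = vs ! j"
    then show "f (map L vs) = 0" by (intro 2[of "map L vs" i j]) simp_all
  qed
qed

lemma alternating_cong:
  assumes "alternating k f" "\<And>vs. length vs = k \<Longrightarrow> f vs = g vs"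
  shows "alternating k g"
proof -
  have "(\<lambda>v. f (vs[i := v])) = (\<lambda>v. g (vs[i := v]))" if "length vs = k" for vs i
    using assms(2) that by simp
  then show ?thesis using assms unfolding alternating_def by simp
qed

lemma alternating_zero: "alternating k (\<lambda>vs. 0)"
  by (simp add: alternating_def linear_zero)

lemma alternating_1I: "linear (\<lambda>v. f [v]) \<Longrightarrow> alternating 1 f"
  by (auto simp: alternating_def length_Suc_conv)

lemma alternating3:
  assumes "alternating 3 f"
  shows "linear (\<lambda>v. f [v, b, c])" "linear (\<lambda>v. f [a, v, c])" "linear (\<lambda>v. f [a, b, v])"
    "f [a, a, c] = 0" "f [a, b, a] = 0" "f [a, b, b] = 0"
    "f [b, a, c] = - f [a, b, c]" "f [a, c, b] = - f [a, b, c]" "f [c, b, a] = - f [a, b, c]"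
proof -
  show L: "linear (\<lambda>v. f [v, b, c])" "linear (\<lambda>v. f [a, v, c])" "linear (\<lambda>v. f [a, b, v])" for a b c
    using alternating_linear[OF assms, of "[]" "[b, c]"] alternating_linear[OF assms, of "[a]" "[c]"]
      alternating_linear[OF assms, of "[a, b]" "[]"] by auto
  have A: "length vs = 3 \<Longrightarrow> i < 3 \<Longrightarrow> j < 3 \<Longrightarrow> i \<noteq> j \<Longrightarrow> vs ! i = vs ! j \<Longrightarrow> f vs = 0" for vs i j
    using assms unfolding alternating_def by blast
  show Z: "f [a, a, c] = 0" "f [a, b, a] = 0" "f [a, b, b] = 0" for a b c
    using A[of "[a, a, c]" 0 1] A[of "[a, b, a]" 0 2] A[of "[a, b, b]" 1 2] by auto
  have add: "f [x + y, b, c] = f [x, b, c] + f [y, b, c]" "f [b, x + y, c] = f [b, x, c] + f [b, y, c]"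
    "f [b, c, x + y] = f [b, c, x] + f [b, c, y]" for x y b c
    using linear_add[OF L(1)] linear_add[OF L(2)] linear_add[OF L(3)] by auto
  \<comment> \<open>Polarisation: each left-hand side vanishes, having a repeated argument.\<close>
  have "f [a + b, a + b, c] = f [b, a, c] + f [a, b, c]" "f [a, b + c, b + c] = f [a, c, b] + f [a, b, c]"
    "f [a + c, b, a + c] = f [c, b, a] + f [a, b, c]"
    unfolding add by (simp_all add: Z)
  then show "f [b, a, c] = - f [a, b, c]" "f [a, c, b] = - f [a, b, c]" "f [c, b, a] = - f [a, b, c]"
    by (simp_all add: Z eq_neg_iff_add_eq_0)
qed

text \<open>Smoothness is given for fixed arguments only. Expanding each varying argument in the
  basis reduces to that case, one slot at a time.\<close>

lemma Cinf_on_alternating_family: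
  fixes T :: "'x::euclidean_space \<Rightarrow> 'e::euclidean_space list \<Rightarrow> 'v::real_normed_vector"
  assumes o: "open O'" and alt: "\<And>u. u \<in> O' \<Longrightarrow> alternating k (T u)"
    and sm: "\<And>vs. length vs = k \<Longrightarrow> Cinf_on O' (\<lambda>u. T u vs)"
    and fs: "\<And>f. f \<in> set fs \<Longrightarrow> Cinf_on O' f" and l: "length fs + length vs = k"
  shows "Cinf_on O' (\<lambda>u. T u (map (\<lambda>f. f u) fs @ vs))"
  using fs l
\<comment> \<open>The last varying argument goes first: its basis vectors then join the fixed tail
  \<open>vs\<close>, as the induction hypothesis requires.\<close>
proof (induction fs arbitrary: vs rule: rev_induct)
  case Nil
  then show ?case using sm by simp
next
  case (snoc f fs)
  have "Cinf_on O' (\<lambda>u. \<Sum>b\<in>Basis. (f u \<bullet> b) *\<^sub>R T u (map (\<lambda>f. f u) fs @ b # vs))"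
  proof (rule Cinf_on_sum[OF finite_Basis o], rule Cinf_on_scaleR[OF o])
    fix b :: 'e
    show "Cinf_on O' (\<lambda>u. f u \<bullet> b)"
      by (rule Cinf_on_linear_comp[OF bounded_linear_inner_left o]) (use snoc.prems in simp)
    show "Cinf_on O' (\<lambda>u. T u (map (\<lambda>f. f u) fs @ b # vs))"
      by (rule snoc.IH) (use snoc.prems in simp_all)
  qed
  moreover have "(\<Sum>b\<in>Basis. (f u \<bullet> b) *\<^sub>R T u (map (\<lambda>f. f u) fs @ b # vs)) = T u (map (\<lambda>f. f u) (fs @ [f]) @ vs)"
    if "u \<in> O'" for u
  proof -
    have lin: "linear (\<lambda>v. T u (map (\<lambda>f. f u) fs @ v # vs))"
      by (rule alternating_linear[OF alt[OF that]]) (use snoc.prems in simp)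
    have "T u (map (\<lambda>f. f u) fs @ (\<Sum>b\<in>Basis. (f u \<bullet> b) *\<^sub>R b) # vs) = (\<Sum>b\<in>Basis. (f u \<bullet> b) *\<^sub>R T u (map (\<lambda>f. f u) fs @ b # vs))"
      using linear_sum[OF lin, of "\<lambda>b. (f u \<bullet> b) *\<^sub>R b" Basis] linear_cmul[OF lin] by simp
    then show ?thesis by (simp add: euclidean_representation)
  qed
  ultimately show ?case by (rule Cinf_on_cong[OF o])
qed

text \<open>A product rule for evaluating a varying linear map at a varying vector, where the map is
  differentiated through its values on fixed vectors.\<close>

lemma has_derivative_linear_family:
  fixes G :: "'x::euclidean_space \<Rightarrow> 'e::euclidean_space \<Rightarrow> 'v::real_normed_vector"
  assumes o: "open O'" "t0 \<in> O'" and lin: "\<And>t. t \<in> O' \<Longrightarrow> linear (G t)"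
    and G': "\<And>v. ((\<lambda>t. G t v) has_derivative G' v) (at t0)"
    and f: "(f has_derivative f') (at t0)"
  shows "((\<lambda>t. G t (f t)) has_derivative (\<lambda>h. G' (f t0) h + G t0 (f' h))) (at t0)"
proof -
  have exp: "G t v = (\<Sum>b\<in>Basis. (v \<bullet> b) *\<^sub>R G t b)" if "t \<in> O'" for t v
    using linear_sum[OF lin[OF that], of "\<lambda>b. (v \<bullet> b) *\<^sub>R b" Basis] linear_cmul[OF lin[OF that]]
    by (simp add: euclidean_representation)
  \<comment> \<open>Linearity of \<open>G t\<close> in v passes to \<open>G'\<close> by uniqueness
    of the derivative.\<close>
  have exp': "G' v = (\<lambda>h. \<Sum>b\<in>Basis. (v \<bullet> b) *\<^sub>R G' b h)" for v
  proof (rule has_derivative_unique)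
    show "((\<lambda>t. G t v) has_derivative G' v) (at t0)" by (rule G')
    have "((\<lambda>t. \<Sum>b\<in>Basis. (v \<bullet> b) *\<^sub>R G t b) has_derivative (\<lambda>h. \<Sum>b\<in>Basis. (v \<bullet> b) *\<^sub>R G' b h)) (at t0)"
      by (intro has_derivative_sum has_derivative_scaleR_right G')
    then show "((\<lambda>t. G t v) has_derivative (\<lambda>h. \<Sum>b\<in>Basis. (v \<bullet> b) *\<^sub>R G' b h)) (at t0)"
      by (rule has_derivative_transform_within_open[OF _ o]) (rule exp[symmetric])
  qed
  have "((\<lambda>t. \<Sum>b\<in>Basis. (f t \<bullet> b) *\<^sub>R G t b) has_derivative
      (\<lambda>h. \<Sum>b\<in>Basis. (f t0 \<bullet> b) *\<^sub>R G' b h + (f' h \<bullet> b) *\<^sub>R G t0 b)) (at t0)"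
    by (intro has_derivative_sum has_derivative_scaleR G' has_derivative_inner_left f)
  moreover have "(\<lambda>h. \<Sum>b\<in>Basis. (f t0 \<bullet> b) *\<^sub>R G' b h + (f' h \<bullet> b) *\<^sub>R G t0 b) = (\<lambda>h. G' (f t0) h + G t0 (f' h))"
  proof
    fix h
    show "(\<Sum>b\<in>Basis. (f t0 \<bullet> b) *\<^sub>R G' b h + (f' h \<bullet> b) *\<^sub>R G t0 b) = G' (f t0) h + G t0 (f' h)"
      using exp[OF o(2), of "f' h"] fun_cong[OF exp'[of "f t0"], of h] by (simp only: sum.distrib)
  qed
  ultimately have "((\<lambda>t. \<Sum>b\<in>Basis. (f t \<bullet> b) *\<^sub>R G t b) has_derivative (\<lambda>h. G' (f t0) h + G t0 (f' h))) (at t0)"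
    by simp
  then show ?thesis
    by (rule has_derivative_transform_within_open[OF _ o]) (rule exp[symmetric])
qed

lemma has_derivative_alternating3:
  fixes T :: "'x::euclidean_space \<Rightarrow> 'e::euclidean_space list \<Rightarrow> 'v::real_normed_vector"
  assumes o: "open O'" "t0 \<in> O'" and alt: "\<And>t. t \<in> O' \<Longrightarrow> alternating 3 (T t)"
    and T': "\<And>vs. length vs = 3 \<Longrightarrow> ((\<lambda>t. T t vs) has_derivative T' vs) (at t0)"
    and f: "(f1 has_derivative f1') (at t0)" "(f2 has_derivative f2') (at t0)" "(f3 has_derivative f3') (at t0)"
  shows "((\<lambda>t. T t [f1 t, f2 t, f3 t]) has_derivative (\<lambda>h. T' [f1 t0, f2 t0, f3 t0] h
    + T t0 [f1 t0, f2 t0, f3' h] + T t0 [f1 t0, f2' h, f3 t0] + T t0 [f1' h, f2 t0, f3 t0])) (at t0)"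
proof -
  have 1: "((\<lambda>t. T t [a, b, f3 t]) has_derivative (\<lambda>h. T' [a, b, f3 t0] h + T t0 [a, b, f3' h])) (at t0)" for a b
    by (rule has_derivative_linear_family[OF o, of "\<lambda>t v. T t [a, b, v]" "\<lambda>v. T' [a, b, v]"])
      (use alternating3(3)[OF alt] T' f in auto)
  have 2: "((\<lambda>t. T t [a, f2 t, f3 t]) has_derivative (\<lambda>h. T' [a, f2 t0, f3 t0] h + T t0 [a, f2 t0, f3' h] + T t0 [a, f2' h, f3 t0])) (at t0)" for a
    by (rule has_derivative_linear_family[OF o, of "\<lambda>t v. T t [a, v, f3 t]" "\<lambda>v h. T' [a, v, f3 t0] h + T t0 [a, v, f3' h]"])
      (use alternating3(2)[OF alt] 1 f in auto)
  show ?thesis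
    by (rule has_derivative_linear_family[OF o, of "\<lambda>t v. T t [v, f2 t, f3 t]" "\<lambda>v h. T' [v, f2 t0, f3 t0] h + T t0 [v, f2 t0, f3' h] + T t0 [v, f2' h, f3 t0]"])
      (use alternating3(1)[OF alt] 2 f in auto)
qed

subsection \<open>Forms and pullbacks\<close>

lemma k_formD:
  assumes "k_form A S k \<omega>" "smooth_atlas A" "open S" "c \<in> A"
  shows "u \<in> coord c ` cdom c \<Longrightarrow> param c u \<in> S \<Longrightarrow> alternating k (\<omega> c u)"
    "length vs = k \<Longrightarrow> Cinf_on (coord c ` (cdom c \<inter> S)) (\<lambda>u. \<omega> c u vs)"
    "c' \<in> A \<Longrightarrow> u \<in> coord c ` cdom c \<Longrightarrow> param c u \<in> cdom c' \<Longrightarrow> param c u \<in> S \<Longrightarrow> length vs = k \<Longrightarrow>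
       \<omega> c u vs = \<omega> c' (coord c' (param c u)) (map (dmap (\<lambda>x. x) c c' u) vs)"
proof -
  note ch = atlas_chart[OF assms(2,4)]
  note F = assms(1)[unfolded k_form_def transition_eq_dmap]
  note F1 = F[THEN conjunct1, rule_format, OF assms(4)]
    and F2 = F[THEN conjunct2, THEN conjunct1, rule_format, OF assms(4)]
    and F3 = F[THEN conjunct2, THEN conjunct2, rule_format, OF assms(4)]
  show "alternating k (\<omega> c u)" if "u \<in> coord c ` cdom c" "param c u \<in> S"
    by (rule F1) (simp only: chart_image_iff(1)[OF ch] that simp_thms)
  show "Cinf_on (coord c ` (cdom c \<inter> S)) (\<lambda>u. \<omega> c u vs)" if "length vs = k"
    using F2[OF that] smooth_on_open[OF open_chart_image[OF ch assms(3)]] by blast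
  show "\<omega> c u vs = \<omega> c' (coord c' (param c u)) (map (dmap (\<lambda>x. x) c c' u) vs)"
    if "c' \<in> A" "u \<in> coord c ` cdom c" "param c u \<in> cdom c'" "param c u \<in> S" "length vs = k"
    by (rule F3[OF that(1) _ that(5)]) (simp only: Int_assoc chart_image_iff(1)[OF ch] Int_iff that simp_thms)
qed

text \<open>Smoothness is asked for near each point only, so charts and sections may be chosen
  depending on that point.\<close>

lemma k_formI:
  assumes "smooth_atlas A" "open S"
    and "\<And>c u. c \<in> A \<Longrightarrow> u \<in> coord c ` cdom c \<Longrightarrow> param c u \<in> S \<Longrightarrow> alternating k (\<omega> c u)"
    and "\<And>c u0 vs. c \<in> A \<Longrightarrow> u0 \<in> coord c ` cdom c \<Longrightarrow> param c u0 \<in> S \<Longrightarrow> length vs = k \<Longrightarrow>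
      \<exists>N. open N \<and> u0 \<in> N \<and> Cinf_on N (\<lambda>u. \<omega> c u vs)"
    and "\<And>c c' u vs. c \<in> A \<Longrightarrow> c' \<in> A \<Longrightarrow> u \<in> coord c ` cdom c \<Longrightarrow> param c u \<in> cdom c' \<Longrightarrow> param c u \<in> S \<Longrightarrow> length vs = k \<Longrightarrow>
       \<omega> c u vs = \<omega> c' (coord c' (param c u)) (map (dmap (\<lambda>x. x) c c' u) vs)"
  shows "k_form A S k \<omega>"
  unfolding k_form_def transition_eq_dmap
proof (intro conjI ballI allI impI)
  fix c u assume c: "c \<in> A" and "u \<in> coord c ` (cdom c \<inter> S)"
  then show "alternating k (\<omega> c u)"
    by (intro assms(3)) (simp_all only: chart_image_iff(1)[OF atlas_chart[OF assms(1) c]])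
next
  fix c and vs :: "'b list" assume c: "c \<in> A" and l: "length vs = k"
  note ch = atlas_chart[OF assms(1) c]
  have "Cinf_on (coord c ` (cdom c \<inter> S)) (\<lambda>u. \<omega> c u vs)"
    by (rule Cinf_on_local, rule assms(4)[OF c _ _ l]) (simp_all only: chart_image_iff(1)[OF ch])
  then show "smooth_on (coord c ` (cdom c \<inter> S)) (\<lambda>u. \<omega> c u vs)"
    using smooth_on_open[OF open_chart_image[OF ch assms(2)]] by blast
next
  fix c c' u and vs :: "'b list"
  assume c: "c \<in> A" "c' \<in> A" and u: "u \<in> coord c ` (cdom c \<inter> cdom c' \<inter> S)" and l: "length vs = k"
  have "u \<in> coord c ` cdom c" "param c u \<in> cdom c'" "param c u \<in> S"
    using u by (simp_all only: Int_assoc chart_image_iff(1)[OF atlas_chart[OF assms(1) c(1)]] Int_iff)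
  then show "\<omega> c u vs = \<omega> c' (coord c' (param c u)) (map (dmap (\<lambda>x. x) c c' u) vs)"
    by (rule assms(5)[OF c _ _ _ l])
qed

text \<open>The transformation law absorbs the chart chosen by \<open>SOME\<close> in
  \<open>pullback\<close>; afterwards any chart around the image point may be used.\<close>

lemma pullback_eq:
  assumes f: "smooth_map A B S f" and AB: "smooth_atlas A" "smooth_atlas B" and o: "open S" "open T"
    and \<omega>: "k_form B T k \<omega>" and c: "c \<in> A" "c' \<in> B" "u \<in> coord c ` cdom c" "param c u \<in> S"
      "f (param c u) \<in> cdom c'" "f (param c u) \<in> T" "length vs = k"
  shows "pullback B f \<omega> c u vs = \<omega> c' (coord c' (f (param c u))) (map (dmap f c c' u) vs)"
proof -
  define c'' where "c'' = (SOME c'. c' \<in> B \<and> f (param c u) \<in> cdom c')"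
  have c'': "c'' \<in> B" "f (param c u) \<in> cdom c''"
    using someI[of "\<lambda>c'. c' \<in> B \<and> f (param c u) \<in> cdom c'" c'] c unfolding c''_def by auto
  note ch = atlas_chart[OF AB(2) c''(1)]
  have p: "param c'' (coord c'' (f (param c u))) = f (param c u)"
    using chart_facts(6)[OF ch] c'' by simp
  have "pullback B f \<omega> c u vs = \<omega> c'' (coord c'' (f (param c u))) (map (dmap f c c'' u) vs)"
    unfolding pullback_def c''_def[symmetric] Let_def dmap_def ..
  also have "\<dots> = \<omega> c' (coord c' (f (param c u))) (map (dmap (\<lambda>x. x) c'' c' (coord c'' (f (param c u)))) (map (dmap f c c'' u) vs))"
    using k_formD(3)[OF \<omega> AB(2) o(2) c''(1) c(2), of "coord c'' (f (param c u))" "map (dmap f c c'' u) vs"]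
      p c c'' by auto
  also have "map (dmap (\<lambda>x. x) c'' c' (coord c'' (f (param c u)))) (map (dmap f c c'' u) vs) = map (dmap f c c' u) vs"
    using dmap_chain[OF f smooth_map_id[OF AB(2)] AB(1,2,2) o(1) open_UNIV c(1) c''(1) c(2,3,4)] c'' c by auto
  finally show ?thesis .
qed

lemma k_form_pullback:
  assumes f: "smooth_map A B S f" and AB: "smooth_atlas A" "smooth_atlas B" and o: "open S" "open T"
    and \<omega>: "k_form B T k \<omega>" and ST: "f ` S \<subseteq> T"
  shows "k_form A S k (pullback B f \<omega>)"
proof (rule k_formI[OF AB(1) o(1)])
  note pb = pullback_eq[OF f AB o \<omega>]
  fix c u assume c: "c \<in> A" and u: "u \<in> coord c ` cdom c" "param c u \<in> S"
  obtain c' where c': "c' \<in> B" "f (param c u) \<in> cdom c'" using atlas_cover[OF AB(2)] by blast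
  have T: "f (param c u) \<in> T" using ST u by blast
  note ch = atlas_chart[OF AB(2) c'(1)]
  have p: "param c' (coord c' (f (param c u))) = f (param c u)"
    using chart_facts(6)[OF ch] c' by simp
  have "alternating k (\<omega> c' (coord c' (f (param c u))))"
    by (rule k_formD(1)[OF \<omega> AB(2) o(2) c'(1)]) (simp_all only: p c' T imageI)
  from alternating_map[OF this dmap_linear[OF f AB o(1) c c'(1) u c'(2)]]
  have "alternating k (\<lambda>vs. \<omega> c' (coord c' (f (param c u))) (map (dmap f c c' u) vs))" .
  then show "alternating k (pullback B f \<omega> c u)"
    by (rule alternating_cong) (rule pb[OF c c'(1) u c'(2) T, symmetric])
next
  note pb = pullback_eq[OF f AB o \<omega>]
  fix c u0 and vs :: "'b list" assume c: "c \<in> A" and u0: "u0 \<in> coord c ` cdom c" "param c u0 \<in> S" and l: "length vs = k"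
  obtain c' where c': "c' \<in> B" "f (param c u0) \<in> cdom c'" using atlas_cover[OF AB(2)] by blast
  note ch = atlas_chart[OF AB(1) c] atlas_chart[OF AB(2) c'(1)]
  define N where "N = coord c ` {x \<in> cdom c \<inter> S. f x \<in> cdom c'}"
  define \<phi> where "\<phi> = coord c' \<circ> f \<circ> param c"
  have N: "open N" and \<phi>: "Cinf_on N \<phi>"
    using smooth_map_local_rep(2,3)[OF f AB o(1) c c'(1)] unfolding N_def \<phi>_def by auto
  have Nu: "u \<in> coord c ` cdom c" "param c u \<in> S" "f (param c u) \<in> cdom c'" if "u \<in> N" for u
    using that unfolding N_def by (simp_all only: chart_image_iff(2)[OF ch(1)])
  have NT: "f (param c u) \<in> T" if "u \<in> N" for u
    using ST Nu(2)[OF that] by (rule subsetD[OF _ imageI])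
  have \<phi>N: "\<phi> ` N \<subseteq> coord c' ` (cdom c' \<inter> T)"
    unfolding \<phi>_def by (rule image_subsetI) (simp only: o_apply, intro imageI IntI Nu NT)
  \<comment> \<open>In these charts the pullback is the coefficient along \<open>\<phi>\<close>,
    evaluated on the smooth vector functions d\<phi>(v).\<close>
  have "Cinf_on N (\<lambda>u. \<omega> c' (\<phi> u) (map (\<lambda>f. f u) (map (\<lambda>v u. frechet_derivative \<phi> (at u) v) vs) @ []))"
  proof (rule Cinf_on_alternating_family[OF N])
    show "alternating k (\<omega> c' (\<phi> u))" if "u \<in> N" for u
      by (rule k_formD(1)[OF \<omega> AB(2) o(2) c'(1)])
        (simp_all only: \<phi>_def o_apply imageI chart_facts(6)[OF ch(2)] Nu[OF that] NT[OF that])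
    show "Cinf_on N (\<lambda>u. \<omega> c' (\<phi> u) vs)" if "length vs = k" for vs
      by (rule Cinf_on_compose[OF N open_chart_image[OF ch(2) o(2)] \<phi>N k_formD(2)[OF \<omega> AB(2) o(2) c'(1) that] \<phi>])
    show "Cinf_on N g" if "g \<in> set (map (\<lambda>v u. frechet_derivative \<phi> (at u) v) vs)" for g
      using that Cinf_on_deriv[OF \<phi>] by auto
  qed (use l in auto)
  then have "Cinf_on N (\<lambda>u. pullback B f \<omega> c u vs)"
  proof (rule Cinf_on_cong[OF N])
    fix u assume "u \<in> N"
    show "\<omega> c' (\<phi> u) (map (\<lambda>f. f u) (map (\<lambda>v u. frechet_derivative \<phi> (at u) v) vs) @ []) = pullback B f \<omega> c u vs"
      unfolding pb[OF c c'(1) Nu[OF \<open>u \<in> N\<close>] NT[OF \<open>u \<in> N\<close>] l] dmap_def \<phi>_def by (simp add: o_def)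
  qed
  moreover have "u0 \<in> N" unfolding N_def by (simp only: chart_image_iff(2)[OF ch(1)] u0 c'(2) simp_thms)
  ultimately show "\<exists>N. open N \<and> u0 \<in> N \<and> Cinf_on N (\<lambda>u. pullback B f \<omega> c u vs)"
    using N by blast
next
  note pb = pullback_eq[OF f AB o \<omega>]
  fix c c1 u and vs :: "'b list"
  assume c: "c \<in> A" "c1 \<in> A" and u: "u \<in> coord c ` cdom c" "param c u \<in> cdom c1" "param c u \<in> S" and l: "length vs = k"
  obtain c' where c': "c' \<in> B" "f (param c u) \<in> cdom c'" using atlas_cover[OF AB(2)] by blast
  have T: "f (param c u) \<in> T" using ST u by blast
  note ch = atlas_chart[OF AB(1) c(2)]
  have p: "param c1 (coord c1 (param c u)) = param c u"
    using chart_facts(6)[OF ch] u by simp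
  have "dmap f c c' u v = dmap f c1 c' (coord c1 (param c u)) (dmap (\<lambda>x. x) c c1 u v)" for v
    by (rule dmap_chain[OF smooth_map_id[OF AB(1)] f AB(1,1,2) open_UNIV o(1) c c'(1) u(1)])
      (simp_all only: u c' UNIV_I)
  then have d: "map (dmap f c1 c' (coord c1 (param c u))) (map (dmap (\<lambda>x. x) c c1 u) vs) = map (dmap f c c' u) vs"
    by simp
  have "pullback B f \<omega> c1 (coord c1 (param c u)) (map (dmap (\<lambda>x. x) c c1 u) vs)
      = \<omega> c' (coord c' (f (param c1 (coord c1 (param c u))))) (map (dmap f c1 c' (coord c1 (param c u))) (map (dmap (\<lambda>x. x) c c1 u) vs))"
    by (rule pb[OF c(2) c'(1)]) (simp_all only: p u imageI c' T l length_map)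
  then show "pullback B f \<omega> c u vs = pullback B f \<omega> c1 (coord c1 (param c u)) (map (dmap (\<lambda>x. x) c c1 u) vs)"
    unfolding p d pb[OF c(1) c'(1) u(1,3) c'(2) T l] by (rule sym)
qed

subsection \<open>Exterior derivatives\<close>

lemma ext_d_two: "ext_d \<omega> c u [v, w] =
    frechet_derivative (\<lambda>y. \<omega> c y [w]) (at u) v - frechet_derivative (\<lambda>y. \<omega> c y [v]) (at u) w"
  by (simp add: ext_d_def numeral_2_eq_2 lessThan_Suc)

lemma ext_d_four: "ext_d \<omega> c u [v1, v2, v3, v4] =
    frechet_derivative (\<lambda>y. \<omega> c y [v2, v3, v4]) (at u) v1 - frechet_derivative (\<lambda>y. \<omega> c y [v1, v3, v4]) (at u) v2
    + frechet_derivative (\<lambda>y. \<omega> c y [v1, v2, v4]) (at u) v3 - frechet_derivative (\<lambda>y. \<omega> c y [v1, v2, v3]) (at u) v4"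
proof -
  have "{..<4} = {0, 1, 2, 3::nat}" by auto
  then show ?thesis by (simp add: ext_d_def)
qed

text \<open>Used for the derivatives of a 3-form, whose alternating sum over four vectors then vanishes
  because they are linearly dependent.\<close>

lemma alternating3_det:
  fixes f :: "(real^3) list \<Rightarrow> real"
  assumes "alternating 3 f"
  shows "f [a, b, c] = f [axis 1 1, axis 2 1, axis 3 1] *
    (a$1 * (b$2 * c$3 - b$3 * c$2) - a$2 * (b$1 * c$3 - b$3 * c$1) + a$3 * (b$1 * c$2 - b$2 * c$1))"
proof -
  let ?e1 = "axis 1 1 :: real^3" and ?e2 = "axis 2 1 :: real^3" and ?e3 = "axis 3 1 :: real^3"
  have ex: "v = (v$1) *\<^sub>R ?e1 + (v$2) *\<^sub>R ?e2 + (v$3) *\<^sub>R ?e3" for v :: "real^3"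
    by (simp add: vec_eq_iff forall_3 axis_def)
  have lin: "f [x + y, p, q] = f [x, p, q] + f [y, p, q]" "f [p, x + y, q] = f [p, x, q] + f [p, y, q]"
    "f [p, q, x + y] = f [p, q, x] + f [p, q, y]" "f [r *\<^sub>R x, p, q] = r * f [x, p, q]"
    "f [p, r *\<^sub>R x, q] = r * f [p, x, q]" "f [p, q, r *\<^sub>R x] = r * f [p, q, x]" for x y p q r
    using linear_add[OF alternating3(1)[OF assms]] linear_add[OF alternating3(2)[OF assms]] linear_add[OF alternating3(3)[OF assms]]
      linear_cmul[OF alternating3(1)[OF assms]] linear_cmul[OF alternating3(2)[OF assms]] linear_cmul[OF alternating3(3)[OF assms]]
    by auto
  note alt = alternating3(4-6)[OF assms]
  have sw: "f [?e1, ?e3, ?e2] = - f [?e1, ?e2, ?e3]" "f [?e2, ?e1, ?e3] = - f [?e1, ?e2, ?e3]"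
    "f [?e3, ?e2, ?e1] = - f [?e1, ?e2, ?e3]" "f [?e2, ?e3, ?e1] = f [?e1, ?e2, ?e3]" "f [?e3, ?e1, ?e2] = f [?e1, ?e2, ?e3]"
    using alternating3(7)[OF assms, of ?e2 ?e1 ?e3] alternating3(8)[OF assms, of ?e1 ?e2 ?e3] alternating3(9)[OF assms, of ?e1 ?e2 ?e3]
      alternating3(7)[OF assms, of ?e3 ?e2 ?e1] alternating3(8)[OF assms, of ?e3 ?e2 ?e1] alternating3(7)[OF assms, of ?e2 ?e1 ?e3] by linarith+
  have "f [a, b, c] = f [(a$1) *\<^sub>R ?e1 + (a$2) *\<^sub>R ?e2 + (a$3) *\<^sub>R ?e3,
      (b$1) *\<^sub>R ?e1 + (b$2) *\<^sub>R ?e2 + (b$3) *\<^sub>R ?e3, (c$1) *\<^sub>R ?e1 + (c$2) *\<^sub>R ?e2 + (c$3) *\<^sub>R ?e3]"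
    using ex[of a] ex[of b] ex[of c] by simp
  also have "\<dots> = f [?e1, ?e2, ?e3] *
    (a$1 * (b$2 * c$3 - b$3 * c$2) - a$2 * (b$1 * c$3 - b$3 * c$1) + a$3 * (b$1 * c$2 - b$2 * c$1))"
    unfolding lin alt sw by (simp add: algebra_simps)
  finally show ?thesis .
qed

lemma closed_form_top_degree:
  fixes A :: "('m::topological_space, real^3) chart set" and \<omega> :: "('m, real^3, real) form"
  assumes "k_form A UNIV 3 \<omega>" "smooth_atlas A"
  shows "closed_form A 3 \<omega>"
  unfolding closed_form_def form_eq_def
proof (intro ballI allI impI)
  fix c u and vs :: "(real^3) list" assume c: "c \<in> A" and u: "u \<in> coord c ` cdom c" and "length vs = Suc 3"
  then obtain v1 v2 v3 v4 where vs: "vs = [v1, v2, v3, v4]"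
    by (auto simp: length_Suc_conv numeral_3_eq_3)
  let ?O = "coord c ` cdom c"
  have o: "open ?O" using chart_facts(2)[OF atlas_chart[OF assms(2) c]] .
  define g where "g y = \<omega> c y [axis 1 1, axis 2 1, axis 3 1]" for y
  define L where "L = frechet_derivative g (at u)"
  have gd: "(g has_derivative L) (at u)"
    unfolding L_def g_def[abs_def]
    using Cinf_on_has_derivative[OF k_formD(2)[OF assms open_UNIV c]] u by simp
  \<comment> \<open>On constant vectors only the coefficient \<open>g\<close> of the coordinate
    volume form varies.\<close>
  have D: "frechet_derivative (\<lambda>y. \<omega> c y [p, q, r]) (at u) v = L v *
     (p$1 * (q$2 * r$3 - q$3 * r$2) - p$2 * (q$1 * r$3 - q$3 * r$1) + p$3 * (q$1 * r$2 - q$2 * r$1))" for p q r v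
  proof -
    let ?d = "p$1 * (q$2 * r$3 - q$3 * r$2) - p$2 * (q$1 * r$3 - q$3 * r$1) + p$3 * (q$1 * r$2 - q$2 * r$1)"
    have "((\<lambda>y. g y * ?d) has_derivative (\<lambda>v. L v * ?d)) (at u)"
      by (rule has_derivative_mult_left[OF gd])
    then have "((\<lambda>y. \<omega> c y [p, q, r]) has_derivative (\<lambda>v. L v * ?d)) (at u)"
    proof (rule has_derivative_transform_within_open[OF _ o u])
      fix y assume "y \<in> ?O"
      then show "g y * ?d = \<omega> c y [p, q, r]"
        unfolding g_def by (intro alternating3_det[symmetric] k_formD(1)[OF assms open_UNIV c] UNIV_I)
    qed
    from frechet_derivative_at[OF this] show ?thesis by (simp add: fun_eq_iff)
  qed
  have ex: "v = (v$1) *\<^sub>R axis 1 1 + (v$2) *\<^sub>R axis 2 1 + (v$3) *\<^sub>R axis 3 1" for v :: "real^3"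
    by (simp add: vec_eq_iff forall_3 axis_def)
  have Lv: "L v = v$1 * L (axis 1 1) + v$2 * L (axis 2 1) + v$3 * L (axis 3 1)" for v
  proof -
    have "L v = L ((v$1) *\<^sub>R axis 1 1 + (v$2) *\<^sub>R axis 2 1 + (v$3) *\<^sub>R axis 3 1)"
      by (rule arg_cong[OF ex])
    also have "\<dots> = v$1 * L (axis 1 1) + v$2 * L (axis 2 1) + v$3 * L (axis 3 1)"
      using has_derivative_linear[OF gd] by (simp only: linear_add linear_cmul real_scaleR_def)
    finally show ?thesis .
  qed
  \<comment> \<open>The coefficient of each \<open>L (axis i 1)\<close> is a 4x4 determinant in
    which the row of i-th coordinates occurs twice.\<close>
  show "ext_d \<omega> c u vs = 0"
    unfolding vs ext_d_four D Lv[of v1] Lv[of v2] Lv[of v3] Lv[of v4] by algebra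
qed

section \<open>Principal bundles\<close>

lemma has_derivative_partial:
  assumes "(F has_derivative F') (at (u, A))"
  shows "((\<lambda>B. F (u, B)) has_derivative (\<lambda>H. F' (0, H))) (at A)"
    "((\<lambda>y. F (y, A)) has_derivative (\<lambda>v. F' (v, 0))) (at u)"
  by (rule has_derivative_compose[OF has_derivative_Pair[OF has_derivative_const has_derivative_ident] assms]
      has_derivative_compose[OF has_derivative_Pair[OF has_derivative_ident has_derivative_const] assms])+

context principal_SU2_bundle
begin

section \<open>Smoothness of the action\<close>

lemma P_chart: "c \<in> AP \<Longrightarrow> is_chart c" and M_chart: "c' \<in> AM \<Longrightarrow> is_chart c'"
  using atlas_chart total_atlas base_atlas by blast+

lemma smooth_map_act:
  assumes g: "g \<in> SU2"
  shows "smooth_map AP AP UNIV (\<lambda>q. act q g)"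
proof -
  have cont: "continuous_on UNIV (\<lambda>q. act q g)"
    using continuous_on_compose2[OF act_continuous, of UNIV "\<lambda>q. (q, g)"] g
    by (simp add: continuous_on_Pair image_subset_iff)
  show ?thesis
    unfolding smooth_map_def
  proof (intro conjI ballI cont)
    fix c c' assume c: "c \<in> AP" "c' \<in> AP"
    note ch = P_chart[OF c(1)] P_chart[OF c(2)]
    let ?D = "coord c ` {q \<in> cdom c \<inter> UNIV. act q g \<in> cdom c'}"
    have "open {q. act q g \<in> cdom c'}"
      using continuous_open_preimage[OF cont open_UNIV chart_facts(1)[OF ch(2)]] by (simp add: vimage_def)
    moreover have eq: "{q \<in> cdom c \<inter> UNIV. act q g \<in> cdom c'} = cdom c \<inter> {q. act q g \<in> cdom c'}" by auto
    ultimately have o: "open ?D" using open_chart_image[OF ch(1)] by simp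
    have "Cinf_on ?D (\<lambda>u. (\<lambda>(u, g). coord c' (act (param c u) g)) (u, g))"
    proof (rule smooth_on_compose_Cinf[OF act_smooth[OF c] o Cinf_on_Pair[OF o Cinf_on_id Cinf_on_const]])
      show "(\<lambda>u. (u, g)) ` ?D \<subseteq> {(coord c q, g) |q g. q \<in> cdom c \<and> g \<in> SU2 \<and> act q g \<in> cdom c'}"
        using g by blast
    qed
    then show "smooth_on ?D (coord c' \<circ> (\<lambda>q. act q g) \<circ> param c)"
      by (simp only: smooth_on_open[OF o] o_def prod.case)
  qed
qed

text \<open>The action in coordinates, extended to an open set of matrices. There are two charts
  because translation may leave the chart of the point. Point and group element are one joint
  variable so that mixed second derivatives are symmetric.\<close>

definition actx :: "('p, 'f) chart \<Rightarrow> ('p, 'f) chart \<Rightarrow> 'f \<times> (complex^2^2) \<Rightarrow> 'f" where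
  "actx c c' z = coord c' (act (param c (fst z)) (SU2_retr (snd z)))"

definition actx_dom :: "('p, 'f) chart \<Rightarrow> ('p, 'f) chart \<Rightarrow> ('f \<times> (complex^2^2)) set" where
  "actx_dom c c' = {z. fst z \<in> coord c ` cdom c \<and> snd z \<in> retr_dom \<and>
     act (param c (fst z)) (SU2_retr (snd z)) \<in> cdom c'}"

lemma actx_dom_iff:
  "(u, A) \<in> actx_dom c c' \<longleftrightarrow> u \<in> coord c ` cdom c \<and> A \<in> retr_dom \<and> act (param c u) (SU2_retr A) \<in> cdom c'"
  by (simp add: actx_dom_def)

lemma actx_dom_SU2:
  "g \<in> SU2 \<Longrightarrow> u \<in> coord c ` cdom c \<Longrightarrow> act (param c u) g \<in> cdom c' \<Longrightarrow> (u, g) \<in> actx_dom c c'"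
  by (simp only: actx_dom_iff SU2_in_retr_dom SU2_retr_id simp_thms)

lemma actx_dom_1: "c \<in> AP \<Longrightarrow> u \<in> coord c ` cdom c \<Longrightarrow> (u, mat 1) \<in> actx_dom c c"
  by (rule actx_dom_SU2[OF mat_1_SU2]) (simp_all only: act_one chart_facts(8)[OF P_chart])

lemma actx_1: "c \<in> AP \<Longrightarrow> u \<in> coord c ` cdom c \<Longrightarrow> actx c c (u, mat 1) = u"
  by (simp only: actx_def fst_conv snd_conv SU2_retr_id[OF mat_1_SU2] act_one chart_facts(7)[OF P_chart])

lemma actx_smooth:
  assumes c: "c \<in> AP" "c' \<in> AP"
  shows "open (actx_dom c c')" "Cinf_on (actx_dom c c') (actx c c')"
proof -
  note ch = P_chart[OF c(1)] P_chart[OF c(2)]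
  let ?B = "coord c ` cdom c \<times> retr_dom"
  have "continuous_on ?B (\<lambda>z. (param c (fst z), SU2_retr (snd z)))"
    by (intro continuous_on_Pair continuous_on_compose2[OF chart_facts(5)[OF ch(1)]]
        continuous_on_compose2[OF Cinf_on_continuous[OF Cinf_on_SU2_retr]] continuous_on_fst continuous_on_snd continuous_on_id) auto
  then have "continuous_on ?B (\<lambda>z. (\<lambda>(q, g). act q g) (param c (fst z), SU2_retr (snd z)))"
    by (rule continuous_on_compose2[OF act_continuous]) (use SU2_retr_in in auto)
  then have cont: "continuous_on ?B (\<lambda>z. act (param c (fst z)) (SU2_retr (snd z)))" by simp
  have "actx_dom c c' = ?B \<inter> (\<lambda>z. act (param c (fst z)) (SU2_retr (snd z))) -` cdom c'"
    unfolding actx_dom_def by (auto simp: mem_Times_iff)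
  then show o: "open (actx_dom c c')"
    using continuous_open_preimage[OF cont open_Times[OF chart_facts(2)[OF ch(1)] open_retr_dom] chart_facts(1)[OF ch(2)]]
    by (simp only:)
  have "Cinf_on (actx_dom c c') (\<lambda>z. SU2_retr (snd z))"
    by (rule Cinf_on_compose[OF o open_retr_dom _ Cinf_on_SU2_retr Cinf_on_bounded_linear[OF bounded_linear_snd]])
      (auto simp: actx_dom_def)
  then have "Cinf_on (actx_dom c c') (\<lambda>z. (fst z, SU2_retr (snd z)))"
    by (rule Cinf_on_Pair[OF o Cinf_on_bounded_linear[OF bounded_linear_fst]])
  then have "Cinf_on (actx_dom c c') (\<lambda>z. (\<lambda>(u, g). coord c' (act (param c u) g)) (fst z, SU2_retr (snd z)))"
  proof (rule smooth_on_compose_Cinf[OF act_smooth[OF c] o])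
    show "(\<lambda>z. (fst z, SU2_retr (snd z))) ` actx_dom c c'
      \<subseteq> {(coord c q, g) |q g. q \<in> cdom c \<and> g \<in> SU2 \<and> act q g \<in> cdom c'}"
    proof (rule image_subsetI)
      fix z assume z: "z \<in> actx_dom c c'"
      then have "(fst z, SU2_retr (snd z)) = (coord c (param c (fst z)), SU2_retr (snd z))"
        by (simp add: actx_dom_def chart_facts(7)[OF ch(1)])
      moreover have "param c (fst z) \<in> cdom c" "SU2_retr (snd z) \<in> SU2" "act (param c (fst z)) (SU2_retr (snd z)) \<in> cdom c'"
        using z unfolding actx_dom_def by (simp_all only: mem_Collect_eq chart_facts(8)[OF ch(1)] SU2_retr_in)
      ultimately show "(fst z, SU2_retr (snd z)) \<in> {(coord c q, g) |q g. q \<in> cdom c \<and> g \<in> SU2 \<and> act q g \<in> cdom c'}"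
        by blast
    qed
  qed
  then show "Cinf_on (actx_dom c c') (actx c c')" by (simp add: actx_def[abs_def])
qed

lemma actx_has_derivative:
  assumes c: "c \<in> AP" "c' \<in> AP" and z: "z \<in> actx_dom c c'"
  shows "(actx c c' has_derivative frechet_derivative (actx c c') (at z)) (at z)"
  by (rule Cinf_on_has_derivative[OF actx_smooth(2)[OF c] z])

lemma open_actx_slice:
  assumes c: "c \<in> AP" "c' \<in> AP"
  shows "open {A. (u, A) \<in> actx_dom c c'}" "open {y. (y, A) \<in> actx_dom c c'}"
proof -
  have "open ((\<lambda>A. (u, A)) -` actx_dom c c')" "open ((\<lambda>y. (y, A)) -` actx_dom c c')"
    by (intro open_vimage actx_smooth(1)[OF c] continuous_intros)+
  then show "open {A. (u, A) \<in> actx_dom c c'}" "open {y. (y, A) \<in> actx_dom c c'}"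
    by (simp_all add: vimage_def)
qed

subsection \<open>Fundamental vector fields\<close>

text \<open>The fundamental field \<xi>_X in coordinates. Admitting all matrices X, and not only
  \<open>su2\<close>, lets linearity be applied to products such as \<open>X ** Y\<close>.\<close>

definition fund :: "('p, 'f) chart \<Rightarrow> complex^2^2 \<Rightarrow> 'f \<Rightarrow> 'f" where
  "fund c X u = frechet_derivative (actx c c) (at (u, mat 1)) (0, X)"

lemma fund_has_derivative:
  assumes "c \<in> AP" "u \<in> coord c ` cdom c"
  shows "((\<lambda>A. actx c c (u, A)) has_derivative (\<lambda>X. fund c X u)) (at (mat 1))"
  unfolding fund_def
  by (rule has_derivative_partial(1)[OF actx_has_derivative[OF assms(1,1) actx_dom_1[OF assms]]])

lemma fund_linear: "c \<in> AP \<Longrightarrow> u \<in> coord c ` cdom c \<Longrightarrow> linear (\<lambda>X. fund c X u)"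
  using has_derivative_linear[OF fund_has_derivative] .

lemma fund_smooth:
  assumes c: "c \<in> AP"
  shows "Cinf_on (coord c ` cdom c) (fund c X)"
proof -
  have "Cinf_on (coord c ` cdom c) (\<lambda>u. (\<lambda>z. frechet_derivative (actx c c) (at z) (0, X)) (u, mat 1))"
  proof (rule Cinf_on_compose[OF chart_facts(2)[OF P_chart[OF c]] actx_smooth(1)[OF c c]])
    show "(\<lambda>u. (u, mat 1)) ` coord c ` cdom c \<subseteq> actx_dom c c"
      by (rule image_subsetI) (rule actx_dom_1[OF c])
    show "Cinf_on (actx_dom c c) (\<lambda>z. frechet_derivative (actx c c) (at z) (0, X))"
      by (rule Cinf_on_deriv[OF actx_smooth(2)[OF c c]])
    show "Cinf_on (coord c ` cdom c) (\<lambda>u. (u, mat 1 :: complex^2^2))"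
      by (rule Cinf_on_Pair[OF chart_facts(2)[OF P_chart[OF c]] Cinf_on_id Cinf_on_const])
  qed
  then show ?thesis by (simp add: fund_def[abs_def])
qed

text \<open>Fundamental fields are velocities of orbit maps. Their properties follow by writing an
  orbit map in two ways and comparing derivatives at the identity.\<close>

lemma orbit_has_derivative:
  assumes f: "smooth_map AP B S f" and B: "smooth_atlas B" and o: "open S" and c: "c \<in> AP" "c' \<in> B"
    and u: "u \<in> coord c ` cdom c" "param c u \<in> S" "f (param c u) \<in> cdom c'"
  shows "((\<lambda>A. coord c' (f (act (param c u) (SU2_retr A)))) has_derivative (\<lambda>X. dmap f c c' u (fund c X u))) (at (mat 1))"
proof -
  have "((coord c' \<circ> f \<circ> param c) has_derivative dmap f c c' u) (at (actx c c (u, mat 1)))"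
    unfolding actx_1[OF c(1) u(1)] by (rule dmap_has_derivative[OF f total_atlas B o c u])
  from has_derivative_compose[OF fund_has_derivative[OF c(1) u(1)] this]
  have "((\<lambda>A. (coord c' \<circ> f \<circ> param c) (actx c c (u, A))) has_derivative (\<lambda>X. dmap f c c' u (fund c X u))) (at (mat 1))" .
  then show ?thesis
  proof (rule has_derivative_transform_within_open[OF _ open_actx_slice(1)[OF c(1) c(1)]])
    show "mat 1 \<in> {A. (u, A) \<in> actx_dom c c}" by (rule CollectI) (rule actx_dom_1[OF c(1) u(1)])
    fix A assume "A \<in> {A. (u, A) \<in> actx_dom c c}"
    then have "act (param c u) (SU2_retr A) \<in> cdom c" by (simp add: actx_dom_iff)
    then show "(coord c' \<circ> f \<circ> param c) (actx c c (u, A)) = coord c' (f (act (param c u) (SU2_retr A)))"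
      by (simp only: o_apply actx_def fst_conv snd_conv chart_facts(6)[OF P_chart[OF c(1)]])
  qed
qed

lemma bounded_linear_mult_const:
  "bounded_linear (\<lambda>X :: complex^2^2. g ** X)" "bounded_linear (\<lambda>X :: complex^2^2. X ** g)"
  by (rule bounded_bilinear.bounded_linear_right[OF bounded_bilinear_matrix_mult]
      bounded_bilinear.bounded_linear_left[OF bounded_bilinear_matrix_mult])+

lemma retr_dom_nbhd: "open retr_dom" "mat 1 \<in> retr_dom"
  by (rule open_retr_dom, rule SU2_in_retr_dom[OF mat_1_SU2])

text \<open>From q (g A) = (q g) A, differentiated at A = 1. It expresses the group derivative of
  the action at any g by a fundamental vector at q g.\<close>

lemma actx_derivative_SU2:
  assumes c: "c \<in> AP" "c' \<in> AP" and g: "g \<in> SU2" and u: "u \<in> coord c ` cdom c" "act (param c u) g \<in> cdom c'"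
  shows "frechet_derivative (actx c c') (at (u, g)) (0, g ** X) = fund c' X (coord c' (act (param c u) g))"
proof -
  let ?u' = "coord c' (act (param c u) g)"
  have u': "?u' \<in> coord c' ` cdom c'" by (rule imageI[OF u(2)])
  have "((\<lambda>B. actx c c' (u, B)) has_derivative (\<lambda>H. frechet_derivative (actx c c') (at (u, g)) (0, H))) (at (g ** mat 1))"
    unfolding matrix_mul_rid
    by (rule has_derivative_partial(1)[OF actx_has_derivative[OF c actx_dom_SU2[OF g u]]])
  from has_derivative_compose[OF bounded_linear_imp_has_derivative[OF bounded_linear_mult_const(1)] this]
  have 1: "((\<lambda>A. actx c c' (u, g ** A)) has_derivative (\<lambda>X. frechet_derivative (actx c c') (at (u, g)) (0, g ** X))) (at (mat 1))" .
  have "((\<lambda>A. actx c' c' (?u', A)) has_derivative (\<lambda>X. frechet_derivative (actx c c') (at (u, g)) (0, g ** X))) (at (mat 1))"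
    by (rule has_derivative_transform_within_open[OF 1 retr_dom_nbhd])
      (simp only: actx_def fst_conv snd_conv chart_facts(6)[OF P_chart[OF c(2)] u(2)] SU2_retr_mult(1)[OF g] act_mult[OF g SU2_retr_in])
  from has_derivative_unique[OF this fund_has_derivative[OF c(2) u']] show ?thesis by (rule fun_cong)
qed

text \<open>The orbit map (q A) g = q (A g) has velocity in direction X g = g (g^-1 X g), to which
  \<open>actx_derivative_SU2\<close> applies.\<close>

lemma act_fund:
  assumes c: "c \<in> AP" "c' \<in> AP" and g: "g \<in> SU2" and u: "u \<in> coord c ` cdom c" "act (param c u) g \<in> cdom c'"
  shows "dmap (\<lambda>q. act q g) c c' u (fund c X u) = fund c' (matrix_inv g ** X ** g) (coord c' (act (param c u) g))"
proof -
  have "((\<lambda>B. actx c c' (u, B)) has_derivative (\<lambda>H. frechet_derivative (actx c c') (at (u, g)) (0, H))) (at (mat 1 ** g))"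
    unfolding matrix_mul_lid
    by (rule has_derivative_partial(1)[OF actx_has_derivative[OF c actx_dom_SU2[OF g u]]])
  from has_derivative_compose[OF bounded_linear_imp_has_derivative[OF bounded_linear_mult_const(2)] this]
  have 1: "((\<lambda>A. actx c c' (u, A ** g)) has_derivative (\<lambda>X. frechet_derivative (actx c c') (at (u, g)) (0, X ** g))) (at (mat 1))" .
  have 2: "((\<lambda>A. coord c' (act (act (param c u) (SU2_retr A)) g)) has_derivative (\<lambda>X. frechet_derivative (actx c c') (at (u, g)) (0, X ** g))) (at (mat 1))"
    by (rule has_derivative_transform_within_open[OF 1 retr_dom_nbhd])
      (simp only: actx_def fst_conv snd_conv SU2_retr_mult(2)[OF g] act_mult[OF SU2_retr_in g])
  have "((\<lambda>A. coord c' (act (act (param c u) (SU2_retr A)) g)) has_derivative (\<lambda>X. dmap (\<lambda>q. act q g) c c' u (fund c X u))) (at (mat 1))"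
    by (rule orbit_has_derivative[OF smooth_map_act[OF g] total_atlas open_UNIV c u(1) UNIV_I u(2)])
  from has_derivative_unique[OF this 2]
  have "dmap (\<lambda>q. act q g) c c' u (fund c X u) = frechet_derivative (actx c c') (at (u, g)) (0, X ** g)" by (rule fun_cong)
  also have "X ** g = g ** (matrix_inv g ** X ** g)"
    by (simp only: matrix_mul_assoc SU2_inv(2)[OF g] matrix_mul_lid)
  finally show ?thesis by (simp only: actx_derivative_SU2[OF c g u])
qed

text \<open>An orbit stays in one fibre, so its projection is constant.\<close>

lemma proj_fund:
  assumes c: "c \<in> AP" "c' \<in> AM" and u: "u \<in> coord c ` cdom c" "\<pi> (param c u) \<in> cdom c'"
  shows "dmap \<pi> c c' u (fund c X u) = 0"
proof -
  have 1: "((\<lambda>A. coord c' (\<pi> (act (param c u) (SU2_retr A)))) has_derivative (\<lambda>X. dmap \<pi> c c' u (fund c X u))) (at (mat 1))"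
    by (rule orbit_has_derivative[OF proj_smooth base_atlas open_UNIV c u(1) UNIV_I u(2)])
  have "((\<lambda>A. coord c' (\<pi> (param c u))) has_derivative (\<lambda>X. dmap \<pi> c c' u (fund c X u))) (at (mat 1))"
    by (rule has_derivative_transform_within_open[OF 1 retr_dom_nbhd]) (simp only: proj_act[OF SU2_retr_in])
  from has_derivative_unique[OF this has_derivative_const] show ?thesis by (rule fun_cong)
qed

lemma fund_vertical: "c \<in> AP \<Longrightarrow> u \<in> coord c ` cdom c \<Longrightarrow> vertical AM \<pi> c u (fund c X u)"
  unfolding vertical_def dmap_def[symmetric] by (intro ballI impI) (rule proj_fund)

subsection \<open>Local trivialisations\<close>

lemma local_trivD:
  assumes "local_triv AM AP \<pi> act U s \<gamma>"
  shows "open U" "smooth_map AM AP U s" "smooth_map AP std_atlas (\<pi> -` U) \<gamma>" "open (\<pi> -` U)"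
    "\<pi> q \<in> U \<Longrightarrow> \<gamma> q \<in> SU2" "x \<in> U \<Longrightarrow> \<pi> (s x) = x"
    "x \<in> U \<Longrightarrow> g \<in> SU2 \<Longrightarrow> \<gamma> (act (s x) g) = g"
    "\<pi> q \<in> U \<Longrightarrow> act (s (\<pi> q)) (\<gamma> q) = q"
proof -
  note a = assms[unfolded local_triv_def]
  show U: "open U" and "smooth_map AM AP U s" "smooth_map AP std_atlas (\<pi> -` U) \<gamma>" using a by blast+
  show "open (\<pi> -` U)"
    using continuous_open_preimage[OF _ open_UNIV U, of \<pi>] proj_smooth by (simp add: smooth_map_def)
  show "\<pi> q \<in> U \<Longrightarrow> \<gamma> q \<in> SU2" "x \<in> U \<Longrightarrow> \<pi> (s x) = x"
    "x \<in> U \<Longrightarrow> g \<in> SU2 \<Longrightarrow> \<gamma> (act (s x) g) = g" "\<pi> q \<in> U \<Longrightarrow> act (s (\<pi> q)) (\<gamma> q) = q"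
    using a by blast+
qed

lemma fibre_coord_has_derivative:
  assumes t: "local_triv AM AP \<pi> act U s \<gamma>" and c: "c \<in> AP" and u: "u \<in> coord c ` cdom c" "\<pi> (param c u) \<in> U"
  shows "((\<gamma> \<circ> param c) has_derivative frechet_derivative (\<gamma> \<circ> param c) (at u)) (at u)"
proof -
  let ?c' = "(UNIV, \<lambda>x. x) :: (complex^2^2, complex^2^2) chart"
  have c': "?c' \<in> std_atlas" by (simp add: std_atlas_def)
  have "((coord ?c' \<circ> \<gamma> \<circ> param c) has_derivative dmap \<gamma> c ?c' u) (at u)"
    by (rule dmap_has_derivative[OF local_trivD(3)[OF t] total_atlas smooth_atlas_std local_trivD(4)[OF t] c c' u(1)])
      (simp_all add: u(2))
  then show ?thesis by (simp add: dmap_def o_def)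
qed

text \<open>The fibre coordinate is equivariant, \<gamma>(q A) = \<gamma>(q) A. Consequently the
  Maurer-Cartan form sends \<xi>_X to X.\<close>

lemma fibre_coord_fund:
  assumes t: "local_triv AM AP \<pi> act U s \<gamma>" and c: "c \<in> AP" and u: "u \<in> coord c ` cdom c" "\<pi> (param c u) \<in> U"
    and X: "X \<in> su2"
  shows "frechet_derivative (\<gamma> \<circ> param c) (at u) (fund c X u) = \<gamma> (param c u) ** X"
proof -
  let ?c' = "(UNIV, \<lambda>x. x) :: (complex^2^2, complex^2^2) chart" and ?q = "param c u"
  have c': "?c' \<in> std_atlas" by (simp add: std_atlas_def)
  have "((\<lambda>A. coord ?c' (\<gamma> (act ?q (SU2_retr A)))) has_derivative (\<lambda>X. dmap \<gamma> c ?c' u (fund c X u))) (at (mat 1))"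
    by (rule orbit_has_derivative[OF local_trivD(3)[OF t] smooth_atlas_std local_trivD(4)[OF t] c c' u(1)])
      (simp_all add: u(2))
  then have 1: "((\<lambda>A. \<gamma> (act ?q (SU2_retr A))) has_derivative (\<lambda>X. frechet_derivative (\<gamma> \<circ> param c) (at u) (fund c X u))) (at (mat 1))"
    by (simp add: dmap_def o_def)
  have 2: "((\<lambda>A. \<gamma> ?q ** SU2_retr A) has_derivative (\<lambda>X. frechet_derivative (\<gamma> \<circ> param c) (at u) (fund c X u))) (at (mat 1))"
  proof (rule has_derivative_transform_within_open[OF 1 retr_dom_nbhd])
    fix A assume A: "A \<in> retr_dom"
    have "act ?q (SU2_retr A) = act (s (\<pi> ?q)) (\<gamma> ?q ** SU2_retr A)"
      using act_mult[OF local_trivD(5)[OF t u(2)] SU2_retr_in[OF A], of "s (\<pi> ?q)"] local_trivD(8)[OF t u(2)] by simp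
    then show "\<gamma> (act ?q (SU2_retr A)) = \<gamma> ?q ** SU2_retr A"
      using local_trivD(7)[OF t u(2) SU2_mult[OF local_trivD(5)[OF t u(2)] SU2_retr_in[OF A]]] by simp
  qed
  have "((\<lambda>A. \<gamma> ?q ** SU2_retr A) has_derivative (\<lambda>X. \<gamma> ?q ** frechet_derivative SU2_retr (at (mat 1)) X)) (at (mat 1))"
    by (rule bounded_linear.has_derivative[OF bounded_linear_mult_const(1) Cinf_on_has_derivative[OF Cinf_on_SU2_retr retr_dom_nbhd(2)]])
  from fun_cong[OF has_derivative_unique[OF 2 this], of X] show ?thesis
    by (simp only: SU2_retr_deriv_1[OF X])
qed

text \<open>Differentiating \<open>q = act (s (\<pi> q)) (\<gamma> q)\<close> splits a tangent vector into a translate of a vector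
  tangent to the section and a vertical vector.\<close>

lemma tangent_decomposition:
  assumes t: "local_triv AM AP \<pi> act U s \<gamma>" and c: "c \<in> AP" "cP \<in> AP" "cM \<in> AM"
    and u: "u \<in> coord c ` cdom c" "\<pi> (param c u) \<in> U" "\<pi> (param c u) \<in> cdom cM" "s (\<pi> (param c u)) \<in> cdom cP"
  shows "v = dmap (\<lambda>q. act q (\<gamma> (param c u))) cP c (coord cP (s (\<pi> (param c u))))
      (dmap s cM cP (coord cM (\<pi> (param c u))) (dmap \<pi> c cM u v))
    + fund c (matrix_inv (\<gamma> (param c u)) ** frechet_derivative (\<gamma> \<circ> param c) (at u) v) u"
proof -
  let ?q = "param c u"
  let ?g = "\<gamma> ?q" and ?y = "coord cP (s (\<pi> ?q))"
  note tD = local_trivD[OF t]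
  have g: "?g \<in> SU2" by (rule tD(5)[OF u(2)])
  have py: "param cP ?y = s (\<pi> ?q)" by (rule chart_facts(6)[OF P_chart[OF c(2)] u(4)])
  have q: "act (param cP ?y) ?g = ?q" unfolding py by (rule tD(8)[OF u(2)])
  have qc: "?q \<in> cdom c" by (rule chart_facts(8)[OF P_chart[OF c(1)] u(1)])
  have y: "?y \<in> coord cP ` cdom cP" by (rule imageI[OF u(4)])
  define f1 where "f1 = (\<lambda>w. coord cP (s (\<pi> (param c w))))"
  define f1' where "f1' = (\<lambda>v. dmap s cM cP (coord cM (\<pi> ?q)) (dmap \<pi> c cM u v))"
  define \<gamma>' where "\<gamma>' = frechet_derivative (\<gamma> \<circ> param c) (at u)"
  define F' where "F' = frechet_derivative (actx cP c) (at (?y, ?g))"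
  have f1: "(f1 has_derivative f1') (at u)"
    unfolding f1_def f1'_def
    by (rule dmap_chain_has_derivative[OF proj_smooth tD(2) total_atlas base_atlas total_atlas open_UNIV tD(1) c(1,3,2) u(1) UNIV_I u(3,2,4)])
  have \<gamma>: "((\<lambda>w. \<gamma> (param c w)) has_derivative \<gamma>') (at u)"
    using fibre_coord_has_derivative[OF t c(1) u(1,2)] by (simp only: \<gamma>'_def o_def)
  have dom: "(?y, ?g) \<in> actx_dom cP c"
    by (rule actx_dom_SU2[OF g y]) (simp only: q qc)
  have F: "(actx cP c has_derivative F') (at (f1 u, \<gamma> (param c u)))"
    unfolding F'_def f1_def by (rule actx_has_derivative[OF c(2,1) dom])
  have 1: "((\<lambda>w. actx cP c (f1 w, \<gamma> (param c w))) has_derivative (\<lambda>v. F' (f1' v, \<gamma>' v))) (at u)"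
    by (rule has_derivative_compose[OF has_derivative_Pair[OF f1 \<gamma>] F])
  \<comment> \<open>The chart cP can be used only where the section stays in its domain; continuity
    makes this an open condition on q.\<close>
  have cont: "continuous_on (\<pi> -` U) (\<lambda>x. s (\<pi> x))"
  proof (rule continuous_on_compose2[of U s])
    show "continuous_on U s" using tD(2) by (simp add: smooth_map_def)
    show "continuous_on (\<pi> -` U) \<pi>" using proj_smooth continuous_on_subset by (auto simp: smooth_map_def)
  qed auto
  have "open (\<pi> -` U \<inter> (\<lambda>x. s (\<pi> x)) -` cdom cP)"
    by (rule continuous_open_preimage[OF cont tD(4) chart_facts(1)[OF P_chart[OF c(2)]]])
  then have o: "open (coord c ` (cdom c \<inter> (\<pi> -` U \<inter> (\<lambda>x. s (\<pi> x)) -` cdom cP)))"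
    by (rule open_chart_image[OF P_chart[OF c(1)]])
  have "((\<lambda>w. w) has_derivative (\<lambda>v. F' (f1' v, \<gamma>' v))) (at u)"
  proof (rule has_derivative_transform_within_open[OF 1 o])
    show "u \<in> coord c ` (cdom c \<inter> (\<pi> -` U \<inter> (\<lambda>x. s (\<pi> x)) -` cdom cP))"
      by (simp only: chart_image_iff(1)[OF P_chart[OF c(1)]] Int_iff vimage_eq u simp_thms)
    fix w assume "w \<in> coord c ` (cdom c \<inter> (\<pi> -` U \<inter> (\<lambda>x. s (\<pi> x)) -` cdom cP))"
    then have w: "w \<in> coord c ` cdom c" "\<pi> (param c w) \<in> U" "s (\<pi> (param c w)) \<in> cdom cP"
      by (simp_all only: chart_image_iff(1)[OF P_chart[OF c(1)]] Int_iff vimage_eq)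
    show "actx cP c (f1 w, \<gamma> (param c w)) = w"
      by (simp only: actx_def fst_conv snd_conv f1_def chart_facts(6)[OF P_chart[OF c(2)] w(3)]
          SU2_retr_id[OF tD(5)[OF w(2)]] tD(8)[OF w(2)] chart_facts(7)[OF P_chart[OF c(1)] w(1)])
  qed
  from has_derivative_unique[OF has_derivative_ident this]
  have "v = F' (f1' v, \<gamma>' v)" by (rule fun_cong)
  also have "\<dots> = F' (f1' v, 0) + F' (0, \<gamma>' v)"
    using linear_add[OF has_derivative_linear[OF F], of "(f1' v, 0)" "(0, \<gamma>' v)"] by simp
  \<comment> \<open>A group direction at g, written as g times a direction at the identity, is seen
    to give a fundamental vector.\<close>
  also have "F' (0, \<gamma>' v) = F' (0, ?g ** (matrix_inv ?g ** \<gamma>' v))"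
    by (simp only: matrix_mul_assoc SU2_inv(2)[OF g] matrix_mul_lid)
  also have "\<dots> = fund c (matrix_inv ?g ** \<gamma>' v) u"
    unfolding F'_def
    using actx_derivative_SU2[OF c(2,1) g y, of "matrix_inv ?g ** \<gamma>' v"] qc
    by (simp only: q chart_facts(7)[OF P_chart[OF c(1)] u(1)])
  also have "F' (f1' v, 0) = dmap (\<lambda>q. act q ?g) cP c ?y (f1' v)"
  proof -
    have 2: "((\<lambda>y. actx cP c (y, ?g)) has_derivative (\<lambda>v. F' (v, 0))) (at ?y)"
      unfolding F'_def by (rule has_derivative_partial(2)[OF actx_has_derivative[OF c(2,1) dom]])
    have "(\<lambda>y. actx cP c (y, ?g)) = coord c \<circ> (\<lambda>q. act q ?g) \<circ> param cP"
      by (simp add: fun_eq_iff actx_def SU2_retr_id[OF g])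
    with frechet_derivative_at[OF 2] show ?thesis unfolding dmap_def by metis
  qed
  finally show ?thesis unfolding f1'_def \<gamma>'_def .
qed

subsection \<open>Lie derivatives along fundamental fields\<close>

text \<open>By symmetry of second derivatives, differentiating \<xi>_X along v is the same as
  differentiating, along X at the identity, the differential of translation applied to v.\<close>

lemma fund_deriv_eq_mixed:
  assumes c: "c \<in> AP" and u: "u \<in> coord c ` cdom c"
  shows "frechet_derivative (fund c X) (at u) v =
    frechet_derivative (\<lambda>z. frechet_derivative (actx c c) (at z) (v, 0)) (at (u, mat 1)) (0, X)"
proof -
  let ?F = "\<lambda>z. frechet_derivative (actx c c) (at z) (0, X)"
  have "(?F has_derivative frechet_derivative ?F (at (u, mat 1))) (at (u, mat 1))"
    by (rule Cinf_on_has_derivative[OF Cinf_on_deriv[OF actx_smooth(2)[OF c c]] actx_dom_1[OF c u]])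
  from has_derivative_partial(2)[OF this]
  have "(fund c X has_derivative (\<lambda>v. frechet_derivative ?F (at (u, mat 1)) (v, 0))) (at u)"
    by (simp only: fund_def[abs_def])
  from fun_cong[OF frechet_derivative_at[OF this], of v]
  have "frechet_derivative (fund c X) (at u) v = frechet_derivative ?F (at (u, mat 1)) (v, 0)" by (rule sym)
  also have "\<dots> = frechet_derivative (\<lambda>z. frechet_derivative (actx c c) (at z) (v, 0)) (at (u, mat 1)) (0, X)"
    by (rule second_derivative_symmetric[OF actx_smooth(1)[OF c c] actx_dom_1[OF c u] actx_smooth(2)[OF c c]])
  finally show ?thesis .
qed

text \<open>The symmetric second derivative of the action cancels in the difference, leaving the
  directions \<open>Y ** X\<close> and \<open>X ** Y\<close>. The left-hand side is minus the
  bracket of the two fields in coordinates, whence the sign.\<close>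

lemma fund_bracket:
  assumes c: "c \<in> AP" and u: "u \<in> coord c ` cdom c" and X: "X \<in> su2" and Y: "Y \<in> su2"
  shows "frechet_derivative (fund c X) (at u) (fund c Y u) - frechet_derivative (fund c Y) (at u) (fund c X u)
    = - fund c (commutator X Y) u"
proof -
  define D where "D X Y = frechet_derivative (\<lambda>z. frechet_derivative (actx c c) (at z) (0, X)) (at (u, mat 1)) (0, Y)" for X Y
  have D: "D X Y = D Y X" for X Y
    unfolding D_def by (rule second_derivative_symmetric[OF actx_smooth(1)[OF c c] actx_dom_1[OF c u] actx_smooth(2)[OF c c]])
  have key: "frechet_derivative (fund c X) (at u) (fund c Y u) = D X Y + fund c (Y ** X) u" if X: "X \<in> su2" for X Y
  proof -
    let ?O = "{A. (u, A) \<in> actx_dom c c}"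
    have oO: "open ?O" by (rule open_actx_slice(1)[OF c c])
    have 1: "mat 1 \<in> ?O" by (rule CollectI) (rule actx_dom_1[OF c u])
    \<comment> \<open>At q A the field \<xi>_X is the velocity of q (A B) at B = 1, so it is the
      derivative of the action at A in direction A X. This formula can be differentiated in
      A.\<close>
    have eq: "fund c X (actx c c (u, A)) = frechet_derivative (actx c c) (at (u, A)) (0, A ** X)" if "A \<in> ?O" for A
    proof -
      have A: "(u, A) \<in> actx_dom c c" "A \<in> retr_dom" "act (param c u) (SU2_retr A) \<in> cdom c"
        using that by (simp_all add: actx_dom_iff)
      let ?u' = "actx c c (u, A)"
      have u': "?u' \<in> coord c ` cdom c" using A(3) by (simp add: actx_def)
      have p: "param c ?u' = act (param c u) (SU2_retr A)"
        by (simp only: actx_def fst_conv snd_conv chart_facts(6)[OF P_chart[OF c] A(3)])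
      have r: "((\<lambda>B. A ** SU2_retr B) has_derivative (\<lambda>X. A ** frechet_derivative SU2_retr (at (mat 1)) X)) (at (mat 1))"
        by (rule bounded_linear.has_derivative[OF bounded_linear_mult_const(1) Cinf_on_has_derivative[OF Cinf_on_SU2_retr retr_dom_nbhd(2)]])
      have "((\<lambda>B. actx c c (u, B)) has_derivative (\<lambda>H. frechet_derivative (actx c c) (at (u, A)) (0, H))) (at (A ** SU2_retr (mat 1)))"
        unfolding SU2_retr_id[OF mat_1_SU2] matrix_mul_rid
        by (rule has_derivative_partial(1)[OF actx_has_derivative[OF c c A(1)]])
      from has_derivative_compose[OF r this]
      have 2: "((\<lambda>B. actx c c (u, A ** SU2_retr B)) has_derivative
        (\<lambda>X. frechet_derivative (actx c c) (at (u, A)) (0, A ** frechet_derivative SU2_retr (at (mat 1)) X))) (at (mat 1))" .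
      have "((\<lambda>B. actx c c (?u', B)) has_derivative
        (\<lambda>X. frechet_derivative (actx c c) (at (u, A)) (0, A ** frechet_derivative SU2_retr (at (mat 1)) X))) (at (mat 1))"
      proof (rule has_derivative_transform_within_open[OF 2 retr_dom_nbhd])
        fix B assume B: "B \<in> retr_dom"
        show "actx c c (u, A ** SU2_retr B) = actx c c (?u', B)"
          unfolding actx_def[of c c "(?u', B)"] fst_conv snd_conv p act_mult[OF SU2_retr_in[OF A(2)] SU2_retr_in[OF B]]
          unfolding actx_def fst_conv snd_conv SU2_retr_mult(2)[OF SU2_retr_in[OF B]] ..
      qed
      from fun_cong[OF has_derivative_unique[OF fund_has_derivative[OF c u'] this], of X]
      show ?thesis by (simp only: SU2_retr_deriv_1[OF X])
    qed
    have a1: "(fund c X has_derivative frechet_derivative (fund c X) (at u)) (at (actx c c (u, mat 1)))"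
      unfolding actx_1[OF c u] by (rule Cinf_on_has_derivative[OF fund_smooth[OF c] u])
    have lhs: "((\<lambda>A. fund c X (actx c c (u, A))) has_derivative (\<lambda>Y. frechet_derivative (fund c X) (at u) (fund c Y u))) (at (mat 1))"
      by (rule has_derivative_compose[OF fund_has_derivative[OF c u] a1])
    \<comment> \<open>A enters twice, as base point and in the direction; these give the second
      derivative and the term with \<open>Y ** X\<close>.\<close>
    have "((\<lambda>A. frechet_derivative (actx c c) (at (u, A)) (0, A ** X)) has_derivative
      (\<lambda>Y. D (mat 1 ** X) Y + frechet_derivative (actx c c) (at (u, mat 1)) (0, Y ** X))) (at (mat 1))"
    proof (rule has_derivative_linear_family[OF oO 1, of "\<lambda>A H. frechet_derivative (actx c c) (at (u, A)) (0, H)"])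
      show "linear (\<lambda>H. frechet_derivative (actx c c) (at (u, A)) (0, H))" if "A \<in> ?O" for A
        by (rule has_derivative_linear[OF has_derivative_partial(1)[OF actx_has_derivative[OF c c]]]) (use that in simp)
      show "((\<lambda>A. frechet_derivative (actx c c) (at (u, A)) (0, H)) has_derivative D H) (at (mat 1))" for H
        unfolding D_def
        by (rule has_derivative_partial(1)[OF Cinf_on_has_derivative[OF Cinf_on_deriv[OF actx_smooth(2)[OF c c]] actx_dom_1[OF c u]]])
      show "((\<lambda>A. A ** X) has_derivative (\<lambda>Y. Y ** X)) (at (mat 1))"
        by (rule bounded_linear_imp_has_derivative[OF bounded_linear_mult_const(2)])
    qed
    then have "((\<lambda>A. fund c X (actx c c (u, A))) has_derivative
      (\<lambda>Y. D (mat 1 ** X) Y + frechet_derivative (actx c c) (at (u, mat 1)) (0, Y ** X))) (at (mat 1))"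
      by (rule has_derivative_transform_within_open[OF _ oO 1]) (rule eq[symmetric])
    from fun_cong[OF has_derivative_unique[OF lhs this], of Y] show ?thesis
      by (simp only: matrix_mul_lid fund_def)
  qed
  have "fund c (Y ** X) u - fund c (X ** Y) u = - fund c (commutator X Y) u"
    using linear_diff[OF fund_linear[OF c u], of "X ** Y" "Y ** X"] by (simp add: commutator_def)
  then show ?thesis using key[OF X, of Y] key[OF Y, of X] D[of X Y] by simp
qed

lemma invariant_form_transform:
  assumes \<Omega>: "k_form AP UNIV k \<Omega>" and inv: "invariant_form AP act k \<Omega>"
    and c: "c \<in> AP" "c' \<in> AP" and g: "g \<in> SU2"
    and u: "u \<in> coord c ` cdom c" "act (param c u) g \<in> cdom c'" and l: "length vs = k"
  shows "\<Omega> c' (coord c' (act (param c u) g)) (map (dmap (\<lambda>q. act q g) c c' u) vs) = \<Omega> c u vs"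
proof -
  have "pullback AP (\<lambda>q. act q g) \<Omega> c u vs = \<Omega> c u vs"
    using inv g c(1) u(1) l unfolding invariant_form_def form_eq_def by blast
  then show ?thesis
    unfolding pullback_eq[OF smooth_map_act[OF g] total_atlas total_atlas open_UNIV open_UNIV \<Omega> c u(1) UNIV_I u(2) UNIV_I l] .
qed

text \<open>The left-hand side is the Lie derivative along a fundamental field, in coordinates.\<close>

lemma invariant_form_Lie:
  fixes \<Omega> :: "('p, 'f, real) form"
  assumes \<Omega>: "k_form AP UNIV 3 \<Omega>" and inv: "invariant_form AP act 3 \<Omega>"
    and c: "c \<in> AP" and u: "u \<in> coord c ` cdom c"
  shows "frechet_derivative (\<lambda>y. \<Omega> c y [v1, v2, v3]) (at u) (fund c X u)
    + \<Omega> c u [v1, v2, frechet_derivative (fund c X) (at u) v3]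
    + \<Omega> c u [v1, frechet_derivative (fund c X) (at u) v2, v3]
    + \<Omega> c u [frechet_derivative (fund c X) (at u) v1, v2, v3] = 0"
proof -
  let ?O = "{A. (u, A) \<in> actx_dom c c}"
  have oO: "open ?O" by (rule open_actx_slice(1)[OF c c])
  have 1: "mat 1 \<in> ?O" by (rule CollectI) (rule actx_dom_1[OF c u])
  \<comment> \<open>The differential at u of translation by the retracted A, applied to v.\<close>
  define f where "f v A = frechet_derivative (actx c c) (at (u, A)) (v, 0)" for v A
  have fd: "(f v has_derivative (\<lambda>X. frechet_derivative (fund c X) (at u) v)) (at (mat 1))" for v
    unfolding f_def fund_deriv_eq_mixed[OF c u]
    by (rule has_derivative_partial(1)[OF Cinf_on_has_derivative[OF Cinf_on_deriv[OF actx_smooth(2)[OF c c]] actx_dom_1[OF c u]]])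
  have part: "((\<lambda>y. actx c c (y, A)) has_derivative (\<lambda>v. f v A)) (at u)" if "A \<in> ?O" for A
    unfolding f_def by (rule has_derivative_partial(2)[OF actx_has_derivative[OF c c]]) (use that in simp)
  have f1: "f v (mat 1) = v" for v
  proof -
    have "((\<lambda>y. y) has_derivative (\<lambda>v. f v (mat 1))) (at u)"
      by (rule has_derivative_transform_within_open[OF part[OF 1] chart_facts(2)[OF P_chart[OF c]] u]) (rule actx_1[OF c])
    from has_derivative_unique[OF has_derivative_ident this] show ?thesis by metis
  qed
  \<comment> \<open>By invariance the form on the translated vectors is constant in A;
    differentiating at the identity gives the claim.\<close>
  have eq: "\<Omega> c (actx c c (u, A)) [f v1 A, f v2 A, f v3 A] = \<Omega> c u [v1, v2, v3]" if A: "A \<in> ?O" for A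
  proof -
    have A': "A \<in> retr_dom" "act (param c u) (SU2_retr A) \<in> cdom c" using A by (simp_all add: actx_dom_iff)
    have "(\<lambda>y. actx c c (y, A)) = coord c \<circ> (\<lambda>q. act q (SU2_retr A)) \<circ> param c"
      by (simp add: fun_eq_iff actx_def)
    then have "dmap (\<lambda>q. act q (SU2_retr A)) c c u = (\<lambda>v. f v A)"
      unfolding dmap_def using frechet_derivative_at[OF part[OF A]] by metis
    then show ?thesis
      using invariant_form_transform[OF \<Omega> inv c c SU2_retr_in[OF A'(1)] u A'(2), of "[v1, v2, v3]"]
      by (simp add: actx_def)
  qed
  have T: "((\<lambda>A. \<Omega> c (actx c c (u, A)) vs) has_derivative
      (\<lambda>X. frechet_derivative (\<lambda>y. \<Omega> c y vs) (at u) (fund c X u))) (at (mat 1))" if "length vs = 3" for vs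
  proof (rule has_derivative_compose[OF fund_has_derivative[OF c u]])
    have "Cinf_on (coord c ` cdom c) (\<lambda>y. \<Omega> c y vs)"
      using k_formD(2)[OF \<Omega> total_atlas open_UNIV c that] by simp
    then show "((\<lambda>y. \<Omega> c y vs) has_derivative frechet_derivative (\<lambda>y. \<Omega> c y vs) (at u)) (at (actx c c (u, mat 1)))"
      unfolding actx_1[OF c u] by (rule Cinf_on_has_derivative[OF _ u])
  qed
  have "((\<lambda>A. \<Omega> c (actx c c (u, A)) [f v1 A, f v2 A, f v3 A]) has_derivative (\<lambda>X.
      frechet_derivative (\<lambda>y. \<Omega> c y [f v1 (mat 1), f v2 (mat 1), f v3 (mat 1)]) (at u) (fund c X u)
    + \<Omega> c (actx c c (u, mat 1)) [f v1 (mat 1), f v2 (mat 1), frechet_derivative (fund c X) (at u) v3]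
    + \<Omega> c (actx c c (u, mat 1)) [f v1 (mat 1), frechet_derivative (fund c X) (at u) v2, f v3 (mat 1)]
    + \<Omega> c (actx c c (u, mat 1)) [frechet_derivative (fund c X) (at u) v1, f v2 (mat 1), f v3 (mat 1)])) (at (mat 1))"
  proof (rule has_derivative_alternating3[OF oO 1, of "\<lambda>A. \<Omega> c (actx c c (u, A))", OF _ T fd fd fd])
    fix A assume "A \<in> ?O"
    then have "act (param c u) (SU2_retr A) \<in> cdom c" by (simp add: actx_dom_iff)
    then have "actx c c (u, A) \<in> coord c ` cdom c" by (simp add: actx_def)
    then show "alternating 3 (\<Omega> c (actx c c (u, A)))"
      by (rule k_formD(1)[OF \<Omega> total_atlas open_UNIV c _ UNIV_I])
  qed
  then have "((\<lambda>A. \<Omega> c u [v1, v2, v3]) has_derivative (\<lambda>X.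
      frechet_derivative (\<lambda>y. \<Omega> c y [v1, v2, v3]) (at u) (fund c X u)
    + \<Omega> c u [v1, v2, frechet_derivative (fund c X) (at u) v3]
    + \<Omega> c u [v1, frechet_derivative (fund c X) (at u) v2, v3]
    + \<Omega> c u [frechet_derivative (fund c X) (at u) v1, v2, v3])) (at (mat 1))"
    unfolding f1 actx_1[OF c u]
    by (rule has_derivative_transform_within_open[OF _ oO 1]) (rule eq)
  from fun_cong[OF has_derivative_unique[OF this has_derivative_const], of X] show ?thesis .
qed

end

section \<open>Chern-Simons forms on three vectors\<close>

lemma sum_permutes_2:
  "(\<Sum>p | p permutes {..<2::nat}. of_int (sign p) *\<^sub>R f p) = f id - f (Transposition.transpose 0 1)"
  for f :: "_ \<Rightarrow> 'a::real_vector"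
proof -
  have s: "{..<2::nat} = insert 0 {1}" by auto
  show ?thesis
    unfolding s by (simp add: sum_over_permutations_insert permutes_sing sign_swap_id sign_id)
qed

lemma sum_permutes_3:
  fixes f :: "nat \<Rightarrow> nat \<Rightarrow> nat \<Rightarrow> 'a::real_vector"
  shows "(\<Sum>p | p permutes {..<3::nat}. of_int (sign p) *\<^sub>R f (p 0) (p 1) (p 2)) =
    f 0 1 2 - f 0 2 1 - f 1 0 2 + f 1 2 0 + f 2 0 1 - f 2 1 0"
proof -
  have s: "{..<3::nat} = insert 0 (insert 1 {2})" by auto
  have 1: "finite {1::nat, 2}" "0 \<notin> {1::nat, 2}" and 2: "finite {2::nat}" "1 \<notin> {2::nat}" by auto
  show ?thesis
    unfolding s sum_over_permutations_insert[OF 1] sum_over_permutations_insert[OF 2] permutes_sing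
    by (simp add: sign_swap_id permutation_swap_id sign_compose sign_id Transposition.transpose_def)
qed

lemma wedge_1_1: "wedge 1 1 \<alpha> \<beta> c u [v, w] = \<alpha> c u [v] ** \<beta> c u [w] - \<alpha> c u [w] ** \<beta> c u [v]"
proof -
  have "wedge 1 1 \<alpha> \<beta> c u [v, w] = (\<Sum>p | p permutes {..<2::nat}. of_int (sign p) *\<^sub>R
        (\<alpha> c u [[v, w] ! p 0] ** \<beta> c u [[v, w] ! p 1]))"
    by (simp add: wedge_def numeral_2_eq_2)
  then show ?thesis by (simp add: sum_permutes_2)
qed

text \<open>By skewness the two orders of each pair contribute equally, which cancels the
  normalisation 1/(1! 2!).\<close>

lemma wedge_1_2:
  assumes "\<And>v w. \<beta> c u [v, w] = - \<beta> c u [w, v]"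
  shows "wedge 1 2 \<alpha> \<beta> c u [v1, v2, v3] =
    \<alpha> c u [v1] ** \<beta> c u [v2, v3] + \<alpha> c u [v2] ** \<beta> c u [v3, v1] + \<alpha> c u [v3] ** \<beta> c u [v1, v2]"
proof -
  have s: "{..<1 + 2} = {..<3::nat}" by simp
  have m: "map (\<lambda>i. [v1, v2, v3] ! p i) [0..<1] = [[v1, v2, v3] ! p 0]"
    "map (\<lambda>i. [v1, v2, v3] ! p i) [1..<1 + 2] = [[v1, v2, v3] ! p 1, [v1, v2, v3] ! p 2]" for p
    by (simp_all add: upt_rec numeral_2_eq_2)
  have r: "A ** (- B) = - (A ** B)" for A B :: "complex^'z^'z"
    by (simp add: matrix_matrix_mult_def vec_eq_iff sum_negf)
  have "wedge 1 2 \<alpha> \<beta> c u [v1, v2, v3] = (1/2) *\<^sub>R (\<Sum>p | p permutes {..<3::nat}. of_int (sign p) *\<^sub>R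
        (\<alpha> c u [[v1, v2, v3] ! p 0] ** \<beta> c u [[v1, v2, v3] ! p 1, [v1, v2, v3] ! p 2]))"
    unfolding wedge_def s m by (simp add: fact_numeral)
  also have "\<dots> = (1/2) *\<^sub>R (2 *\<^sub>R (\<alpha> c u [v1] ** \<beta> c u [v2, v3] + \<alpha> c u [v2] ** \<beta> c u [v3, v1] + \<alpha> c u [v3] ** \<beta> c u [v1, v2]))"
    unfolding sum_permutes_3[of "\<lambda>i j k. \<alpha> c u [[v1, v2, v3] ! i] ** \<beta> c u [[v1, v2, v3] ! j, [v1, v2, v3] ! k]"]
    using assms[of v3 v2] assms[of v1 v3] assms[of v2 v1] by (simp add: r scaleR_2)
  finally show ?thesis by simp
qed

lemma wedge_2_1:
  assumes "\<And>v w. \<alpha> c u [v, w] = - \<alpha> c u [w, v]"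
  shows "wedge 2 1 \<alpha> \<beta> c u [v1, v2, v3] =
    \<alpha> c u [v1, v2] ** \<beta> c u [v3] + \<alpha> c u [v2, v3] ** \<beta> c u [v1] + \<alpha> c u [v3, v1] ** \<beta> c u [v2]"
proof -
  have s: "{..<2 + 1} = {..<3::nat}" by simp
  have m: "map (\<lambda>i. [v1, v2, v3] ! p i) [0..<2] = [[v1, v2, v3] ! p 0, [v1, v2, v3] ! p 1]"
    "map (\<lambda>i. [v1, v2, v3] ! p i) [2..<2 + 1] = [[v1, v2, v3] ! p 2]" for p
    by (simp_all add: upt_rec numeral_2_eq_2)
  have r: "(- A) ** B = - (A ** B)" for A B :: "complex^'z^'z"
    by (simp add: matrix_matrix_mult_def vec_eq_iff sum_negf)
  have "wedge 2 1 \<alpha> \<beta> c u [v1, v2, v3] = (1/2) *\<^sub>R (\<Sum>p | p permutes {..<3::nat}. of_int (sign p) *\<^sub>R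
        (\<alpha> c u [[v1, v2, v3] ! p 0, [v1, v2, v3] ! p 1] ** \<beta> c u [[v1, v2, v3] ! p 2]))"
    unfolding wedge_def s m by (simp add: fact_numeral)
  also have "\<dots> = (1/2) *\<^sub>R (2 *\<^sub>R (\<alpha> c u [v1, v2] ** \<beta> c u [v3] + \<alpha> c u [v2, v3] ** \<beta> c u [v1] + \<alpha> c u [v3, v1] ** \<beta> c u [v2]))"
    unfolding sum_permutes_3[of "\<lambda>i j k. \<alpha> c u [[v1, v2, v3] ! i, [v1, v2, v3] ! j] ** \<beta> c u [[v1, v2, v3] ! k]"]
    using assms[of v3 v2] assms[of v1 v3] assms[of v2 v1] by (simp add: r scaleR_2)
  finally show ?thesis by simp
qed

lemma trace_commutator_cyclic:
  "trace (B ** commutator C A) = trace (A ** commutator B C)"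
  "trace (commutator A B ** C) = trace (A ** commutator B C)"
  by (simp_all add: commutator_def matrix2_simps algebra_simps)

text \<open>Three commutator terms with the same trace, by cyclicity. The 3 turns the -1/3 of
  \<open>fibre_normalised\<close> into -1 and the 2/3 of \<open>chern_simons\<close> into 2.\<close>

lemma trace_wedge_cube:
  "trace (wedge 2 1 (wedge 1 1 \<alpha> \<alpha>) \<alpha> c u [v1, v2, v3]) = 3 * trace (\<alpha> c u [v1] ** commutator (\<alpha> c u [v2]) (\<alpha> c u [v3]))"
  for \<alpha> :: "('m, 'e, complex^2^2) form"
proof -
  have "wedge 2 1 (wedge 1 1 \<alpha> \<alpha>) \<alpha> c u [v1, v2, v3] =
    commutator (\<alpha> c u [v1]) (\<alpha> c u [v2]) ** \<alpha> c u [v3] + commutator (\<alpha> c u [v2]) (\<alpha> c u [v3]) ** \<alpha> c u [v1]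
    + commutator (\<alpha> c u [v3]) (\<alpha> c u [v1]) ** \<alpha> c u [v2]"
    by (subst wedge_2_1) (unfold wedge_1_1 commutator_def, rule minus_diff_eq[symmetric], rule refl)
  then show ?thesis
    using trace_commutator_cyclic(2)[of "\<alpha> c u [v1]" "\<alpha> c u [v2]" "\<alpha> c u [v3]"]
      trace_commutator_cyclic(2)[of "\<alpha> c u [v2]" "\<alpha> c u [v3]" "\<alpha> c u [v1]"]
      trace_commutator_cyclic(2)[of "\<alpha> c u [v3]" "\<alpha> c u [v1]" "\<alpha> c u [v2]"]
      trace_commutator_cyclic(1)[of "\<alpha> c u [v2]" "\<alpha> c u [v3]" "\<alpha> c u [v1]"]
      trace_commutator_cyclic(1)[of "\<alpha> c u [v3]" "\<alpha> c u [v1]" "\<alpha> c u [v2]"]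
    by (simp add: trace_add)
qed

lemma chern_simons_eq:
  "chern_simons W c u [v1, v2, v3] =
    trace (W c u [v1] ** ext_d W c u [v2, v3]) + trace (W c u [v2] ** ext_d W c u [v3, v1])
    + trace (W c u [v3] ** ext_d W c u [v1, v2]) + 2 * trace (W c u [v1] ** commutator (W c u [v2]) (W c u [v3]))"
proof -
  have sc: "trace (r *\<^sub>R A) = r *\<^sub>R trace A" for r and A :: "complex^2^2"
    by (simp add: trace2 scaleR_add_right)
  have w: "wedge 1 2 W (ext_d W) c u [v1, v2, v3] = W c u [v1] ** ext_d W c u [v2, v3]
    + W c u [v2] ** ext_d W c u [v3, v1] + W c u [v3] ** ext_d W c u [v1, v2]"
    by (rule wedge_1_2) (simp add: ext_d_two)
  show ?thesis
    unfolding chern_simons_def w trace_add sc trace_wedge_cube by (simp add: scaleR_conv_of_real)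
qed

section \<open>The connection determined by an invariant 3-form\<close>

locale invariant_CS_form = principal_SU2_bundle AM AP \<pi> act
  for AM :: "('m::{t2_space,second_countable_topology}, 'e::euclidean_space) chart set"
    and AP :: "('p::{t2_space,second_countable_topology}, 'f::euclidean_space) chart set"
    and \<pi> :: "'p \<Rightarrow> 'm" and act :: "'p \<Rightarrow> complex^2^2 \<Rightarrow> 'p" +
  fixes \<Omega> :: "('p, 'f, real) form"
  assumes form: "k_form AP UNIV 3 \<Omega>"
    and closed: "closed_form AP 3 \<Omega>"
    and invariant: "invariant_form AP act 3 \<Omega>"
    and normalised: "fibre_normalised AM AP \<pi> act \<Omega>"
begin

text \<open>\<open>su2_of_bilinear\<close> takes values in \<open>su2\<close> whatever its argument,
  so \<open>conn_su2\<close> holds without conditions on chart or point.\<close>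

definition conn :: "('p, 'f, complex^2^2) form" where
  "conn c u vs = su2_of_bilinear (\<lambda>X Y. \<Omega> c u [hd vs, fund c X u, fund c Y u])"

lemma conn_su2 [simp]: "conn c u vs \<in> su2"
  by (simp add: conn_def)

lemma form_alt: "c \<in> AP \<Longrightarrow> u \<in> coord c ` cdom c \<Longrightarrow> alternating 3 (\<Omega> c u)"
  by (rule k_formD(1)[OF form total_atlas open_UNIV _ _ UNIV_I])

lemma form_smooth: "c \<in> AP \<Longrightarrow> length vs = 3 \<Longrightarrow> Cinf_on (coord c ` cdom c) (\<lambda>u. \<Omega> c u vs)"
  using k_formD(2)[OF form total_atlas open_UNIV] by simp

lemma conn_trace:
  assumes c: "c \<in> AP" "u \<in> coord c ` cdom c" and XY: "X \<in> su2" "Y \<in> su2"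
  shows "complex_of_real (\<Omega> c u [v, fund c X u, fund c Y u]) = - trace (conn c u [v] ** commutator X Y)"
  unfolding conn_def list.sel
proof (rule su2_of_bilinear[OF _ _ _ XY])
  note a = alternating3[OF form_alt[OF c]]
  show "linear (\<lambda>X. \<Omega> c u [v, fund c X u, fund c Y u])" for Y
    using linear_compose[OF fund_linear[OF c] a(2)] by (simp only: o_def)
  show "linear (\<lambda>Y. \<Omega> c u [v, fund c X u, fund c Y u])" for X
    using linear_compose[OF fund_linear[OF c] a(3)] by (simp only: o_def)
  show "\<Omega> c u [v, fund c X u, fund c X u] = 0" for X by (rule a(6))
qed

lemma conn_eqI:
  assumes c: "c \<in> AP" "u \<in> coord c ` cdom c" and A: "A \<in> su2"
    and "\<And>X Y. X \<in> su2 \<Longrightarrow> Y \<in> su2 \<Longrightarrow> complex_of_real (\<Omega> c u [v, fund c X u, fund c Y u]) = - trace (A ** commutator X Y)"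
  shows "conn c u [v] = A"
  by (rule su2_nondegenerate[OF conn_su2 A]) (use assms(4) conn_trace[OF c] in \<open>metis neg_equal_iff_equal\<close>)

text \<open>On three fundamental vectors \<Omega> is prescribed by its normalisation in some local
  trivialisation, where the Maurer-Cartan form returns the generators.\<close>

lemma conn_fund:
  assumes c: "c \<in> AP" and u: "u \<in> coord c ` cdom c" and X: "X \<in> su2"
  shows "conn c u [fund c X u] = X"
proof (rule conn_eqI[OF c u X])
  fix Y Z assume YZ: "Y \<in> su2" "Z \<in> su2"
  obtain U s \<gamma> where U: "\<pi> (param c u) \<in> U" and t: "local_triv AM AP \<pi> act U s \<gamma>"
    using locally_trivial by blast
  have uU: "u \<in> coord c ` (cdom c \<inter> \<pi> -` U)"
    by (simp only: chart_image_iff(1)[OF P_chart[OF c]] u vimage_eq U simp_thms)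
  have m: "maurer_cartan \<gamma> c u [fund c X u] = X" if "X \<in> su2" for X
    unfolding maurer_cartan_def nth_Cons_0 fibre_coord_fund[OF t c u U that]
    by (simp only: matrix_mul_assoc SU2_inv(1)[OF local_trivD(5)[OF t U]] matrix_mul_lid)
  have "complex_of_real (\<Omega> c u [fund c X u, fund c Y u, fund c Z u]) =
      - (1/3) * trace (wedge 2 1 (wedge 1 1 (maurer_cartan \<gamma>) (maurer_cartan \<gamma>)) (maurer_cartan \<gamma>) c u
        [fund c X u, fund c Y u, fund c Z u])"
    using normalised[unfolded fibre_normalised_def, rule_format, OF t c uU, of "[fund c X u, fund c Y u, fund c Z u]"]
      fund_vertical[OF c u] by simp
  then show "complex_of_real (\<Omega> c u [fund c X u, fund c Y u, fund c Z u]) = - trace (X ** commutator Y Z)"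
    unfolding trace_wedge_cube m[OF X] m[OF YZ(1)] m[OF YZ(2)] by simp
qed

lemma conn_linear: "c \<in> AP \<Longrightarrow> u \<in> coord c ` cdom c \<Longrightarrow> linear (\<lambda>v. conn c u [v])"
proof -
  assume c: "c \<in> AP" and u: "u \<in> coord c ` cdom c"
  note lin = alternating3(1)[OF form_alt[OF c u]]
  show ?thesis
    by (rule linearI)
      (simp_all add: conn_def su2_of_bilinear_def su2_mat_add su2_mat_scaleR linear_add[OF lin] linear_cmul[OF lin] add_divide_distrib algebra_simps)
qed

text \<open>Invariance of \<Omega> moves the pairing back to u; invariance of the trace under
  conjugation then moves the group element onto the value of the connection.\<close>

lemma conn_act:
  assumes c: "c \<in> AP" "c' \<in> AP" and g: "g \<in> SU2" and u: "u \<in> coord c ` cdom c" "act (param c u) g \<in> cdom c'"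
  shows "conn c' (coord c' (act (param c u) g)) [dmap (\<lambda>q. act q g) c c' u v] = matrix_inv g ** conn c u [v] ** g"
proof (rule conn_eqI[OF c(2) imageI[OF u(2)] su2_conj[OF g conn_su2]])
  fix X Y assume XY: "X \<in> su2" "Y \<in> su2"
  let ?u' = "coord c' (act (param c u) g)" and ?R = "dmap (\<lambda>q. act q g) c c' u"
  \<comment> \<open>Generators whose fields at u are carried by translation by g to those of X and
    Y.\<close>
  define X' Y' where "X' = g ** X ** matrix_inv g" and "Y' = g ** Y ** matrix_inv g"
  have ii: "matrix_inv (matrix_inv g) = g"
    by (rule matrix_inv_eqI) (rule SU2_inv[OF g])+
  have X': "X' \<in> su2" "Y' \<in> su2"
    using su2_conj[OF SU2_inv(3)[OF g] XY(1)] su2_conj[OF SU2_inv(3)[OF g] XY(2)] by (simp_all only: X'_def Y'_def ii)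
  have conj_cancel: "matrix_inv g ** (g ** Z ** matrix_inv g) ** g = Z" for Z
  proof -
    have "matrix_inv g ** (g ** Z ** matrix_inv g) ** g = (matrix_inv g ** g) ** Z ** (matrix_inv g ** g)"
      by (simp only: matrix_mul_assoc)
    then show ?thesis by (simp only: SU2_inv(1)[OF g] matrix_mul_lid matrix_mul_rid)
  qed
  have "\<Omega> c' ?u' [?R v, fund c' X ?u', fund c' Y ?u'] = \<Omega> c' ?u' (map ?R [v, fund c X' u, fund c Y' u])"
    by (simp only: list.map act_fund[OF c g u] X'_def Y'_def conj_cancel)
  also have "\<dots> = \<Omega> c u [v, fund c X' u, fund c Y' u]"
    by (rule invariant_form_transform[OF form invariant c g u]) simp
  finally have "complex_of_real (\<Omega> c' ?u' [?R v, fund c' X ?u', fund c' Y ?u']) = - trace (conn c u [v] ** commutator X' Y')"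
    by (simp only: conn_trace[OF c(1) u(1) X'])
  also have "\<dots> = - trace ((matrix_inv g ** conn c u [v] ** g) ** commutator X Y)"
    using trace_conj[OF g, of "conn c u [v]" "commutator X' Y'"] commutator_conj[OF g, of X' Y']
    by (simp only: X'_def Y'_def conj_cancel)
  finally show "complex_of_real (\<Omega> c' ?u' [?R v, fund c' X ?u', fund c' Y ?u'])
    = - trace ((matrix_inv g ** conn c u [v] ** g) ** commutator X Y)" .
qed

lemma conj_mat_1: "matrix_inv (mat 1) ** X ** mat 1 = X" for X :: "complex^2^2"
proof -
  have "matrix_inv (mat 1 :: complex^2^2) = mat 1" by (rule matrix_inv_eqI) (simp_all only: matrix_mul_lid)
  then show ?thesis by (simp only: matrix_mul_lid matrix_mul_rid)
qed

lemma pairing_smooth: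
  assumes c: "c \<in> AP"
  shows "Cinf_on (coord c ` cdom c) (\<lambda>u. \<Omega> c u [v, fund c X u, fund c Y u])"
proof -
  have "Cinf_on (coord c ` cdom c) (\<lambda>u. \<Omega> c u (map (\<lambda>f. f u) [\<lambda>u. v, fund c X, fund c Y] @ []))"
    by (rule Cinf_on_alternating_family[OF chart_facts(2)[OF P_chart[OF c]] form_alt[OF c] form_smooth[OF c]])
      (use fund_smooth[OF c] in auto)
  then show ?thesis by simp
qed

text \<open>Scalar pairings times constant matrices: the shape in which smoothness of
  \<open>conn\<close> and \<open>hor\<close> can be read off.\<close>

lemma conn_expand: "conn c u [v] = \<Omega> c u [v, fund c (su2_mat 0 1 0) u, fund c (su2_mat 0 0 1) u] *\<^sub>R su2_mat (1/4) 0 0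
    + \<Omega> c u [v, fund c (su2_mat 0 0 1) u, fund c (su2_mat 1 0 0) u] *\<^sub>R su2_mat 0 (1/4) 0
    + \<Omega> c u [v, fund c (su2_mat 1 0 0) u, fund c (su2_mat 0 1 0) u] *\<^sub>R su2_mat 0 0 (1/4)"
  by (simp add: conn_def su2_of_bilinear_def su2_mat_add su2_mat_scaleR)

lemma conn_smooth:
  assumes c: "c \<in> AP"
  shows "Cinf_on (coord c ` cdom c) (\<lambda>u. conn c u [v])"
  unfolding conn_expand
  by (rule Cinf_on_add Cinf_on_scaleR chart_facts(2)[OF P_chart[OF c]] pairing_smooth[OF c] Cinf_on_const)+

lemma conn_form: "k_form AP UNIV 1 conn"
proof (rule k_formI[OF total_atlas open_UNIV])
  fix c u assume c: "c \<in> AP" and u: "u \<in> coord c ` cdom c"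
  show "alternating 1 (conn c u)" by (rule alternating_1I[OF conn_linear[OF c u]])
next
  fix c u0 and vs :: "'f list" assume c: "c \<in> AP" and u0: "u0 \<in> coord c ` cdom c" and "length vs = 1"
  then obtain v where "vs = [v]" by (auto simp: length_Suc_conv)
  then show "\<exists>N. open N \<and> u0 \<in> N \<and> Cinf_on N (\<lambda>u. conn c u vs)"
    using chart_facts(2)[OF P_chart[OF c]] u0 conn_smooth[OF c] by blast
next
  fix c c' u and vs :: "'f list"
  assume c: "c \<in> AP" "c' \<in> AP" and u: "u \<in> coord c ` cdom c" "param c u \<in> cdom c'" and "length vs = 1"
  then obtain v where vs: "vs = [v]" by (auto simp: length_Suc_conv)
  \<comment> \<open>A chart change is translation by the identity, so the transformation law is a
    case of equivariance.\<close>
  have "conn c' (coord c' (param c u)) [dmap (\<lambda>q. q) c c' u v] = conn c u [v]"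
    using conn_act[OF c mat_1_SU2 u(1), of v] u(2) by (simp only: act_one conj_mat_1)
  then show "conn c u vs = conn c' (coord c' (param c u)) (map (dmap (\<lambda>x. x) c c' u) vs)"
    by (simp only: vs list.map)
qed

subsection \<open>Closedness determines the exterior derivative\<close>

lemma form_ext_d:
  assumes c: "c \<in> AP" and u: "u \<in> coord c ` cdom c"
  shows "frechet_derivative (\<lambda>y. \<Omega> c y [v2, v3, v4]) (at u) v1 - frechet_derivative (\<lambda>y. \<Omega> c y [v1, v3, v4]) (at u) v2
    + frechet_derivative (\<lambda>y. \<Omega> c y [v1, v2, v4]) (at u) v3 - frechet_derivative (\<lambda>y. \<Omega> c y [v1, v2, v3]) (at u) v4 = 0"
  unfolding ext_d_four[symmetric]
  using closed[unfolded closed_form_def form_eq_def, rule_format, OF c u, of "[v1, v2, v3, v4]"] by simp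

lemma form_deriv_cyclic:
  assumes c: "c \<in> AP" and u: "u \<in> coord c ` cdom c"
  shows "frechet_derivative (\<lambda>y. \<Omega> c y [v1, v2, v3]) (at u) = frechet_derivative (\<lambda>y. \<Omega> c y [v2, v3, v1]) (at u)"
proof (rule frechet_derivative_cong_germ[OF chart_facts(2)[OF P_chart[OF c]] u])
  fix y assume "y \<in> coord c ` cdom c"
  note a = alternating3(7,8)[OF form_alt[OF c this]]
  show "\<Omega> c y [v1, v2, v3] = \<Omega> c y [v2, v3, v1]"
    using a(1)[of v1 v2 v3] a(2)[of v2 v1 v3] by simp
qed

text \<open>The product rule for \<Omega>(\<xi>_X, \<xi>_Y, w) with w constant: the derivative of
  \<Omega> on frozen arguments plus terms from the variation of the two fields.\<close>

lemma conn_deriv: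
  assumes c: "c \<in> AP" and u: "u \<in> coord c ` cdom c" and XY: "X \<in> su2" "Y \<in> su2"
  shows "- trace (frechet_derivative (\<lambda>y. conn c y [w]) (at u) v ** commutator X Y) = complex_of_real
    (frechet_derivative (\<lambda>y. \<Omega> c y [fund c X u, fund c Y u, w]) (at u) v
     + \<Omega> c u [fund c X u, frechet_derivative (fund c Y) (at u) v, w] + \<Omega> c u [frechet_derivative (fund c X) (at u) v, fund c Y u, w])"
proof -
  let ?O = "coord c ` cdom c"
  have o: "open ?O" by (rule chart_facts(2)[OF P_chart[OF c]])
  \<comment> \<open>The summand with 0 comes from the constant third argument.\<close>
  let ?D = "\<lambda>v. frechet_derivative (\<lambda>y. \<Omega> c y [fund c X u, fund c Y u, w]) (at u) v
     + \<Omega> c u [fund c X u, fund c Y u, 0]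
     + \<Omega> c u [fund c X u, frechet_derivative (fund c Y) (at u) v, w] + \<Omega> c u [frechet_derivative (fund c X) (at u) v, fund c Y u, w]"
  have 1: "((\<lambda>y. \<Omega> c y [fund c X y, fund c Y y, w]) has_derivative ?D) (at u)"
    by (rule has_derivative_alternating3[OF o u form_alt[OF c] Cinf_on_has_derivative[OF form_smooth[OF c] u]
        Cinf_on_has_derivative[OF fund_smooth[OF c] u] Cinf_on_has_derivative[OF fund_smooth[OF c] u] has_derivative_const])
  have 2: "((\<lambda>y. complex_of_real (\<Omega> c y [fund c X y, fund c Y y, w])) has_derivative (\<lambda>v. complex_of_real (?D v))) (at u)"
    by (rule bounded_linear.has_derivative[OF bounded_linear_of_real 1])
  have bl: "bounded_linear (\<lambda>A :: complex^2^2. - trace (A ** commutator X Y))"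
    by (auto intro!: linear_conv_bounded_linear[THEN iffD1] linearI simp: matrix2_simps complex_eq_iff algebra_simps)
  have 3: "((\<lambda>y. - trace (conn c y [w] ** commutator X Y)) has_derivative
      (\<lambda>v. - trace (frechet_derivative (\<lambda>y. conn c y [w]) (at u) v ** commutator X Y))) (at u)"
    by (rule bounded_linear.has_derivative[OF bl Cinf_on_has_derivative[OF conn_smooth[OF c] u]])
  have "((\<lambda>y. - trace (conn c y [w] ** commutator X Y)) has_derivative (\<lambda>v. complex_of_real (?D v))) (at u)"
  proof (rule has_derivative_transform_within_open[OF 2 o u])
    fix y assume y: "y \<in> ?O"
    note a = alternating3(7,8)[OF form_alt[OF c y]]
    have "\<Omega> c y [fund c X y, fund c Y y, w] = \<Omega> c y [w, fund c X y, fund c Y y]"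
      using a(1)[of w "fund c X y" "fund c Y y"] a(2)[of "fund c X y" w "fund c Y y"] by simp
    then show "complex_of_real (\<Omega> c y [fund c X y, fund c Y y, w]) = - trace (conn c y [w] ** commutator X Y)"
      by (simp only: conn_trace[OF c y XY])
  qed
  from fun_cong[OF has_derivative_unique[OF 3 this], of v]
  show ?thesis using linear_0[OF alternating3(3)[OF form_alt[OF c u]]] by simp
qed

text \<open>For Z = [X, Y] the exterior derivative is computed by \<open>conn_deriv\<close>;
  closedness on (v, w, \<xi>_X, \<xi>_Y) and the invariance identities evaluate the result.\<close>

lemma trace_ext_d_conn:
  assumes c: "c \<in> AP" and u: "u \<in> coord c ` cdom c" and Z: "Z \<in> su2"
  shows "trace (Z ** ext_d conn c u [v, w]) = complex_of_real (\<Omega> c u [fund c Z u, v, w])"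
proof (rule linear_eq_on_su2[OF _ _ _ Z])
  note a = alternating3[OF form_alt[OF c u]]
  show "linear (\<lambda>Z. trace (Z ** ext_d conn c u [v, w]))"
    by (auto intro!: linearI simp: matrix2_simps complex_eq_iff algebra_simps)
  have "linear (\<lambda>Z. \<Omega> c u [fund c Z u, v, w])"
    using linear_compose[OF fund_linear[OF c u] a(1)] by (simp only: o_def)
  from linear_compose[OF this bounded_linear.linear[OF bounded_linear_of_real]]
  show "linear (\<lambda>Z. complex_of_real (\<Omega> c u [fund c Z u, v, w]))" by (simp only: o_def)
  fix X Y assume XY: "X \<in> su2" "Y \<in> su2"
  define p q where "p = fund c X u" and "q = fund c Y u"
  define x where "x = frechet_derivative (fund c X) (at u)"
  define y where "y = frechet_derivative (fund c Y) (at u)"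
  define D where "D = (\<lambda>a b d e. frechet_derivative (\<lambda>y. \<Omega> c y [b, d, e]) (at u) a)"
  have cl: "D v w p q - D w v p q + D p v w q - D q v w p = 0"
    unfolding D_def by (rule form_ext_d[OF c u])
  have cyc: "D v w p q = D v p q w" "D w v p q = D w p q v"
    unfolding D_def using form_deriv_cyclic[OF c u] by metis+
  have lie1: "D p v w q + \<Omega> c u [v, w, x q] + \<Omega> c u [v, x w, q] + \<Omega> c u [x v, w, q] = 0"
    unfolding D_def x_def p_def by (rule invariant_form_Lie[OF form invariant c u])
  have lie2: "D q v w p + \<Omega> c u [v, w, y p] + \<Omega> c u [v, y w, p] + \<Omega> c u [y v, w, p] = 0"
    unfolding D_def y_def q_def by (rule invariant_form_Lie[OF form invariant c u])
  have "\<Omega> c u [v, w, x q] - \<Omega> c u [v, w, y p] = \<Omega> c u [v, w, x q - y p]"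
    by (rule linear_diff[OF a(3), symmetric])
  also have "\<dots> = - \<Omega> c u [v, w, fund c (commutator X Y) u]"
    unfolding x_def y_def p_def q_def fund_bracket[OF c u XY] by (rule linear_neg[OF a(3)])
  also have "\<Omega> c u [v, w, fund c (commutator X Y) u] = \<Omega> c u [fund c (commutator X Y) u, v, w]"
    using a(8)[of v w "fund c (commutator X Y) u"] a(7)[of "fund c (commutator X Y) u" v w] by linarith
  finally have br: "\<Omega> c u [v, w, x q] - \<Omega> c u [v, w, y p] = - \<Omega> c u [fund c (commutator X Y) u, v, w]" .
  have rot: "\<Omega> c u [i, j, k] = \<Omega> c u [j, k, i]" for i j k
    using a(7)[of i j k] a(8)[of j i k] by linarith
  have "trace (commutator X Y ** ext_d conn c u [v, w]) =
    trace (frechet_derivative (\<lambda>y. conn c y [w]) (at u) v ** commutator X Y) - trace (frechet_derivative (\<lambda>y. conn c y [v]) (at u) w ** commutator X Y)"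
    unfolding ext_d_two by (simp add: trace_mul_sym[of "commutator X Y"] matrix_diff_mult trace_sub)
  also have "\<dots> = - (- trace (frechet_derivative (\<lambda>y. conn c y [w]) (at u) v ** commutator X Y)) + (- trace (frechet_derivative (\<lambda>y. conn c y [v]) (at u) w ** commutator X Y))"
    by simp
  also have "\<dots> = complex_of_real (- (D v p q w + \<Omega> c u [p, y v, w] + \<Omega> c u [x v, q, w])
      + (D w p q v + \<Omega> c u [p, y w, v] + \<Omega> c u [x w, q, v]))"
    unfolding conn_deriv[OF c u XY] D_def p_def q_def x_def y_def by simp
  \<comment> \<open>Closedness trades the derivatives along v and w for those along p and q, and
    \<open>lie1\<close>, \<open>lie2\<close> remove the latter. Terms in which a field is
    differentiated along v or w cancel in pairs; the others form the bracket in
    \<open>br\<close>.\<close>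
  also have "- (D v p q w + \<Omega> c u [p, y v, w] + \<Omega> c u [x v, q, w])
      + (D w p q v + \<Omega> c u [p, y w, v] + \<Omega> c u [x w, q, v]) = \<Omega> c u [fund c (commutator X Y) u, v, w]"
    using cl cyc lie1 lie2 br rot[of p "y v" w] a(8)[of "x v" w q] a(9)[of p "y w" v] rot[of v "x w" q]
    by linarith
  finally show "trace (commutator X Y ** ext_d conn c u [v, w]) = complex_of_real (\<Omega> c u [fund c (commutator X Y) u, v, w])" .
qed

subsection \<open>The horizontal part\<close>

definition hor :: "('p, 'f) chart \<Rightarrow> 'f \<Rightarrow> 'f \<Rightarrow> 'f" where
  "hor c u v = v - fund c (conn c u [v]) u"

definition hform :: "('p, 'f, real) form" where
  "hform c u vs = \<Omega> c u (map (hor c u) vs)"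

lemma hor_linear:
  assumes "c \<in> AP" "u \<in> coord c ` cdom c"
  shows "linear (hor c u)"
  using linear_compose_sub[OF linear_ident linear_compose[OF conn_linear[OF assms] fund_linear[OF assms]]]
  by (simp only: hor_def[abs_def] o_def)

lemma hor_fund: "c \<in> AP \<Longrightarrow> u \<in> coord c ` cdom c \<Longrightarrow> X \<in> su2 \<Longrightarrow> hor c u (fund c X u) = 0"
  by (simp add: hor_def conn_fund)

lemma hor_act:
  assumes c: "c \<in> AP" "c' \<in> AP" and g: "g \<in> SU2" and u: "u \<in> coord c ` cdom c" "act (param c u) g \<in> cdom c'"
  shows "hor c' (coord c' (act (param c u) g)) (dmap (\<lambda>q. act q g) c c' u v) = dmap (\<lambda>q. act q g) c c' u (hor c u v)"
  unfolding hor_def linear_diff[OF dmap_linear[OF smooth_map_act[OF g] total_atlas total_atlas open_UNIV c u(1) UNIV_I u(2)]]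
    conn_act[OF c g u] act_fund[OF c g u] ..

lemma hform_act:
  assumes c: "c \<in> AP" "c' \<in> AP" and g: "g \<in> SU2" and u: "u \<in> coord c ` cdom c" "act (param c u) g \<in> cdom c'"
    and l: "length vs = 3"
  shows "hform c' (coord c' (act (param c u) g)) (map (dmap (\<lambda>q. act q g) c c' u) vs) = hform c u vs"
proof -
  have "map (hor c' (coord c' (act (param c u) g))) (map (dmap (\<lambda>q. act q g) c c' u) vs)
      = map (dmap (\<lambda>q. act q g) c c' u) (map (hor c u) vs)"
    by (simp add: hor_act[OF c g u])
  then show ?thesis
    unfolding hform_def by (simp only: invariant_form_transform[OF form invariant c g u] length_map l)
qed

lemma hor_smooth:
  assumes c: "c \<in> AP"
  shows "Cinf_on (coord c ` cdom c) (\<lambda>u. hor c u v)"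
proof -
  let ?O = "coord c ` cdom c"
  note o = chart_facts(2)[OF P_chart[OF c]]
  have "Cinf_on ?O (\<lambda>u. v - (\<Omega> c u [v, fund c (su2_mat 0 1 0) u, fund c (su2_mat 0 0 1) u] *\<^sub>R fund c (su2_mat (1/4) 0 0) u
    + \<Omega> c u [v, fund c (su2_mat 0 0 1) u, fund c (su2_mat 1 0 0) u] *\<^sub>R fund c (su2_mat 0 (1/4) 0) u
    + \<Omega> c u [v, fund c (su2_mat 1 0 0) u, fund c (su2_mat 0 1 0) u] *\<^sub>R fund c (su2_mat 0 0 (1/4)) u))"
    by (rule Cinf_on_diff[OF o Cinf_on_const] Cinf_on_add[OF o] Cinf_on_scaleR[OF o] pairing_smooth[OF c] fund_smooth[OF c])+
  then show ?thesis
    by (rule Cinf_on_cong[OF o])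
      (simp add: hor_def conn_expand linear_add[OF fund_linear[OF c]] linear_cmul[OF fund_linear[OF c]])
qed

lemma hform_form: "k_form AP UNIV 3 hform"
proof (rule k_formI[OF total_atlas open_UNIV])
  fix c u assume c: "c \<in> AP" and u: "u \<in> coord c ` cdom c"
  show "alternating 3 (hform c u)"
    using alternating_map[OF form_alt[OF c u] hor_linear[OF c u]] by (simp only: hform_def[abs_def])
next
  fix c u0 and vs :: "'f list" assume c: "c \<in> AP" and u0: "u0 \<in> coord c ` cdom c" and l: "length vs = 3"
  note o = chart_facts(2)[OF P_chart[OF c]]
  have "Cinf_on (coord c ` cdom c) (\<lambda>u. \<Omega> c u (map (\<lambda>f. f u) (map (\<lambda>v u. hor c u v) vs) @ []))"
  proof (rule Cinf_on_alternating_family[OF o form_alt[OF c] form_smooth[OF c]])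
    fix f assume "f \<in> set (map (\<lambda>v u. hor c u v) vs)"
    then obtain v where "f = (\<lambda>u. hor c u v)" by auto
    then show "Cinf_on (coord c ` cdom c) f" by (simp only: hor_smooth[OF c])
  qed (use l in simp_all)
  then have "Cinf_on (coord c ` cdom c) (\<lambda>u. hform c u vs)"
    by (simp add: hform_def o_def)
  then show "\<exists>N. open N \<and> u0 \<in> N \<and> Cinf_on N (\<lambda>u. hform c u vs)"
    using o u0 by blast
next
  fix c c' u and vs :: "'f list"
  assume c: "c \<in> AP" "c' \<in> AP" and u: "u \<in> coord c ` cdom c" "param c u \<in> cdom c'" and l: "length vs = 3"
  show "hform c u vs = hform c' (coord c' (param c u)) (map (dmap (\<lambda>x. x) c c' u) vs)"
    using hform_act[OF c mat_1_SU2 u(1) _ l] u(2) by (simp only: act_one)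
qed

lemma form_decomposition:
  assumes c: "c \<in> AP" and u: "u \<in> coord c ` cdom c"
  shows "complex_of_real (\<Omega> c u [v1, v2, v3]) = chern_simons conn c u [v1, v2, v3] + complex_of_real (hform c u [v1, v2, v3])"
proof -
  note a = alternating3[OF form_alt[OF c u]]
  define W where "W v = conn c u [v]" for v
  define \<xi> where "\<xi> v = fund c (W v) u" for v
  have W: "W v \<in> su2" for v by (simp add: W_def)
  \<comment> \<open>With this sign t is Tr(W(v1) [W(v2), W(v3)]).\<close>
  define t where "t = - \<Omega> c u [v1, \<xi> v2, \<xi> v3]"
  have rot: "\<Omega> c u [i, j, k] = \<Omega> c u [j, k, i]" for i j k
    using a(7)[of i j k] a(8)[of j i k] by linarith
  have tr: "complex_of_real (\<Omega> c u [v, \<xi> i, \<xi> j]) = - trace (W v ** commutator (W i) (W j))" for v i j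
    unfolding \<xi>_def W_def by (rule conn_trace[OF c u]) simp_all
  have t1: "trace (W v1 ** commutator (W v2) (W v3)) = complex_of_real t"
    using tr[of v1 v2 v3] by (simp add: t_def)
  have "complex_of_real (\<Omega> c u [v2, \<xi> v3, \<xi> v1]) = complex_of_real (- t)"
    unfolding tr using t1 trace_commutator_cyclic(1)[of "W v2" "W v3" "W v1"] by simp
  then have t2: "\<Omega> c u [v2, \<xi> v3, \<xi> v1] = - t" by (simp only: of_real_eq_iff)
  have "complex_of_real (\<Omega> c u [v3, \<xi> v1, \<xi> v2]) = complex_of_real (- t)"
    unfolding tr using t1 trace_commutator_cyclic(1)[of "W v3" "W v1" "W v2"] trace_commutator_cyclic(1)[of "W v2" "W v3" "W v1"] by simp
  then have t3: "\<Omega> c u [v3, \<xi> v1, \<xi> v2] = - t" by (simp only: of_real_eq_iff)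
  have W\<xi>: "W (\<xi> v1) = W v1" unfolding \<xi>_def unfolding W_def[of "fund c (W v1) u"] by (rule conn_fund[OF c u W])
  have "complex_of_real (\<Omega> c u [\<xi> v1, \<xi> v2, \<xi> v3]) = complex_of_real (- t)"
    unfolding tr W\<xi> using t1 by simp
  then have t4: "\<Omega> c u [\<xi> v1, \<xi> v2, \<xi> v3] = - t" by (simp only: of_real_eq_iff)
  have cs: "chern_simons conn c u [v1, v2, v3] = complex_of_real
     (\<Omega> c u [\<xi> v1, v2, v3] + \<Omega> c u [\<xi> v2, v3, v1] + \<Omega> c u [\<xi> v3, v1, v2] + 2 * t)"
  proof -
    have "trace (W v ** ext_d conn c u [i, j]) = complex_of_real (\<Omega> c u [\<xi> v, i, j])" for v i j
      unfolding \<xi>_def by (rule trace_ext_d_conn[OF c u W])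
    then show ?thesis unfolding chern_simons_eq W_def[symmetric] t1 by simp
  qed
  have sub: "\<Omega> c u [i - i', j, k] = \<Omega> c u [i, j, k] - \<Omega> c u [i', j, k]"
    "\<Omega> c u [i, j - j', k] = \<Omega> c u [i, j, k] - \<Omega> c u [i, j', k]"
    "\<Omega> c u [i, j, k - k'] = \<Omega> c u [i, j, k] - \<Omega> c u [i, j, k']" for i j k i' j' k'
    by (rule linear_diff[OF a(1)] linear_diff[OF a(2)] linear_diff[OF a(3)])+
  have "hform c u [v1, v2, v3] = \<Omega> c u [v1 - \<xi> v1, v2 - \<xi> v2, v3 - \<xi> v3]"
    by (simp add: hform_def hor_def \<xi>_def W_def)
  \<comment> \<open>Multilinear expansion: each of the three terms with two vertical arguments is
    -t, the one with three contributes +t after its sign, in total -2t. This matches the coefficient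
    2 in \<open>chern_simons_eq\<close>.\<close>
  also have "\<dots> = \<Omega> c u [v1, v2, v3] - (\<Omega> c u [\<xi> v1, v2, v3] + \<Omega> c u [\<xi> v2, v3, v1] + \<Omega> c u [\<xi> v3, v1, v2] + 2 * t)"
    unfolding sub using rot[of v1 "\<xi> v2" v3] rot[of v1 v2 "\<xi> v3"] rot[of v2 "\<xi> v3" v1] rot[of "\<xi> v3" v1 v2]
      rot[of "\<xi> v1" v2 "\<xi> v3"] rot[of "\<xi> v1" "\<xi> v2" v3] rot[of "\<xi> v2" v3 "\<xi> v1"] t2 t3 t4 t_def
    by linarith
  finally show ?thesis unfolding cs by (simp add: of_real_diff[symmetric] of_real_add[symmetric] del: of_real_diff of_real_add)
qed

end

section \<open>Descent to the base\<close>

context invariant_CS_form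
begin

lemma fibre_coord_derivative_su2:
  assumes t: "local_triv AM AP \<pi> act U s \<gamma>" and c: "c \<in> AP" and u: "u \<in> coord c ` cdom c" "\<pi> (param c u) \<in> U"
  shows "matrix_inv (\<gamma> (param c u)) ** frechet_derivative (\<gamma> \<circ> param c) (at u) v \<in> su2"
proof -
  note iff = chart_image_iff(1)[OF P_chart[OF c]]
  have "matrix_inv ((\<gamma> \<circ> param c) u) ** frechet_derivative (\<gamma> \<circ> param c) (at u) v \<in> su2"
  proof (rule SU2_valued_derivative[OF fibre_coord_has_derivative[OF t c u] open_chart_image[OF P_chart[OF c] local_trivD(4)[OF t]]])
    show "u \<in> coord c ` (cdom c \<inter> \<pi> -` U)" by (simp only: iff u vimage_eq simp_thms)
    fix y assume "y \<in> coord c ` (cdom c \<inter> \<pi> -` U)"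
    then have "\<pi> (param c y) \<in> U" by (simp only: iff vimage_eq)
    then show "(\<gamma> \<circ> param c) y \<in> SU2" unfolding o_apply by (rule local_trivD(5)[OF t])
  qed
  then show ?thesis by (simp only: o_apply)
qed

lemma conn_su2_connection: "su2_connection AM AP \<pi> act conn"
  unfolding su2_connection_def
proof (intro conjI allI impI ballI conn_form conn_su2)
  fix U s \<gamma> assume t: "local_triv AM AP \<pi> act U s \<gamma>"
  note tD = local_trivD[OF t]
  \<comment> \<open>The base form of a connection in a trivialisation is its pullback by the
    section.\<close>
  define w :: "('m, 'e, complex^2^2) form" where "w = pullback AP s conn"
  have w: "k_form AM U 1 w"
    unfolding w_def by (rule k_form_pullback[OF tD(2) base_atlas total_atlas tD(1) open_UNIV conn_form subset_UNIV])
  have wsu: "w c u [v] \<in> su2" for c u v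
    unfolding w_def pullback_def Let_def by (rule conn_su2)
  have eq: "conn c u [v] = matrix_inv (\<gamma> (param c u)) ** pullback AM \<pi> w c u [v] ** \<gamma> (param c u) + maurer_cartan \<gamma> c u [v]"
    if c: "c \<in> AP" and uU: "u \<in> coord c ` (cdom c \<inter> \<pi> -` U)" for c u v
  proof -
    let ?q = "param c u"
    have u: "u \<in> coord c ` cdom c" "\<pi> ?q \<in> U"
      using uU by (simp_all only: chart_image_iff(1)[OF P_chart[OF c]] vimage_eq)
    let ?g = "\<gamma> ?q"
    obtain cM where cM: "cM \<in> AM" "\<pi> ?q \<in> cdom cM" using atlas_cover[OF base_atlas] by blast
    obtain cP where cP: "cP \<in> AP" "s (\<pi> ?q) \<in> cdom cP" using atlas_cover[OF total_atlas] by blast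
    let ?x = "coord cM (\<pi> ?q)" and ?y = "coord cP (s (\<pi> ?q))"
    have px: "param cM ?x = \<pi> ?q" by (rule chart_facts(6)[OF M_chart[OF cM(1)] cM(2)])
    have py: "param cP ?y = s (\<pi> ?q)" by (rule chart_facts(6)[OF P_chart[OF cP(1)] cP(2)])
    have g: "?g \<in> SU2" by (rule tD(5)[OF u(2)])
    have q: "act (param cP ?y) ?g = ?q" unfolding py by (rule tD(8)[OF u(2)])
    have qc: "act (param cP ?y) ?g \<in> cdom c" unfolding q by (rule chart_facts(8)[OF P_chart[OF c] u(1)])
    let ?z = "dmap s cM cP ?x (dmap \<pi> c cM u v)" and ?m = "matrix_inv ?g ** frechet_derivative (\<gamma> \<circ> param c) (at u) v"
    have m: "?m \<in> su2" by (rule fibre_coord_derivative_su2[OF t c u])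
    have "pullback AM \<pi> w c u [v] = w cM ?x (map (dmap \<pi> c cM u) [v])"
      by (rule pullback_eq[OF proj_smooth total_atlas base_atlas open_UNIV tD(1) w c cM(1) u(1) UNIV_I cM(2) u(2)]) simp
    also have "\<dots> = conn cP (coord cP (s (param cM ?x))) (map (dmap s cM cP ?x) (map (dmap \<pi> c cM u) [v]))"
      unfolding w_def
      by (rule pullback_eq[OF tD(2) base_atlas total_atlas tD(1) open_UNIV conn_form cM(1) cP(1) imageI[OF cM(2)]])
        (simp_all only: px u(2) cP(2) UNIV_I length_map list.size One_nat_def)
    finally have pb: "pullback AM \<pi> w c u [v] = conn cP ?y [?z]" by (simp only: px list.map)
    \<comment> \<open>The translated piece gives the conjugated term by equivariance, the vertical
      piece gives the Maurer-Cartan term.\<close>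
    have "conn c u [v] = conn c u [dmap (\<lambda>q. act q ?g) cP c ?y ?z + fund c ?m u]"
      using tangent_decomposition[OF t c cP(1) cM(1) u cM(2) cP(2), of v] by simp
    also have "\<dots> = conn c u [dmap (\<lambda>q. act q ?g) cP c ?y ?z] + conn c u [fund c ?m u]"
      by (rule linear_add[OF conn_linear[OF c u(1)]])
    also have "conn c u [fund c ?m u] = ?m" by (rule conn_fund[OF c u(1) m])
    also have "conn c u [dmap (\<lambda>q. act q ?g) cP c ?y ?z] = matrix_inv ?g ** conn cP ?y [?z] ** ?g"
      using conn_act[OF cP(1) c g imageI[OF cP(2)] qc, of ?z]
      by (simp only: q chart_facts(7)[OF P_chart[OF c] u(1)])
    finally show ?thesis by (simp only: pb maurer_cartan_def nth_Cons_0)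
  qed
  show "\<exists>w. k_form AM U 1 w \<and> (\<forall>c\<in>AM. \<forall>u\<in>coord c ` (cdom c \<inter> U). \<forall>v. w c u [v] \<in> su2) \<and>
      (\<forall>c\<in>AP. \<forall>u\<in>coord c ` (cdom c \<inter> \<pi> -` U). \<forall>v. conn c u [v] =
        matrix_inv (\<gamma> (param c u)) ** pullback AM \<pi> w c u [v] ** \<gamma> (param c u) + maurer_cartan \<gamma> c u [v])"
    by (rule exI[of _ w], intro conjI ballI allI w wsu eq)
qed

text \<open>\<open>hor\<close> kills the vertical piece of each argument and \<open>hform\<close> is
  invariant, so the value at q can be computed at s(\<pi> q) from the projected vectors.\<close>

lemma hform_pullback:
  assumes t: "local_triv AM AP \<pi> act U s \<gamma>" and c: "c \<in> AP" "cM \<in> AM"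
    and u: "u \<in> coord c ` cdom c" "\<pi> (param c u) \<in> U" "\<pi> (param c u) \<in> cdom cM" and l: "length vs = 3"
  shows "hform c u vs = pullback AP s hform cM (coord cM (\<pi> (param c u))) (map (dmap \<pi> c cM u) vs)"
proof -
  note tD = local_trivD[OF t]
  let ?q = "param c u"
  let ?g = "\<gamma> ?q"
  obtain cP where cP: "cP \<in> AP" "s (\<pi> ?q) \<in> cdom cP" using atlas_cover[OF total_atlas] by blast
  let ?x = "coord cM (\<pi> ?q)" and ?y = "coord cP (s (\<pi> ?q))"
  have px: "param cM ?x = \<pi> ?q" by (rule chart_facts(6)[OF M_chart[OF c(2)] u(3)])
  have py: "param cP ?y = s (\<pi> ?q)" by (rule chart_facts(6)[OF P_chart[OF cP(1)] cP(2)])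
  have g: "?g \<in> SU2" by (rule tD(5)[OF u(2)])
  have q: "act (param cP ?y) ?g = ?q" unfolding py by (rule tD(8)[OF u(2)])
  have qc: "act (param cP ?y) ?g \<in> cdom c" unfolding q by (rule chart_facts(8)[OF P_chart[OF c(1)] u(1)])
  let ?R = "dmap (\<lambda>q. act q ?g) cP c ?y" and ?z = "\<lambda>v. dmap s cM cP ?x (dmap \<pi> c cM u v)"
  have "hor c u v = hor c u (?R (?z v))" for v
  proof -
    let ?m = "matrix_inv ?g ** frechet_derivative (\<gamma> \<circ> param c) (at u) v"
    have m: "?m \<in> su2" by (rule fibre_coord_derivative_su2[OF t c(1) u(1,2)])
    have "hor c u v = hor c u (?R (?z v) + fund c ?m u)"
      using tangent_decomposition[OF t c(1) cP(1) c(2) u cP(2), of v] by simp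
    then show ?thesis
      unfolding linear_add[OF hor_linear[OF c(1) u(1)]] hor_fund[OF c(1) u(1) m] by simp
  qed
  then have "map (hor c u) vs = map (hor c u) (map ?R (map ?z vs))" by simp
  then have "hform c u vs = hform c u (map ?R (map ?z vs))" by (simp only: hform_def)
  also have "\<dots> = hform cP ?y (map ?z vs)"
    using hform_act[OF cP(1) c(1) g imageI[OF cP(2)] qc, of "map ?z vs"] l
    by (simp only: q chart_facts(7)[OF P_chart[OF c(1)] u(1)] length_map)
  also have "\<dots> = hform cP (coord cP (s (param cM ?x))) (map (dmap s cM cP ?x) (map (dmap \<pi> c cM u) vs))"
    by (simp add: px o_def)
  also have "\<dots> = pullback AP s hform cM ?x (map (dmap \<pi> c cM u) vs)"
    by (rule pullback_eq[OF tD(2) base_atlas total_atlas tD(1) open_UNIV hform_form c(2) cP(1) imageI[OF u(3)], symmetric])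
      (simp_all only: px u(2) cP(2) UNIV_I length_map l)
  finally show ?thesis .
qed

text \<open>Evaluate \<open>hform\<close> at s'(x) through s by \<open>hform_pullback\<close>; the
  base vectors return unchanged because \<pi> after s' is the identity.\<close>

lemma section_pullback_unique:
  assumes t: "local_triv AM AP \<pi> act U s \<gamma>" and t': "local_triv AM AP \<pi> act U' s' \<gamma>'"
    and c: "cM \<in> AM" and u: "u \<in> coord cM ` cdom cM" "param cM u \<in> U" "param cM u \<in> U'" and l: "length vs = 3"
  shows "pullback AP s' hform cM u vs = pullback AP s hform cM u vs"
proof -
  note tD = local_trivD[OF t] and tD' = local_trivD[OF t']
  let ?x = "param cM u"
  obtain cP where cP: "cP \<in> AP" "s' ?x \<in> cdom cP" using atlas_cover[OF total_atlas] by blast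
  let ?y = "coord cP (s' ?x)"
  have py: "param cP ?y = s' ?x" by (rule chart_facts(6)[OF P_chart[OF cP(1)] cP(2)])
  have \<pi>: "\<pi> (s' ?x) = ?x" by (rule tD'(6)[OF u(3)])
  have xc: "?x \<in> cdom cM" by (rule chart_facts(8)[OF M_chart[OF c] u(1)])
  have id: "dmap \<pi> cP cM ?y (dmap s' cM cP u v) = v" for v
  proof -
    have "dmap \<pi> cP cM ?y (dmap s' cM cP u v) = dmap (\<lambda>x. \<pi> (s' x)) cM cM u v"
      by (rule dmap_chain[OF tD'(2) proj_smooth base_atlas total_atlas base_atlas tD'(1) open_UNIV c cP(1) c u(1,3) cP(2) UNIV_I, symmetric])
        (simp only: \<pi> xc)
    also have "dmap (\<lambda>x. \<pi> (s' x)) cM cM u = dmap (\<lambda>x. x) cM cM u"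
      by (rule dmap_cong[OF M_chart[OF c] tD'(1) u(1,3)]) (rule tD'(6))
    finally show ?thesis by (simp only: dmap_id_same[OF M_chart[OF c] u(1)])
  qed
  have "pullback AP s' hform cM u vs = hform cP ?y (map (dmap s' cM cP u) vs)"
    by (rule pullback_eq[OF tD'(2) base_atlas total_atlas tD'(1) open_UNIV hform_form c cP(1) u(1,3) cP(2) UNIV_I l])
  also have "\<dots> = pullback AP s hform cM (coord cM (\<pi> (param cP ?y))) (map (dmap \<pi> cP cM ?y) (map (dmap s' cM cP u) vs))"
    by (rule hform_pullback[OF t cP(1) c imageI[OF cP(2)]]) (simp_all only: py \<pi> u(2) xc length_map l)
  also have "\<dots> = pullback AP s hform cM u vs"
    by (simp add: py \<pi> chart_facts(7)[OF M_chart[OF c] u(1)] o_def id)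
  finally show ?thesis .
qed

section \<open>Gluing the local forms on the base\<close>

definition local_section :: "'m \<Rightarrow> 'm \<Rightarrow> 'p" where
  "local_section x = (SOME s. \<exists>U \<gamma>. x \<in> U \<and> local_triv AM AP \<pi> act U s \<gamma>)"

text \<open>The section may vary arbitrarily with the point; \<open>base_form_eq\<close> replaces it
  by one fixed section over an open set, where smoothness and the transformation law are
  inherited.\<close>

definition base_form :: "('m, 'e, real) form" where
  "base_form c u vs = pullback AP (local_section (param c u)) hform c u vs"

lemma base_form_eq:
  assumes t: "local_triv AM AP \<pi> act U s \<gamma>" and c: "c \<in> AM" and u: "u \<in> coord c ` cdom c" "param c u \<in> U"
    and l: "length vs = 3"
  shows "base_form c u vs = pullback AP s hform c u vs"
proof -
  have "\<exists>s U \<gamma>. param c u \<in> U \<and> local_triv AM AP \<pi> act U s \<gamma>" using locally_trivial by blast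
  then have "\<exists>U \<gamma>. param c u \<in> U \<and> local_triv AM AP \<pi> act U (local_section (param c u)) \<gamma>"
    unfolding local_section_def by (rule someI_ex)
  then obtain U' \<gamma>' where "param c u \<in> U'" "local_triv AM AP \<pi> act U' (local_section (param c u)) \<gamma>'" by blast
  from section_pullback_unique[OF t this(2) c u this(1) l] show ?thesis by (simp only: base_form_def)
qed

lemma base_form_form: "k_form AM UNIV 3 base_form"
proof (rule k_formI[OF base_atlas open_UNIV])
  fix c u assume c: "c \<in> AM" and u: "u \<in> coord c ` cdom c"
  obtain U s \<gamma> where U: "param c u \<in> U" and t: "local_triv AM AP \<pi> act U s \<gamma>"
    using locally_trivial by blast
  note tD = local_trivD[OF t]
  have k: "k_form AM U 3 (pullback AP s hform)"
    by (rule k_form_pullback[OF tD(2) base_atlas total_atlas tD(1) open_UNIV hform_form subset_UNIV])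
  show "alternating 3 (base_form c u)"
    by (rule alternating_cong[OF k_formD(1)[OF k base_atlas tD(1) c u U]]) (rule base_form_eq[OF t c u U, symmetric])
next
  fix c u0 and vs :: "'e list" assume c: "c \<in> AM" and u0: "u0 \<in> coord c ` cdom c" and l: "length vs = 3"
  obtain U s \<gamma> where U: "param c u0 \<in> U" and t: "local_triv AM AP \<pi> act U s \<gamma>"
    using locally_trivial by blast
  note tD = local_trivD[OF t]
  have k: "k_form AM U 3 (pullback AP s hform)"
    by (rule k_form_pullback[OF tD(2) base_atlas total_atlas tD(1) open_UNIV hform_form subset_UNIV])
  let ?N = "coord c ` (cdom c \<inter> U)"
  have o: "open ?N" by (rule open_chart_image[OF M_chart[OF c] tD(1)])
  have "Cinf_on ?N (\<lambda>u. base_form c u vs)"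
  proof (rule Cinf_on_cong[OF o k_formD(2)[OF k base_atlas tD(1) c l]])
    fix u assume "u \<in> ?N"
    then have "u \<in> coord c ` cdom c" "param c u \<in> U" by (simp_all only: chart_image_iff(1)[OF M_chart[OF c]])
    then show "pullback AP s hform c u vs = base_form c u vs" by (rule base_form_eq[OF t c _ _ l, symmetric])
  qed
  moreover have "u0 \<in> ?N" by (simp only: chart_image_iff(1)[OF M_chart[OF c]] u0 U simp_thms)
  ultimately show "\<exists>N. open N \<and> u0 \<in> N \<and> Cinf_on N (\<lambda>u. base_form c u vs)"
    using o by blast
next
  fix c c' u and vs :: "'e list"
  assume c: "c \<in> AM" "c' \<in> AM" and u: "u \<in> coord c ` cdom c" "param c u \<in> cdom c'" and l: "length vs = 3"
  obtain U s \<gamma> where U: "param c u \<in> U" and t: "local_triv AM AP \<pi> act U s \<gamma>"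
    using locally_trivial by blast
  note tD = local_trivD[OF t]
  have k: "k_form AM U 3 (pullback AP s hform)"
    by (rule k_form_pullback[OF tD(2) base_atlas total_atlas tD(1) open_UNIV hform_form subset_UNIV])
  have p: "param c' (coord c' (param c u)) = param c u" by (rule chart_facts(6)[OF M_chart[OF c(2)] u(2)])
  have "base_form c' (coord c' (param c u)) (map (dmap (\<lambda>x. x) c c' u) vs)
    = pullback AP s hform c' (coord c' (param c u)) (map (dmap (\<lambda>x. x) c c' u) vs)"
    by (rule base_form_eq[OF t c(2) imageI[OF u(2)]]) (simp_all only: p U length_map l)
  then show "base_form c u vs = base_form c' (coord c' (param c u)) (map (dmap (\<lambda>x. x) c c' u) vs)"
    using k_formD(3)[OF k base_atlas tD(1) c u U l] base_form_eq[OF t c(1) u(1) U l] by simp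
qed

lemma pullback_base_form:
  assumes c: "c \<in> AP" and u: "u \<in> coord c ` cdom c" and l: "length vs = 3"
  shows "pullback AM \<pi> base_form c u vs = hform c u vs"
proof -
  let ?x = "\<pi> (param c u)"
  obtain cM where cM: "cM \<in> AM" "?x \<in> cdom cM" using atlas_cover[OF base_atlas] by blast
  obtain U s \<gamma> where U: "?x \<in> U" and t: "local_triv AM AP \<pi> act U s \<gamma>"
    using locally_trivial by blast
  have px: "param cM (coord cM ?x) = ?x" by (rule chart_facts(6)[OF M_chart[OF cM(1)] cM(2)])
  have "pullback AM \<pi> base_form c u vs = base_form cM (coord cM ?x) (map (dmap \<pi> c cM u) vs)"
    by (rule pullback_eq[OF proj_smooth total_atlas base_atlas open_UNIV open_UNIV base_form_form c cM(1) u UNIV_I cM(2) UNIV_I l])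
  also have "\<dots> = pullback AP s hform cM (coord cM ?x) (map (dmap \<pi> c cM u) vs)"
    by (rule base_form_eq[OF t cM(1) imageI[OF cM(2)]]) (simp_all only: px U length_map l)
  also have "\<dots> = hform c u vs" by (rule hform_pullback[OF t c cM(1) u U cM(2) l, symmetric])
  finally show ?thesis .
qed

end

lemma k_form_zero: "smooth_atlas A \<Longrightarrow> k_form A UNIV k (\<lambda>c u vs. 0)"
proof (rule k_formI[OF _ open_UNIV alternating_zero _ refl])
  fix c u0 assume "smooth_atlas A" "c \<in> A"
  show "\<exists>N. open N \<and> u0 \<in> N \<and> Cinf_on N (\<lambda>u. 0)"
    by (intro exI[of _ UNIV] conjI open_UNIV UNIV_I Cinf_on_const)
qed

theorem proposition7:
  fixes AM :: "('m::{t2_space,second_countable_topology}, real^3) chart set"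
    and AP :: "('p::{t2_space,second_countable_topology}, real^6) chart set"
    and \<pi> :: "'p \<Rightarrow> 'm"
    and act :: "'p \<Rightarrow> complex^2^2 \<Rightarrow> 'p"
    and \<Omega> :: "('p, real^6, real) form"
  assumes "principal_SU2_bundle AM AP \<pi> act"
    and "k_form AP UNIV 3 \<Omega>"
    and "closed_form AP 3 \<Omega>"
    and "invariant_form AP act 3 \<Omega>"
    and "fibre_normalised AM AP \<pi> act \<Omega>"
  shows "\<exists>W (\<omega> :: ('m, real^3, real) form) (b :: ('m, real^3, real) form).
    su2_connection AM AP \<pi> act W \<and>
    k_form AM UNIV 3 \<omega> \<and> closed_form AM 3 \<omega> \<and>
    k_form AM UNIV 2 b \<and>
    form_eq AP 3 (\<lambda>c u vs. complex_of_real (\<Omega> c u vs))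
      (\<lambda>c u vs. chern_simons W c u vs
         + complex_of_real (pullback AM \<pi> \<omega> c u vs)
         + complex_of_real (pullback AM \<pi> (ext_d b) c u vs))"
proof -
  interpret invariant_CS_form AM AP \<pi> act \<Omega>
    by (intro invariant_CS_form.intro invariant_CS_form_axioms.intro assms)
  let ?b = "\<lambda>c u vs. 0 :: real"
  have b: "pullback AM \<pi> (ext_d ?b) c u vs = 0" for c :: "('p, real^6) chart" and u vs
    by (simp add: pullback_def ext_d_def Let_def)
  have "form_eq AP 3 (\<lambda>c u vs. complex_of_real (\<Omega> c u vs))
      (\<lambda>c u vs. chern_simons conn c u vs + complex_of_real (pullback AM \<pi> base_form c u vs)
         + complex_of_real (pullback AM \<pi> (ext_d ?b) c u vs))"
    unfolding form_eq_def
  proof (intro ballI allI impI)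
    fix c u and vs :: "(real^6) list" assume c: "c \<in> AP" and u: "u \<in> coord c ` cdom c" and l: "length vs = 3"
    then obtain v1 v2 v3 where vs: "vs = [v1, v2, v3]" by (auto simp: length_Suc_conv numeral_3_eq_3)
    show "complex_of_real (\<Omega> c u vs) = chern_simons conn c u vs + complex_of_real (pullback AM \<pi> base_form c u vs)
         + complex_of_real (pullback AM \<pi> (ext_d ?b) c u vs)"
      unfolding b pullback_base_form[OF c u l] unfolding vs form_decomposition[OF c u] by simp
  qed
  then show ?thesis
    using conn_su2_connection base_form_form closed_form_top_degree[OF base_form_form base_atlas]
      k_form_zero[OF base_atlas] by blast
qed

end
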